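(* Suppose $j\in\{1,2,\ldots,2n\}$ and let $R_j:=X_j(-\Delta_{\mathbb H^n})^{-\frac12}$ be the $j$-th Riesz transform on the Heisenberg group $\mathbb H^n$. Let $K_j(g)$, $g\in\mathbb H^n$, be the (convolution) kernel of $R_j$. Then $$K_j(g)\neq0\quad\text{for a.e. } g\in\mathbb H^n.$$
   Context: The Heisenberg group $\mathbb H^n$ ($n\ge1$) is $\mathbb C^n\times\mathbb R\cong\mathbb R^{2n+1}$ with points $[x,y,t]$, $x,y\in\mathbb R^n$, $t\in\mathbb R$, and group law $[x,y,t]\circ[x',y',t']=[x+x',y+y',t+t'+2\langle y,x'\rangle-2\langle x,y'\rangle]$. Haar measure is Lebesgue measure. Left-invariant vector fields: $X_j=\frac{\partial}{\partial x_j}+2y_j\frac{\partial}{\partial t}$ and $X_{n+j}=Y_j=\frac{\partial}{\partial y_j}-2x_j\frac{\partial}{\partial t}$ for $j=1,\ldots,n$. The sub-Laplacian is $\Delta_{\mathbb H^n}=\sum_{j=1}^{2n}X_j^2$. The convolution kernel of $R_j$ is $K_j(g)=\frac1{\sqrt\pi}\int_0^\infty h^{-1/2}X_jp_h(g)\,dh$ for $g\ne0$, where $p_h$ is the heat kernel (convolution kernel of $e^{h\Delta_{\mathbb H^n}}$); $K_j\in C^\infty(\mathbb H^n\setminus\{0\})$. *)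

theory Defs
  imports "HOL-Analysis.Analysis"
begin

section \<open>The Heisenberg group and its sub-Laplacian\<close>

text \<open>Points \<open>[x, y, t]\<close> of the Heisenberg group of dimension \<open>2n + 1\<close> with \<open>n = CARD('n)\<close>.
  Its Haar measure is \<^term>\<open>lborel\<close>, its identity is \<open>0\<close>, and the inverse of \<open>g\<close> is \<open>- g\<close>.\<close>

type_synonym 'n heis = "(real ^ 'n) \<times> (real ^ 'n) \<times> real"

fun heis_mult :: "'n::finite heis \<Rightarrow> 'n heis \<Rightarrow> 'n heis" where
  "heis_mult (x, y, t) (x', y', t') = (x + x', y + y', t + t' + 2 * (y \<bullet> x') - 2 * (x \<bullet> y'))"

text \<open>The \<open>2n\<close> left-invariant fields are indexed by the type \<^typ>\<open>'n + 'n\<close>: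
  \<open>Inl i\<close> stands for \<open>X\<^sub>i\<close> and \<open>Inr i\<close> for \<open>X\<^sub>n\<^sub>+\<^sub>i = Y\<^sub>i\<close>.\<close>

fun heis_field :: "'n::finite + 'n \<Rightarrow> ('n heis \<Rightarrow> real) \<Rightarrow> 'n heis \<Rightarrow> real" where
  "heis_field (Inl i) f (x, y, t) =
     deriv (\<lambda>s. f (x + s *\<^sub>R axis i 1, y, t)) 0 + 2 * (y $ i) * deriv (\<lambda>s. f (x, y, s)) t"
| "heis_field (Inr i) f (x, y, t) =
     deriv (\<lambda>s. f (x, y + s *\<^sub>R axis i 1, t)) 0 - 2 * (x $ i) * deriv (\<lambda>s. f (x, y, s)) t"

definition sub_laplacian :: "('n::finite heis \<Rightarrow> real) \<Rightarrow> 'n heis \<Rightarrow> real" where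
  "sub_laplacian f g = (\<Sum>j\<in>UNIV. heis_field j (heis_field j f) g)"

section \<open>Test functions and square-integrable functions\<close>

primrec times_continuously_differentiable ::
    "nat \<Rightarrow> ('a::real_normed_vector \<Rightarrow> real) \<Rightarrow> bool" where
  "times_continuously_differentiable 0 f \<longleftrightarrow> continuous_on UNIV f"
| "times_continuously_differentiable (Suc k) f \<longleftrightarrow>
     (\<forall>x. f differentiable (at x)) \<and>
     (\<forall>v. times_continuously_differentiable k (\<lambda>x. frechet_derivative f (at x) v))"

definition smooth :: "('a::real_normed_vector \<Rightarrow> real) \<Rightarrow> bool" where
  "smooth f \<longleftrightarrow> (\<forall>k. times_continuously_differentiable k f)"

definition test_functions :: "('a::real_normed_vector \<Rightarrow> real) set" where
  "test_functions = {f. smooth f \<and> compact (closure {x. f x \<noteq> 0})}"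

text \<open>Elements of \<open>L\<^sup>2\<close> are represented by functions, and equations between them are understood
  almost everywhere.\<close>

definition L2 :: "('a::euclidean_space \<Rightarrow> real) set" where
  "L2 = {f \<in> borel_measurable lborel. integrable lborel (\<lambda>x. (f x)\<^sup>2)}"

definition L2_norm :: "('a::euclidean_space \<Rightarrow> real) \<Rightarrow> real" where
  "L2_norm f = sqrt (LINT x|lborel. (f x)\<^sup>2)"

section \<open>The heat semigroup and the heat kernel\<close>

definition contraction_semigroup ::
    "(real \<Rightarrow> ('a::euclidean_space \<Rightarrow> real) \<Rightarrow> 'a \<Rightarrow> real) \<Rightarrow> bool" where
  "contraction_semigroup T \<longleftrightarrow>
     (\<forall>h\<ge>0. \<forall>f\<in>L2. T h f \<in> L2 \<and> L2_norm (T h f) \<le> L2_norm f) \<and>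
     (\<forall>h\<ge>0. \<forall>f\<in>L2. \<forall>u\<in>L2. \<forall>a b. AE x in lborel.
        T h (\<lambda>z. a * f z + b * u z) x = a * T h f x + b * T h u x) \<and>
     (\<forall>f\<in>L2. AE x in lborel. T 0 f x = f x) \<and>
     (\<forall>s\<ge>0. \<forall>h\<ge>0. \<forall>f\<in>L2. AE x in lborel. T (s + h) f x = T s (T h f) x) \<and>
     (\<forall>f\<in>L2. ((\<lambda>h. L2_norm (\<lambda>x. T h f x - f x)) \<longlongrightarrow> 0) (at_right 0))"

text \<open>Unbounded operators on \<open>L\<^sup>2\<close> are given by their graphs.\<close>

definition generator ::
    "(real \<Rightarrow> ('a::euclidean_space \<Rightarrow> real) \<Rightarrow> 'a \<Rightarrow> real) \<Rightarrow>
     (('a \<Rightarrow> real) \<times> ('a \<Rightarrow> real)) set" where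
  "generator T = {(f, u). f \<in> L2 \<and> u \<in> L2 \<and>
     ((\<lambda>h. L2_norm (\<lambda>x. (T h f x - f x) / h - u x)) \<longlongrightarrow> 0) (at_right 0)}"

text \<open>The self-adjoint realisation of the sub-Laplacian: the closure in \<open>L\<^sup>2\<close> of the
  (essentially self-adjoint, nonpositive) operator \<^const>\<open>sub_laplacian\<close> with domain
  \<^const>\<open>test_functions\<close>.\<close>

definition sub_laplacian_closure ::
    "(('n::finite heis \<Rightarrow> real) \<times> ('n heis \<Rightarrow> real)) set" where
  "sub_laplacian_closure = {(f, u). f \<in> L2 \<and> u \<in> L2 \<and>
     (\<exists>\<phi>. (\<forall>k::nat. \<phi> k \<in> test_functions) \<and>
        (\<lambda>k. L2_norm (\<lambda>g. \<phi> k g - f g)) \<longlonglongrightarrow> 0 \<and>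
        (\<lambda>k. L2_norm (\<lambda>g. sub_laplacian (\<phi> k) g - u g)) \<longlonglongrightarrow> 0)}"

text \<open>\<open>T h = exp (h \<Delta>)\<close>.  As \<open>\<Delta>\<close> is self-adjoint and nonpositive, the exponential given by the
  spectral theorem is the strongly continuous contraction semigroup generated by \<open>\<Delta>\<close>.\<close>

definition heat_semigroup ::
    "(real \<Rightarrow> ('n::finite heis \<Rightarrow> real) \<Rightarrow> 'n heis \<Rightarrow> real) \<Rightarrow> bool" where
  "heat_semigroup T \<longleftrightarrow> contraction_semigroup T \<and> generator T = sub_laplacian_closure"

definition heis_convolution ::
    "('n::finite heis \<Rightarrow> real) \<Rightarrow> ('n heis \<Rightarrow> real) \<Rightarrow> 'n heis \<Rightarrow> real" where
  "heis_convolution f p g = (LINT k|lborel. f k * p (heis_mult (- k) g))"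

text \<open>\<open>p h\<close> is the convolution kernel of \<open>exp (h \<Delta>)\<close>.  The operator determines its kernel only almost
  everywhere; smoothness selects the representative that is differentiated pointwise below.\<close>

definition heat_kernel :: "(real \<Rightarrow> 'n::finite heis \<Rightarrow> real) \<Rightarrow> bool" where
  "heat_kernel p \<longleftrightarrow>
     (\<forall>h>0. smooth (p h)) \<and>
     (\<exists>T. heat_semigroup T \<and>
        (\<forall>h>0. \<forall>f\<in>test_functions. AE g in lborel. T h f g = heis_convolution f (p h) g))"

section \<open>The kernels of the Riesz transforms\<close>

text \<open>The convolution kernel of \<open>R\<^sub>j = X\<^sub>j (-\<Delta>)\<^bsup>-1/2\<^esup>\<close> away from the identity, coming from
  \<open>(-\<Delta>)\<^bsup>-1/2\<^esup> = \<pi>\<^bsup>-1/2\<^esup> \<integral>\<^sub>0\<^sup>\<infinity> h\<^bsup>-1/2\<^esup> exp (h \<Delta>) dh\<close>.  The value at \<open>g = 0\<close> carries no meaning.\<close>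

definition riesz_kernel ::
    "(real \<Rightarrow> 'n::finite heis \<Rightarrow> real) \<Rightarrow> 'n + 'n \<Rightarrow> 'n heis \<Rightarrow> real" where
  "riesz_kernel p j g =
     1 / sqrt pi * (LINT h:{0<..}|lborel. h powr (- 1 / 2) * heis_field j (p h) g)"

end

theory Submission
  imports Defs "HOL-Complex_Analysis.Complex_Analysis" "HOL-Probability.Sinc_Integral"
begin

text \<open>
  Write \<open>\<rho> = |x|\<^sup>2 + |y|\<^sup>2\<close> for a point \<open>g = (x, y, t)\<close>, let \<open>a\<close> be its coordinate in the direction of
  the field \<open>X\<^sub>j\<close> and \<open>b\<close> the coefficient of \<open>\<partial>/\<partial>t\<close> in \<open>X\<^sub>j\<close> at \<open>g\<close>.  Up to a positive constant the Riesz
  kernel at \<open>g\<close> is the absolutely convergent integral over \<open>h > 0\<close> and \<open>\<omega> > 0\<close> of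
  \<open>h\<^bsup>-1/2\<^esup> (\<omega> / sinh 4\<omega>h)\<^sup>n e\<^bsup>-\<rho>\<kappa>\<^esup> (- 2a\<kappa> cos \<omega>t - b\<omega> sin \<omega>t)\<close>, where \<open>\<kappa> = \<omega> coth 4\<omega>h\<close>.
  Fix \<open>x\<close> and \<open>y\<close> with \<open>a \<noteq> 0\<close>.  Since \<open>\<kappa> \<ge> \<omega>\<close>, the integral converges for complex \<open>t\<close> with
  \<open>|Im t| \<le> \<rho>/2\<close> and is holomorphic in the interior of that strip.  At \<open>t = 0\<close> the integrand is
  \<open>-2a\<close> times a positive function, so the holomorphic function is not identically zero and has
  only countably many zeros.  As \<open>a \<noteq> 0\<close> for almost all \<open>(x, y)\<close>, Fubini's theorem gives the claim.

  The other half of the proof identifies the heat kernel, which is given only as the convolution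
  kernel of the semigroup \<open>T\<close> generated by the closure of the sub-Laplacian.  If \<open>U\<^sub>s\<close> is a curve of
  smooth functions that nearly solves the heat equation, then \<open>\<langle>T\<^sub>h f, U\<^sub>0\<rangle>\<close> nearly equals
  \<open>\<langle>f, U\<^sub>h\<rangle>\<close> (lemma \<open>duhamel\<close>); this uses the definition of the generator at time zero, the
  contraction property, and integration by parts against test functions.  Functions
  \<open>cos \<omega>t w(s)\<^bsup>-n\<^esup> exp (- m(s) \<rho>)\<close> that start from \<open>cos \<omega>t e\<^bsup>-\<mu>\<rho>\<^esup>\<close> solve the heat equation exactly when
  \<open>m\<close> and \<open>w\<close> obey ordinary differential equations with hyperbolic solutions; a slowly varying
  vertical cutoff puts them into \<open>L\<^sup>2\<close> at the price of an error that tends to zero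
  (\<open>duhamel_single_frequency\<close>).  Superposing the frequencies with the weight \<open>e\<^bsup>-\<delta>\<omega>\<^esup>\<close> turns the
  initial data into a Gaussian times a Poisson kernel (\<open>superposed_identity\<close>), which is an
  approximate identity as \<open>\<mu> \<rightarrow> \<infinity>\<close>.  In the limit \<open>(T\<^sub>h f)(0)\<close> is a constant multiple of the integral of
  \<open>f\<close> against an explicit continuous function (\<open>heat_semigroup_at_zero\<close>).  Since
  \<open>(T\<^sub>h f)(0) = \<integral> f(k) p\<^sub>h(-k) dk\<close> and \<open>f\<close> is an arbitrary test function, the heat kernel is that explicit
  function up to a constant (\<open>heat_kernel_eq_formula\<close>).
\<close>

section \<open>The pairing of square-integrable functions\<close>

lemma L2_D:
  assumes "f \<in> L2"
  shows "f \<in> borel_measurable lborel" "f \<in> borel_measurable borel" "integrable lborel (\<lambda>x. (f x)\<^sup>2)"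
  using assms by (auto simp: L2_def)

lemma L2_mult_integrable:
  assumes "f \<in> L2" "u \<in> L2"
  shows "integrable lborel (\<lambda>x. f x * u x)"
proof (rule Bochner_Integration.integrable_bound)
  show "integrable lborel (\<lambda>x. (f x)\<^sup>2 + (u x)\<^sup>2)" using assms by (simp add: L2_def)
  show "(\<lambda>x. f x * u x) \<in> borel_measurable lborel"
    using L2_D(1)[OF assms(1)] L2_D(1)[OF assms(2)] by measurable
  show "AE x in lborel. norm (f x * u x) \<le> norm ((f x)\<^sup>2 + (u x)\<^sup>2)"
  proof (rule AE_I2)
    fix x
    have "0 \<le> (\<bar>f x\<bar> - \<bar>u x\<bar>)\<^sup>2" by simp
    then have "2 * (\<bar>f x\<bar> * \<bar>u x\<bar>) \<le> (f x)\<^sup>2 + (u x)\<^sup>2"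
      by (simp add: power2_diff)
    moreover have "0 \<le> \<bar>f x\<bar> * \<bar>u x\<bar>" by simp
    ultimately have "\<bar>f x\<bar> * \<bar>u x\<bar> \<le> (f x)\<^sup>2 + (u x)\<^sup>2" by linarith
    then show "norm (f x * u x) \<le> norm ((f x)\<^sup>2 + (u x)\<^sup>2)"
      by (simp add: abs_mult)
  qed
qed

lemma L2_norm_nonneg [simp]: "0 \<le> L2_norm f"
  by (simp add: L2_norm_def)

lemma L2_scale:
  assumes "f \<in> L2" shows "(\<lambda>x. a * f x) \<in> L2"
  using L2_D[OF assms] by (auto simp: L2_def power_mult_distrib)

lemma L2_add:
  assumes "f \<in> L2" "u \<in> L2" shows "(\<lambda>x. f x + u x) \<in> L2"
proof -
  have "integrable lborel (\<lambda>x. (f x)\<^sup>2 + (u x)\<^sup>2 + 2 * (f x * u x))"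
    using assms L2_mult_integrable[OF assms] by (simp add: L2_def)
  then show ?thesis using L2_D(2)[OF assms(1)] L2_D(2)[OF assms(2)]
    by (auto simp: L2_def power2_sum mult.assoc)
qed

lemma L2_diff:
  assumes "f \<in> L2" "u \<in> L2" shows "(\<lambda>x. f x - u x) \<in> L2"
  using L2_add[OF assms(1) L2_scale[OF assms(2), of "-1"]] by simp

lemma L2_bound:
  assumes "u \<in> L2" "f \<in> borel_measurable borel" "\<And>x. \<bar>f x\<bar> \<le> u x"
  shows "f \<in> L2"
proof -
  have "integrable lborel (\<lambda>x. (f x)\<^sup>2)"
  proof (rule Bochner_Integration.integrable_bound)
    show "integrable lborel (\<lambda>x. (u x)\<^sup>2)" using assms(1) by (simp add: L2_def)
    show "AE x in lborel. norm ((f x)\<^sup>2) \<le> norm ((u x)\<^sup>2)"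
      using assms(3) by (auto intro!: AE_I2 simp: abs_le_square_iff[symmetric] intro: order_trans[OF _ abs_ge_self])
  qed (use assms in measurable)
  then show ?thesis using assms by (simp add: L2_def)
qed

lemma L2_norm_mono:
  assumes "u \<in> L2" "f \<in> borel_measurable borel" "\<And>x. \<bar>f x\<bar> \<le> u x"
  shows "L2_norm f \<le> L2_norm u"
  unfolding L2_norm_def
proof (rule real_sqrt_le_mono, rule integral_mono)
  show "integrable lborel (\<lambda>x. (f x)\<^sup>2)" using L2_bound[OF assms] by (simp add: L2_def)
  show "integrable lborel (\<lambda>x. (u x)\<^sup>2)" using assms(1) by (simp add: L2_def)
  show "(f x)\<^sup>2 \<le> (u x)\<^sup>2" for x
    using assms(3)[of x] by (auto simp: abs_le_square_iff[symmetric] intro: order_trans[OF _ abs_ge_self])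
qed

lemma L2_norm_scale: "L2_norm (\<lambda>x. a * f x) = \<bar>a\<bar> * L2_norm f"
  by (simp add: L2_norm_def power_mult_distrib real_sqrt_mult)

lemma L2_norm_cong_AE:
  assumes "f \<in> L2" "u \<in> L2" "AE x in lborel. f x = u x"
  shows "L2_norm f = L2_norm u"
  unfolding L2_norm_def
  by (intro arg_cong[where f=sqrt] integral_cong_AE)
     (use assms L2_D(1)[OF assms(1)] L2_D(1)[OF assms(2)] in \<open>measurable, auto\<close>)

lemma L2_pairing_bound:
  assumes "f \<in> L2" "u \<in> L2"
  shows "\<bar>LINT x|lborel. f x * u x\<bar> \<le> L2_norm f * L2_norm u"
proof -
  let ?F = "LINT x|lborel. (f x)\<^sup>2" and ?U = "LINT x|lborel. (u x)\<^sup>2" and ?P = "LINT x|lborel. f x * u x"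
  note int = L2_D(3)[OF assms(1)] L2_D(3)[OF assms(2)] L2_mult_integrable[OF assms]
  have *: "0 \<le> a\<^sup>2 * ?F + 2 * a * b * ?P + b\<^sup>2 * ?U" for a b
  proof -
    have "0 \<le> (LINT x|lborel. (a * f x + b * u x)\<^sup>2)" by simp
    also have "\<dots> = (LINT x|lborel. a\<^sup>2 * (f x)\<^sup>2 + 2 * a * b * (f x * u x) + b\<^sup>2 * (u x)\<^sup>2)"
      by (intro Bochner_Integration.integral_cong) (auto simp: power2_eq_square algebra_simps)
    also have "\<dots> = a\<^sup>2 * ?F + 2 * a * b * ?P + b\<^sup>2 * ?U" using int by simp
    finally show ?thesis .
  qed
  have F0: "0 \<le> ?F" and U0: "0 \<le> ?U" by simp_all
  \<comment> \<open>Discriminant of a nonnegative quadratic form; it degenerates when \<open>\<integral> f\<^sup>2 = 0\<close>.\<close>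
  have "?P\<^sup>2 \<le> ?F * ?U"
  proof (cases "?F = 0")
    case True
    have "?P = 0"
    proof (rule ccontr)
      assume "?P \<noteq> 0"
      with *[of "- (?U + 1) / (2 * ?P)" 1] True show False by (simp add: field_simps)
    qed
    then show ?thesis using True by simp
  next
    case False
    have "0 \<le> ?F * (?F * ?U - ?P\<^sup>2)"
      using *[of "- ?P" "?F"] by (simp add: power2_eq_square algebra_simps)
    then show ?thesis using F0 False by (simp add: zero_le_mult_iff)
  qed
  then have "\<bar>?P\<bar> \<le> sqrt (?F * ?U)" by (simp add: real_le_rsqrt)
  then show ?thesis by (simp add: L2_norm_def real_sqrt_mult)
qed

section \<open>Differentiation under the integral sign\<close>

text \<open>The scalar field is left open: the real case differentiates the heat kernel, the complex case
  proves that the Riesz integral is holomorphic.\<close>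

lemma has_field_derivative_integral:
  fixes f :: "'k::{real_normed_field, banach, second_countable_topology} \<Rightarrow> 'a \<Rightarrow> 'k"
  assumes S: "open S" "convex S" "z0 \<in> S"
    and int: "\<And>z. z \<in> S \<Longrightarrow> integrable M (f z)"
    and meas: "f' z0 \<in> borel_measurable M"
    and der: "\<And>z x. z \<in> S \<Longrightarrow> x \<in> space M \<Longrightarrow> ((\<lambda>z. f z x) has_field_derivative f' z x) (at z)"
    and bnd: "\<And>z x. z \<in> S \<Longrightarrow> x \<in> space M \<Longrightarrow> norm (f' z x) \<le> g x"
    and g: "integrable M g"
  shows "((\<lambda>z. LINT x|M. f z x) has_field_derivative (LINT x|M. f' z0 x)) (at z0)"
  unfolding has_field_derivative_iff
proof (rule tendsto_at_iff_sequentially[THEN iffD2], intro allI impI)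
  fix X :: "nat \<Rightarrow> 'k" assume X: "\<forall>i. X i \<in> UNIV - {z0}" "X \<longlonglongrightarrow> z0"
  have "eventually (\<lambda>z. z \<in> S) (nhds z0)" using S eventually_nhds by blast
  then have ev: "eventually (\<lambda>i. X i \<in> S) sequentially"
    using X(2) unfolding filterlim_iff by blast
  then obtain N where N: "\<And>i. i \<ge> N \<Longrightarrow> X i \<in> S" by (auto simp: eventually_sequentially)
  define Y where "Y i = X (i + N)" for i
  have YS: "Y i \<in> S" and Yn: "Y i \<noteq> z0" for i using N X(1) by (auto simp: Y_def)
  have Y: "Y \<longlonglongrightarrow> z0" unfolding Y_def using X(2) by (rule LIMSEQ_ignore_initial_segment)
  have "(\<lambda>i. LINT x|M. (f (Y i) x - f z0 x) / (Y i - z0)) \<longlonglongrightarrow> (LINT x|M. f' z0 x)"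
  proof (rule integral_dominated_convergence[where w = g])
    show "(\<lambda>x. (f (Y i) x - f z0 x) / (Y i - z0)) \<in> borel_measurable M" for i
      using borel_measurable_integrable[OF int[OF YS]] borel_measurable_integrable[OF int[OF S(3)]]
      by measurable
    show "AE x in M. (\<lambda>i. (f (Y i) x - f z0 x) / (Y i - z0)) \<longlonglongrightarrow> f' z0 x"
    proof (rule AE_I2)
      fix x assume "x \<in> space M"
      from der[OF S(3) this] have "((\<lambda>z. (f z x - f z0 x) / (z - z0)) \<longlongrightarrow> f' z0 x) (at z0)"
        by (simp add: has_field_derivative_iff)
      then show "(\<lambda>i. (f (Y i) x - f z0 x) / (Y i - z0)) \<longlonglongrightarrow> f' z0 x"
        using Y Yn by (auto simp: tendsto_at_iff_sequentially comp_def)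
    qed
    show "AE x in M. norm ((f (Y i) x - f z0 x) / (Y i - z0)) \<le> g x" for i
    proof (rule AE_I2)
      fix x assume x: "x \<in> space M"
      have "norm (f (Y i) x - f z0 x) \<le> g x * norm (Y i - z0)"
        by (rule field_differentiable_bound[OF S(2), where f' = "\<lambda>z. f' z x"])
           (use der bnd x YS S in \<open>auto intro: has_field_derivative_at_within\<close>)
      then show "norm ((f (Y i) x - f z0 x) / (Y i - z0)) \<le> g x"
        using Yn[of i] by (simp add: norm_divide divide_le_eq)
    qed
  qed (use meas g in auto)
  moreover have eq: "(LINT x|M. (f (Y i) x - f z0 x) / (Y i - z0))
      = ((LINT x|M. f (Y i) x) - (LINT x|M. f z0 x)) / (Y i - z0)" for i
    using int[OF YS] int[OF S(3)] by (subst integral_divide_zero) simp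
  ultimately have "(\<lambda>i. ((LINT x|M. f (X (i + N)) x) - (LINT x|M. f z0 x)) / (X (i + N) - z0)) \<longlonglongrightarrow> (LINT x|M. f' z0 x)"
    unfolding eq unfolding Y_def by simp
  then show "((\<lambda>y. ((LINT x|M. f y x) - (LINT x|M. f z0 x)) / (y - z0)) \<circ> X) \<longlonglongrightarrow> (LINT x|M. f' z0 x)"
    unfolding comp_def by (rule LIMSEQ_offset)
qed

section \<open>Calculus of smooth functions\<close>

abbreviation (input) "tcd \<equiv> times_continuously_differentiable"

lemma tcd_Suc_D:
  assumes "tcd (Suc k) f"
  shows "f differentiable (at x)" "tcd k (\<lambda>x. frechet_derivative f (at x) v)"
  using assms by auto

lemma tcd_continuous: "tcd k f \<Longrightarrow> continuous_on UNIV f"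
  by (cases k) (auto intro!: continuous_at_imp_continuous_on differentiable_imp_continuous_within)

lemma tcd_const: "tcd k (\<lambda>_. c)"
proof (induction k arbitrary: c)
  case 0 then show ?case by simp
next
  case (Suc k)
  have "frechet_derivative (\<lambda>_. c) (at x) = (\<lambda>_. 0)" for x :: 'a
    by (rule frechet_derivative_at[symmetric]) simp
  then show ?case using Suc[of 0] by simp
qed

lemma tcd_bounded_linear:
  assumes "bounded_linear f" shows "tcd k f"
proof (cases k)
  case 0 then show ?thesis using assms by (simp add: linear_continuous_on)
next
  case (Suc j)
  have d: "(f has_derivative f) (at x)" for x using assms by (rule bounded_linear_imp_has_derivative)
  then have "frechet_derivative f (at x) = f" for x by (rule frechet_derivative_at[symmetric])
  then show ?thesis using d by (auto simp: Suc differentiable_def tcd_const)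
qed

lemma tcd_add:
  assumes "tcd k f" "tcd k g" shows "tcd k (\<lambda>x. f x + g x)"
  using assms
proof (induction k arbitrary: f g)
  case 0 then show ?case by (auto intro: continuous_intros)
next
  case (Suc k)
  have "frechet_derivative (\<lambda>x. f x + g x) (at x)
      = (\<lambda>v. frechet_derivative f (at x) v + frechet_derivative g (at x) v)" for x
    using Suc.prems by (intro frechet_derivative_at[symmetric] has_derivative_add)
      (simp_all add: frechet_derivative_works)
  then show ?case using Suc by (auto intro!: differentiable_add)
qed

lemma tcd_mono: "tcd (Suc k) f \<Longrightarrow> tcd k f"
proof (induction k arbitrary: f)
  case 0 then show ?case using tcd_continuous[OF 0] by simp
next
  case (Suc k)
  then show ?case by (auto simp del: times_continuously_differentiable.simps(2)
      simp add: times_continuously_differentiable.simps(2)[of "Suc k"] times_continuously_differentiable.simps(2)[of "k"])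
qed

lemma tcd_mult:
  assumes "tcd k f" "tcd k g" shows "tcd k (\<lambda>x. f x * g x)"
  using assms
proof (induction k arbitrary: f g)
  case 0 then show ?case by (auto intro: continuous_intros)
next
  case (Suc k)
  have *: "frechet_derivative (\<lambda>x. f x * g x) (at x)
      = (\<lambda>v. f x * frechet_derivative g (at x) v + frechet_derivative f (at x) v * g x)" for x
    using Suc.prems by (intro frechet_derivative_at[symmetric] has_derivative_mult)
      (simp_all add: frechet_derivative_works)
  have "tcd k f" "tcd k g" using Suc.prems by (auto intro: tcd_mono)
  then show ?case unfolding times_continuously_differentiable.simps(2) *
    using Suc by (auto intro!: tcd_add)
qed

text \<open>Composition with a function of one real variable whose successive derivatives are listed
  in a sequence; this form spares the chain rule for iterated derivatives.\<close>

lemma tcd_compose_sequence: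
  assumes g: "\<And>i x. (g i has_real_derivative g (Suc i) x) (at x)"
    and f: "tcd k f"
  shows "tcd k (\<lambda>x. g i (f x))"
  using f
proof (induction k arbitrary: i)
  case 0
  have "continuous_on UNIV (g i)"
    by (rule DERIV_continuous_on) (use g in \<open>auto intro: has_field_derivative_at_within\<close>)
  with 0 show ?case by (auto intro: continuous_on_compose2)
next
  case (Suc k)
  have d: "((\<lambda>x. g i (f x)) has_derivative (\<lambda>v. g (Suc i) (f x) * frechet_derivative f (at x) v)) (at x)" for x
    using has_derivative_compose[of f "frechet_derivative f (at x)" x UNIV "g i" "(*) (g (Suc i) (f x))"]
      Suc.prems g[of i "f x"]
    by (simp add: frechet_derivative_works has_field_derivative_def)
  then have *: "frechet_derivative (\<lambda>x. g i (f x)) (at x) = (\<lambda>v. g (Suc i) (f x) * frechet_derivative f (at x) v)" for x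
    by (rule frechet_derivative_at[symmetric])
  have "tcd k f" using Suc.prems by (rule tcd_mono)
  then show ?case unfolding times_continuously_differentiable.simps(2) *
    using Suc d by (auto intro!: tcd_mult simp: differentiable_def)
qed

lemma smooth_const: "smooth (\<lambda>_. c)" by (simp add: smooth_def tcd_const)

lemma smooth_bounded_linear: "bounded_linear f \<Longrightarrow> smooth f"
  by (simp add: smooth_def tcd_bounded_linear)

lemma smooth_add: "smooth f \<Longrightarrow> smooth g \<Longrightarrow> smooth (\<lambda>x. f x + g x)"
  by (simp add: smooth_def tcd_add)

lemma smooth_mult: "smooth f \<Longrightarrow> smooth g \<Longrightarrow> smooth (\<lambda>x. f x * g x)"
  by (simp add: smooth_def tcd_mult)

lemma smooth_sum: "(\<And>i. i \<in> A \<Longrightarrow> smooth (f i)) \<Longrightarrow> smooth (\<lambda>x. \<Sum>i\<in>A. f i x)"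
  by (induction A rule: infinite_finite_induct) (auto intro: smooth_const smooth_add)

lemma smooth_compose_sequence:
  "(\<And>i x. (g i has_real_derivative g (Suc i) x) (at x)) \<Longrightarrow> smooth f \<Longrightarrow> smooth (\<lambda>x. g i (f x))"
  by (simp add: smooth_def tcd_compose_sequence)

lemma smooth_continuous: "smooth f \<Longrightarrow> continuous_on UNIV f"
  unfolding smooth_def using tcd_continuous by blast

lemma smooth_has_derivative: "smooth f \<Longrightarrow> (f has_derivative frechet_derivative f (at x)) (at x)"
  unfolding smooth_def frechet_derivative_works[symmetric] using tcd_Suc_D(1) by blast

lemma smooth_frechet_derivative: "smooth f \<Longrightarrow> smooth (\<lambda>x. frechet_derivative f (at x) v)"
  unfolding smooth_def using tcd_Suc_D(2) by blast

lemma smooth_exp: assumes "smooth f" shows "smooth (\<lambda>x. exp (f x))"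
  using smooth_compose_sequence[of "\<lambda>_. exp" f] assms by (auto intro: DERIV_exp)

lemma smooth_cos:
  assumes "smooth f" shows "smooth (\<lambda>x. cos (f x))"
proof -
  \<comment> \<open>Each differentiation of the cosine shifts its argument by a quarter period.\<close>
  let ?g = "\<lambda>i x. cos (x + real i * (pi / 2))"
  have "(?g i has_real_derivative ?g (Suc i) x) (at x)" for i x
  proof -
    have "?g (Suc i) x = cos ((x + real i * (pi / 2)) + pi / 2)" by (simp add: field_simps)
    also have "\<dots> = - sin (x + real i * (pi / 2))" by (simp add: cos_add)
    finally show ?thesis by (auto intro!: derivative_eq_intros)
  qed
  from smooth_compose_sequence[of ?g f 0, OF this assms] show ?thesis by simp
qed

text \<open>The functions \<open>P(1/x) e\<^bsup>-1/x\<^esup>\<close>, extended by zero to \<open>x \<le> 0\<close>, are closed under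
  differentiation: \<open>P\<close> is replaced by \<open>X\<^sup>2 (P - P')\<close>.\<close>

definition flat :: "real poly \<Rightarrow> real \<Rightarrow> real" where
  "flat P x = (if x > 0 then poly P (1 / x) * exp (- (1 / x)) else 0)"

definition flat_deriv :: "real poly \<Rightarrow> real poly" where
  "flat_deriv P = [:0, 0, 1:] * (P - pderiv P)"

lemma poly_times_exp_tendsto_zero: "((\<lambda>u. poly P u * exp (- u)) \<longlongrightarrow> (0::real)) at_top"
proof -
  have "((\<lambda>u. \<Sum>i\<le>degree P. coeff P i * (u ^ i / exp u)) \<longlongrightarrow> (\<Sum>i\<le>degree P. coeff P i * 0)) at_top"
    by (intro tendsto_intros tendsto_power_div_exp_0)
  moreover have "(\<Sum>i\<le>degree P. coeff P i * (u ^ i / exp u)) = poly P u * exp (- u)" for u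
    by (simp add: poly_altdef exp_minus sum_distrib_right divide_inverse mult.assoc)
  ultimately show ?thesis by simp
qed

lemma flat_has_derivative: "(flat P has_real_derivative flat (flat_deriv P) x) (at x)"
proof -
  consider "x > 0" | "x < 0" | "x = 0" by linarith
  then show ?thesis
  proof cases
    case 1
    have "((\<lambda>x. poly P (1 / x) * exp (- (1 / x))) has_real_derivative flat (flat_deriv P) x) (at x)"
      using 1 by (auto intro!: derivative_eq_intros poly_DERIV[THEN DERIV_chain2]
          simp: flat_def flat_deriv_def field_simps power2_eq_square)
    then show ?thesis
      by (rule has_field_derivative_transform_within_open[where S="{0<..}"]) (use 1 in \<open>auto simp: flat_def\<close>)
  next
    case 2
    have "((\<lambda>x. 0) has_real_derivative flat (flat_deriv P) x) (at x)" using 2 by (simp add: flat_def)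
    then show ?thesis
      by (rule has_field_derivative_transform_within_open[where S="{..<0}"]) (use 2 in \<open>auto simp: flat_def\<close>)
  next
    case 3
    have "((\<lambda>h. flat P h / h) \<longlongrightarrow> 0) (at_right 0)"
    proof -
      have "((\<lambda>h. (\<lambda>u. poly ([:0, 1:] * P) u * exp (- u)) (1 / h)) \<longlongrightarrow> 0) (at_right (0::real))"
        by (rule filterlim_compose[OF poly_times_exp_tendsto_zero])
          (simp add: divide_inverse filterlim_inverse_at_top_right)
      then show ?thesis
        by (rule Lim_transform_eventually)
          (auto simp: flat_def eventually_at_right_field intro!: exI[of _ 1])
    qed
    moreover have "((\<lambda>h. flat P h / h) \<longlongrightarrow> 0) (at_left 0)"
      by (rule Lim_transform_eventually[OF tendsto_const])
         (auto simp: flat_def eventually_at_left_field intro!: exI[of _ "-1"])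
    ultimately have "((\<lambda>h. flat P h / h) \<longlongrightarrow> 0) (at 0)"
      by (simp add: filterlim_split_at)
    then show ?thesis using 3 by (simp add: DERIV_def flat_def)
  qed
qed

lemma smooth_flat: assumes "smooth f" shows "smooth (\<lambda>x. flat P (f x))"
  using smooth_compose_sequence[of "\<lambda>i. flat ((flat_deriv ^^ i) P)" f 0] assms flat_has_derivative
  by simp

lemma smooth_inner:
  fixes f :: "'a::real_normed_vector \<Rightarrow> 'b::euclidean_space"
  assumes "\<And>b. smooth (\<lambda>x. f x \<bullet> b)" shows "smooth (\<lambda>x. f x \<bullet> f x)"
  by (subst euclidean_inner) (intro smooth_sum smooth_mult assms)

lemma smooth_norm_square:
  fixes a :: "'a::euclidean_space" shows "smooth (\<lambda>x. (x - a) \<bullet> (x - a))"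
proof (rule smooth_inner)
  fix b
  have "smooth (\<lambda>x::'a. x \<bullet> b + - (a \<bullet> b))"
    by (intro smooth_add smooth_const smooth_bounded_linear bounded_linear_inner_left)
  then show "smooth (\<lambda>x. (x - a) \<bullet> b)" by (simp add: inner_diff_left)
qed

lemma bump_function_exists:
  fixes a :: "'a::euclidean_space"
  assumes "r > 0"
  obtains \<phi> where "\<phi> \<in> test_functions" "\<And>x. \<phi> x \<ge> 0" "\<phi> a > 0" "\<And>x. \<phi> x \<noteq> 0 \<Longrightarrow> dist a x < r"
proof
  define \<phi> where "\<phi> x = flat 1 (r\<^sup>2 + (-1) * ((x - a) \<bullet> (x - a)))" for x
  have supp: "dist a x < r" if "\<phi> x \<noteq> 0" for x
  proof -
    have "(norm (x - a))\<^sup>2 < r\<^sup>2" using that by (auto simp: \<phi>_def flat_def power2_norm_eq_inner split: if_splits)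
    then show ?thesis using assms by (simp add: dist_norm norm_minus_commute power_less_imp_less_base)
  qed
  show "\<phi> x \<noteq> 0 \<Longrightarrow> dist a x < r" for x by (rule supp)
  show "\<phi> x \<ge> 0" for x by (simp add: \<phi>_def flat_def)
  show "\<phi> a > 0" using assms by (simp add: \<phi>_def flat_def)
  have "bounded {x. \<phi> x \<noteq> 0}"
    using supp by (intro bounded_subset[OF bounded_ball[of a r]]) auto
  moreover have "smooth \<phi>"
    unfolding \<phi>_def by (intro smooth_flat smooth_add smooth_mult smooth_const smooth_norm_square)
  ultimately show "\<phi> \<in> test_functions" by (simp add: test_functions_def compact_closure)
qed

text \<open>The fundamental lemma of the calculus of variations: if \<open>f a \<noteq> 0\<close>, a bump function near \<open>a\<close>
  detects it.\<close>

lemma continuous_eq_if_integrals_eq: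
  fixes f :: "'a::euclidean_space \<Rightarrow> real"
  assumes f: "continuous_on UNIV f"
    and zero: "\<And>\<phi>. \<phi> \<in> test_functions \<Longrightarrow> (LINT x|lborel. \<phi> x * f x) = 0"
  shows "f a = 0"
proof (rule ccontr)
  assume "f a \<noteq> 0"
  define s where "s = sgn (f a)"
  have sa: "s * f a > 0" using \<open>f a \<noteq> 0\<close> by (simp add: s_def sgn_if)
  have cont: "continuous_on UNIV (\<lambda>x. s * f x)" using f by (intro continuous_intros)
  have "open {x. s * f x > 0}" using open_Collect_less[OF continuous_on_const cont, of 0] by simp
  then obtain r where r: "r > 0" "ball a r \<subseteq> {x. s * f x > 0}" using sa by (auto simp: open_contains_ball)
  obtain \<phi> where \<phi>: "\<phi> \<in> test_functions" "\<And>x. \<phi> x \<ge> 0" "\<phi> a > 0" "\<And>x. \<phi> x \<noteq> 0 \<Longrightarrow> dist a x < r"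
    using bump_function_exists[OF r(1)] by metis
  let ?F = "\<lambda>x. \<phi> x * (s * f x)"
  have Fc: "continuous_on UNIV ?F" using \<phi>(1) cont
    by (intro continuous_on_mult[OF smooth_continuous cont]) (auto simp: test_functions_def)
  have F0: "?F x \<ge> 0" for x using \<phi>(2)[of x] \<phi>(4)[of x] r(2) by (cases "\<phi> x = 0") (auto simp: subset_iff)
  have Fsupp: "?F x = 0" if "x \<notin> cball a r" for x using \<phi>(4)[of x] that by force
  have "integrable lborel (\<lambda>x. indicator (cball a r) x *\<^sub>R ?F x)"
    by (rule borel_integrable_compact) (use Fc in \<open>auto intro: continuous_on_subset\<close>)
  moreover have "(\<lambda>x. indicator (cball a r) x *\<^sub>R ?F x) = ?F" using Fsupp by (auto simp: indicator_def fun_eq_iff)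
  ultimately have int: "integrable lborel ?F" by simp
  have "(LINT x|lborel. ?F x) = s * (LINT x|lborel. \<phi> x * f x)"
    by (subst integral_mult_right_zero[symmetric]) (simp add: mult_ac)
  also have "\<dots> = 0" using zero[OF \<phi>(1)] by simp
  finally have "AE x in lborel. ?F x = 0"
    using integral_nonneg_eq_0_iff_AE[OF int] F0 by auto
  moreover have "open {x. ?F x > 0}" using open_Collect_less[OF continuous_on_const Fc, of 0] by simp
  ultimately have "{x. ?F x > 0} = {}"
  proof -
    assume ae: "AE x in lborel. ?F x = 0" and op: "open {x. ?F x > 0}"
    have "AE x in lborel. x \<notin> {x. ?F x > 0}" using ae by eventually_elim auto
    then have "{x. ?F x > 0} \<in> null_sets lborel"
      using op by (subst AE_iff_null_sets) (auto intro: borel_open)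
    then have "negligible {x. ?F x > 0}" by (metis negligible_iff_null_sets null_sets_completionI)
    then show ?thesis using op open_not_negligible by blast
  qed
  moreover have "?F a > 0" using \<phi>(3) sa by simp
  ultimately show False by blast
qed

section \<open>The left-invariant fields as derivations\<close>

text \<open>The field with index \<open>j\<close> differentiates along the constant direction \<open>heis_base j\<close> and adds
  \<open>heis_slope j\<close> times the vertical derivative.\<close>

definition heis_base :: "'n::finite + 'n \<Rightarrow> 'n heis" where
  "heis_base j = (case j of Inl i \<Rightarrow> (axis i 1, 0, 0) | Inr i \<Rightarrow> (0, axis i 1, 0))"

definition heis_slope :: "'n::finite + 'n \<Rightarrow> 'n heis \<Rightarrow> real" where
  "heis_slope j g = (case j of Inl i \<Rightarrow> 2 * (fst (snd g) $ i) | Inr i \<Rightarrow> - 2 * (fst g $ i))"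

lemma has_real_derivative_along:
  assumes "(f has_derivative D) (at (c (s::real)))" "(c has_vector_derivative v) (at s)"
  shows "((\<lambda>s. f (c s)) has_real_derivative D v) (at s)"
proof -
  have "((\<lambda>s. f (c s)) has_vector_derivative D v) (at s)"
    using vector_derivative_diff_chain_within[of c v s UNIV f D] assms
    by (auto simp: comp_def intro: has_derivative_at_withinI)
  then show ?thesis by (simp add: has_real_derivative_iff_has_vector_derivative)
qed

lemma heis_field_eq_derivative:
  assumes "(f has_derivative D) (at g)"
  shows "heis_field j f g = D (heis_base j) + heis_slope j g * D (0, 0, 1)"
proof (cases g)
  case (fields x y t)
  have t: "deriv (\<lambda>s. f (x, y, s)) t = D (0, 0, 1)"
    by (rule DERIV_imp_deriv, rule has_real_derivative_along[where f=f and D=D and c="\<lambda>s. (x, y, s)" and v="(0, 0, 1)"])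
       (use assms in \<open>auto simp: fields zero_prod_def[symmetric] intro!: derivative_eq_intros has_vector_derivative_Pair\<close>)
  show ?thesis
  proof (cases j)
    case (Inl i)
    have "deriv (\<lambda>s. f (x + s *\<^sub>R axis i 1, y, t)) 0 = D (axis i 1, 0, 0)"
      by (rule DERIV_imp_deriv, rule has_real_derivative_along[where f=f and D=D and c="\<lambda>s. (x + s *\<^sub>R axis i 1, y, t)" and v="(axis i 1, 0, 0)"])
         (use assms in \<open>auto simp: fields zero_prod_def intro!: derivative_eq_intros has_vector_derivative_Pair\<close>)
    then show ?thesis using t by (simp add: fields Inl heis_base_def heis_slope_def)
  next
    case (Inr i)
    have "deriv (\<lambda>s. f (x, y + s *\<^sub>R axis i 1, t)) 0 = D (0, axis i 1, 0)"
      by (rule DERIV_imp_deriv, rule has_real_derivative_along[where f=f and D=D and c="\<lambda>s. (x, y + s *\<^sub>R axis i 1, t)" and v="(0, axis i 1, 0)"])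
         (use assms in \<open>auto simp: fields intro!: derivative_eq_intros has_vector_derivative_Pair\<close>)
    then show ?thesis using t by (simp add: fields Inr heis_base_def heis_slope_def)
  qed
qed

lemma heis_field_smooth_eq:
  assumes "smooth f"
  shows "heis_field j f = (\<lambda>g. frechet_derivative f (at g) (heis_base j)
            + heis_slope j g * frechet_derivative f (at g) (0, 0, 1))"
  using heis_field_eq_derivative[OF smooth_has_derivative[OF assms]] by (rule ext)

lemma bounded_linear_heis_slope: "bounded_linear (heis_slope j)"
proof (cases j)
  case (Inl i)
  have "bounded_linear (\<lambda>g::'a heis. 2 * (fst (snd g) $ i))"
    by (intro bounded_linear_const_mult bounded_linear_vec_nth bounded_linear_compose[OF bounded_linear_vec_nth]
        bounded_linear_compose[OF bounded_linear_fst] bounded_linear_snd)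
  then show ?thesis by (simp add: heis_slope_def[abs_def] Inl)
next
  case (Inr i)
  have "bounded_linear (\<lambda>g::'a heis. - 2 * (fst g $ i))"
    by (intro bounded_linear_const_mult bounded_linear_compose[OF bounded_linear_vec_nth] bounded_linear_fst)
  then show ?thesis by (simp add: heis_slope_def[abs_def] Inr)
qed

lemma smooth_heis_field: "smooth f \<Longrightarrow> smooth (heis_field j f)"
  unfolding heis_field_smooth_eq
  by (intro smooth_add smooth_mult smooth_frechet_derivative smooth_bounded_linear[OF bounded_linear_heis_slope])

lemma smooth_sub_laplacian: "smooth f \<Longrightarrow> smooth (sub_laplacian f)"
  unfolding sub_laplacian_def[abs_def] by (intro smooth_sum smooth_heis_field)

lemma heis_field_mult:
  assumes "smooth f" "smooth u"
  shows "heis_field j (\<lambda>g. f g * u g) g = heis_field j f g * u g + f g * heis_field j u g"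
proof -
  have "((\<lambda>g. f g * u g) has_derivative
      (\<lambda>v. f g * frechet_derivative u (at g) v + frechet_derivative f (at g) v * u g)) (at g)"
    using assms by (intro has_derivative_mult smooth_has_derivative)
  from heis_field_eq_derivative[OF this, of j] show ?thesis
    using assms by (simp add: heis_field_smooth_eq algebra_simps)
qed

section \<open>Integration by parts\<close>

definition support_closure :: "('a::topological_space \<Rightarrow> real) \<Rightarrow> 'a set" where
  "support_closure f = closure {x. f x \<noteq> 0}"

lemma not_in_support: "x \<notin> support_closure f \<Longrightarrow> f x = 0"
  using closure_subset[of "{x. f x \<noteq> 0}"] by (auto simp: support_closure_def)

lemma frechet_derivative_off_support:
  assumes "x \<notin> support_closure f"
  shows "frechet_derivative f (at x) = (\<lambda>_. 0)"
proof (rule frechet_derivative_at[symmetric])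
  have "open (- support_closure f)" by (simp add: support_closure_def open_Compl)
  then show "(f has_derivative (\<lambda>_. 0)) (at x)"
    by (rule has_derivative_transform_within_open[OF has_derivative_const[of 0 "at x"]])
       (use assms not_in_support in force)+
qed

lemma test_functions_D:
  assumes "f \<in> test_functions"
  shows "smooth f" "compact (support_closure f)"
  using assms by (auto simp: test_functions_def support_closure_def)

lemma test_functions_I:
  fixes f :: "'a::euclidean_space \<Rightarrow> real"
  assumes "smooth f" "compact K" "\<And>x. x \<notin> K \<Longrightarrow> f x = 0"
  shows "f \<in> test_functions"
proof -
  have "{x. f x \<noteq> 0} \<subseteq> K" using assms(3) by blast
  then have "bounded {x. f x \<noteq> 0}" using assms(2) bounded_subset compact_imp_bounded by blast
  then show ?thesis using assms(1) by (simp add: test_functions_def compact_closure)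
qed

lemma compactly_supported_integrable:
  fixes f :: "'a::euclidean_space \<Rightarrow> real"
  assumes "continuous_on UNIV f" "compact K" "\<And>x. x \<notin> K \<Longrightarrow> f x = 0"
  shows "integrable lborel f"
proof -
  have "integrable lborel (\<lambda>x. indicator K x *\<^sub>R f x)"
    by (rule borel_integrable_compact) (use assms in \<open>auto intro: continuous_on_subset\<close>)
  moreover have "(\<lambda>x. indicator K x *\<^sub>R f x) = f" using assms(3) by (auto simp: indicator_def fun_eq_iff)
  ultimately show ?thesis by simp
qed

lemma test_function_integrable: "f \<in> test_functions \<Longrightarrow> integrable lborel (f :: 'a::euclidean_space \<Rightarrow> real)"
  by (rule compactly_supported_integrable[OF smooth_continuous test_functions_D(2)])
     (auto dest: test_functions_D not_in_support)

lemma test_function_times_smooth: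
  fixes f :: "'a::euclidean_space \<Rightarrow> real"
  assumes "f \<in> test_functions" "smooth u"
  shows "(\<lambda>x. f x * u x) \<in> test_functions"
  by (rule test_functions_I[OF smooth_mult test_functions_D(2)[OF assms(1)]])
     (use assms in \<open>auto dest: test_functions_D not_in_support\<close>)

lemma test_function_L2: "f \<in> test_functions \<Longrightarrow> (f :: 'a::euclidean_space \<Rightarrow> real) \<in> L2"
  using test_function_integrable[OF test_function_times_smooth[of f f]]
  by (auto simp: L2_def power2_eq_square dest: test_functions_D
      intro!: borel_measurable_continuous_onI smooth_continuous)

lemma heis_field_test_function: "f \<in> test_functions \<Longrightarrow> heis_field j f \<in> test_functions"
  by (rule test_functions_I[OF smooth_heis_field test_functions_D(2)[of f]])
     (auto simp: heis_field_smooth_eq frechet_derivative_off_support dest: test_functions_D)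

lemma heis_field_off_support:
  "smooth f \<Longrightarrow> x \<notin> support_closure f \<Longrightarrow> heis_field j f x = 0"
  by (simp add: heis_field_smooth_eq frechet_derivative_off_support)

lemma support_heis_field:
  assumes "smooth f" shows "support_closure (heis_field j f) \<subseteq> support_closure f"
  unfolding support_closure_def[of "heis_field j f"]
  by (rule closure_minimal) (use heis_field_off_support[OF assms] in \<open>auto simp: support_closure_def\<close>)

lemma sub_laplacian_test_function:
  assumes "f \<in> test_functions" shows "sub_laplacian f \<in> test_functions"
proof (rule test_functions_I[OF _ test_functions_D(2)[OF assms]])
  have f: "smooth f" using assms by (rule test_functions_D)
  show "smooth (sub_laplacian f)" using f by (rule smooth_sub_laplacian)
  show "sub_laplacian f x = 0" if "x \<notin> support_closure f" for x
    unfolding sub_laplacian_def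
    by (intro sum.neutral ballI heis_field_off_support smooth_heis_field f)
       (use that support_heis_field[OF f] in blast)
qed

text \<open>The integral of \<open>x \<mapsto> f (x + s v)\<close> is independent of \<open>s\<close> by translation invariance; its
  derivative at \<open>s = 0\<close> is the integral in question.\<close>

lemma integral_directional_derivative:
  fixes f :: "'a::euclidean_space \<Rightarrow> real"
  assumes "f \<in> test_functions"
  shows "(LINT x|lborel. frechet_derivative f (at x) v) = 0"
proof -
  define K where "K = support_closure f"
  define D where "D x = frechet_derivative f (at x) v" for x
  have f: "smooth f" and K: "compact K" using test_functions_D[OF assms] by (auto simp: K_def)
  have Dc: "continuous_on UNIV D"
    unfolding D_def[abs_def] by (intro smooth_continuous smooth_frechet_derivative f)
  have D0: "D x = 0" if "x \<notin> K" for x using that by (simp add: D_def K_def frechet_derivative_off_support)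
  obtain B where B: "\<And>x. x \<in> K \<Longrightarrow> norm x \<le> B" using compact_imp_bounded[OF K] by (auto simp: bounded_iff)
  have "bounded (D ` K)" by (rule compact_imp_bounded, rule compact_continuous_image[OF continuous_on_subset[OF Dc] K]) simp
  then obtain M where M: "\<And>x. x \<in> K \<Longrightarrow> \<bar>D x\<bar> \<le> M" by (auto simp: bounded_iff)
  define M' where "M' = max M 0"
  have M': "\<bar>D x\<bar> \<le> M'" "0 \<le> M'" for x using M[of x] D0[of x] by (cases "x \<in> K"; auto simp: M'_def max_def)+
  define R where "R = B + norm v"
  have cover: "x \<in> cball 0 R" if "x + s *\<^sub>R v \<in> K" "\<bar>s\<bar> < 1" for x s
  proof -
    have "norm x = norm ((x + s *\<^sub>R v) - s *\<^sub>R v)" by simp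
    also have "\<dots> \<le> norm (x + s *\<^sub>R v) + norm (s *\<^sub>R v)" by (rule norm_triangle_ineq4)
    also have "\<dots> \<le> B + norm v" using B[OF that(1)] that(2) by (intro add_mono) (auto intro: mult_left_le_one_le)
    finally show ?thesis by (simp add: R_def)
  qed
  have "((\<lambda>s. LINT x|lborel. f (x + s *\<^sub>R v)) has_field_derivative (LINT x|lborel. D (x + 0 *\<^sub>R v))) (at 0)"
  proof (rule has_field_derivative_integral[where S="{-1<..<1::real}" and g="\<lambda>x. M' * indicator (cball 0 R) x"
        and f'="\<lambda>s x. D (x + s *\<^sub>R v)"])
    show "integrable lborel (\<lambda>x. f (x + z *\<^sub>R v))" if "z \<in> {-1<..<1}" for z
    proof (rule compactly_supported_integrable)
      show "continuous_on UNIV (\<lambda>x. f (x + z *\<^sub>R v))"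
        by (rule continuous_on_compose2[OF smooth_continuous[OF f]]) (auto intro!: continuous_intros)
      show "compact (cball 0 R :: 'a set)" by simp
      show "f (x + z *\<^sub>R v) = 0" if "x \<notin> cball 0 R" for x
        using cover[of x z] that \<open>z \<in> {-1<..<1}\<close> not_in_support[of "x + z *\<^sub>R v" f]
        by (cases "x + z *\<^sub>R v \<in> K") (auto simp: K_def abs_less_iff)
    qed
    show "(\<lambda>x. D (x + 0 *\<^sub>R v)) \<in> borel_measurable lborel"
      using Dc by (simp add: borel_measurable_continuous_onI)
    show "((\<lambda>z. f (x + z *\<^sub>R v)) has_real_derivative D (x + z *\<^sub>R v)) (at z)" for x z
      unfolding D_def
      by (rule has_real_derivative_along[OF smooth_has_derivative[OF f]])
         (auto intro!: derivative_eq_intros)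
    show "norm (D (x + z *\<^sub>R v)) \<le> M' * indicator (cball 0 R) x" if "z \<in> {-1<..<1}" for z x
      using cover[of x z] that M' D0[of "x + z *\<^sub>R v"] by (cases "x + z *\<^sub>R v \<in> K") (auto simp: indicator_def abs_less_iff)
    show "integrable lborel (\<lambda>x. M' * indicator (cball 0 R :: 'a set) x)"
      by (intro integrable_mult_right integrable_real_indicator) (use emeasure_lborel_cball_finite[of "0 :: 'a" R] in \<open>simp_all add: top_unique infinity_ennreal_def\<close>)
  qed auto
  moreover have "(LINT x|lborel. f (x + s *\<^sub>R v)) = (LINT x|lborel. f x)" for s
  proof -
    have "(LINT x|lborel. f x) = (LINT x|distr lborel borel ((+) (s *\<^sub>R v)). f x)"
      by (simp add: lborel_distr_plus)
    also have "\<dots> = (LINT x|lborel. f (s *\<^sub>R v + x))"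
      by (rule integral_distr) (use f in \<open>auto intro!: borel_measurable_continuous_onI smooth_continuous\<close>)
    finally show ?thesis by (simp add: add.commute)
  qed
  ultimately have "((\<lambda>s::real. LINT x|lborel. f x) has_field_derivative (LINT x|lborel. D x)) (at 0)" by simp
  then show ?thesis unfolding D_def[symmetric]
    by (rule DERIV_unique) simp
qed

lemma integral_heis_field:
  assumes "f \<in> test_functions"
  shows "(LINT g|lborel. heis_field j f g) = 0"
proof -
  let ?t = "(0, 0, 1) :: 'a heis"
  have f: "smooth f" using assms by (rule test_functions_D)
  have slope: "smooth (heis_slope j)" by (intro smooth_bounded_linear bounded_linear_heis_slope)
  let ?F = "\<lambda>g. f g * heis_slope j g"
  have F: "?F \<in> test_functions" using assms slope by (rule test_function_times_smooth)
  \<comment> \<open>The coefficient of the vertical derivative is constant along vertical lines.\<close>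
  have eq: "heis_slope j g * frechet_derivative f (at g) ?t = frechet_derivative ?F (at g) ?t" for g
  proof -
    have d: "(?F has_derivative (\<lambda>v. f g * heis_slope j v + frechet_derivative f (at g) v * heis_slope j g)) (at g)"
      by (intro has_derivative_mult smooth_has_derivative f bounded_linear_imp_has_derivative bounded_linear_heis_slope)
    have "heis_slope j ?t = 0" by (cases j) (auto simp: heis_slope_def)
    with frechet_derivative_at[OF d, symmetric] show ?thesis by simp
  qed
  have int: "integrable lborel (\<lambda>g. frechet_derivative u (at g) v)" if "u \<in> test_functions" for u v
    by (rule compactly_supported_integrable[OF _ test_functions_D(2)[OF that]])
       (use that in \<open>auto simp: frechet_derivative_off_support dest: test_functions_D
          intro: smooth_continuous smooth_frechet_derivative\<close>)
  show ?thesis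
    unfolding heis_field_smooth_eq[OF f] eq
    by (subst Bochner_Integration.integral_add) (auto intro: int F assms simp: integral_directional_derivative F assms)
qed

lemma heis_field_by_parts:
  assumes "f \<in> test_functions" "smooth u"
  shows "(LINT g|lborel. heis_field j f g * u g) = - (LINT g|lborel. f g * heis_field j u g)"
proof -
  have f: "smooth f" using assms(1) by (rule test_functions_D)
  have int: "integrable lborel (\<lambda>g. heis_field j f g * u g)" "integrable lborel (\<lambda>g. f g * heis_field j u g)"
    by (intro test_function_integrable test_function_times_smooth heis_field_test_function smooth_heis_field assms)+
  have "0 = (LINT g|lborel. heis_field j (\<lambda>g. f g * u g) g)"
    using integral_heis_field[OF test_function_times_smooth[OF assms]] by simp
  also have "\<dots> = (LINT g|lborel. heis_field j f g * u g) + (LINT g|lborel. f g * heis_field j u g)"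
    using int by (simp add: heis_field_mult f assms)
  finally show ?thesis by simp
qed

lemma sub_laplacian_by_parts:
  assumes "f \<in> test_functions" "smooth u"
  shows "(LINT g|lborel. sub_laplacian f g * u g) = (LINT g|lborel. f g * sub_laplacian u g)"
proof -
  have "(LINT g|lborel. sub_laplacian f g * u g) = (\<Sum>j\<in>UNIV. LINT g|lborel. heis_field j (heis_field j f) g * u g)"
    unfolding sub_laplacian_def sum_distrib_right
    by (intro Bochner_Integration.integral_sum test_function_integrable test_function_times_smooth
        heis_field_test_function assms)
  also have "\<dots> = (\<Sum>j\<in>UNIV. LINT g|lborel. f g * heis_field j (heis_field j u) g)"
    using assms by (simp add: heis_field_by_parts heis_field_test_function smooth_heis_field)
  also have "\<dots> = (LINT g|lborel. f g * sub_laplacian u g)"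
    unfolding sub_laplacian_def sum_distrib_left
    by (intro Bochner_Integration.integral_sum[symmetric] test_function_integrable test_function_times_smooth
        smooth_heis_field assms)
  finally show ?thesis .
qed

text \<open>Membership in the closure provides test functions on the left-hand side of the pairing, so
  \<open>u\<close> may have unbounded support.\<close>

lemma sub_laplacian_closure_by_parts:
  assumes "(f, v) \<in> sub_laplacian_closure" "smooth u" "u \<in> L2" "sub_laplacian u \<in> L2"
  shows "(LINT g|lborel. v g * u g) = (LINT g|lborel. f g * sub_laplacian u g)"
proof -
  from assms(1) obtain \<phi> where f: "f \<in> L2" and v: "v \<in> L2" and \<phi>: "\<And>k::nat. \<phi> k \<in> test_functions"
    and lim: "(\<lambda>k. L2_norm (\<lambda>g. \<phi> k g - f g)) \<longlonglongrightarrow> 0"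
      "(\<lambda>k. L2_norm (\<lambda>g. sub_laplacian (\<phi> k) g - v g)) \<longlonglongrightarrow> 0"
    unfolding sub_laplacian_closure_def by auto
  have pairing: "(\<lambda>k. LINT g|lborel. a k g * w g) \<longlonglongrightarrow> (LINT g|lborel. b g * w g)"
    if "\<And>k. a k \<in> L2" "b \<in> L2" "w \<in> L2" "(\<lambda>k. L2_norm (\<lambda>g. a k g - b g)) \<longlonglongrightarrow> 0"
    for a :: "nat \<Rightarrow> 'a heis \<Rightarrow> real" and b w
  proof (rule LIM_zero_cancel, rule tendsto_rabs_zero_cancel, rule Lim_null_comparison)
    show "(\<lambda>k. L2_norm (\<lambda>g. a k g - b g) * L2_norm w) \<longlonglongrightarrow> 0"
      using tendsto_mult_right[OF that(4), of "L2_norm w"] by simp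
    have "\<bar>(LINT g|lborel. a k g * w g) - (LINT g|lborel. b g * w g)\<bar> \<le> L2_norm (\<lambda>g. a k g - b g) * L2_norm w" for k
      using L2_pairing_bound[OF L2_diff[OF that(1,2)] that(3), of k]
      by (simp add: left_diff_distrib L2_mult_integrable that)
    then show "\<forall>\<^sub>F k in sequentially. norm \<bar>(LINT g|lborel. a k g * w g) - (LINT g|lborel. b g * w g)\<bar>
        \<le> L2_norm (\<lambda>g. a k g - b g) * L2_norm w" by simp
  qed
  have "(\<lambda>k. LINT g|lborel. sub_laplacian (\<phi> k) g * u g) \<longlonglongrightarrow> (LINT g|lborel. v g * u g)"
    by (rule pairing) (auto intro: test_function_L2 sub_laplacian_test_function \<phi> v assms lim)
  moreover have "(\<lambda>k. LINT g|lborel. \<phi> k g * sub_laplacian u g) \<longlonglongrightarrow> (LINT g|lborel. f g * sub_laplacian u g)"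
    by (rule pairing) (auto intro: test_function_L2 \<phi> f assms lim)
  ultimately show ?thesis
    using LIMSEQ_unique by (simp add: sub_laplacian_by_parts[OF \<phi> assms(2)])
qed

lemma test_function_in_closure:
  assumes "f \<in> test_functions" shows "(f, sub_laplacian f) \<in> sub_laplacian_closure"
  unfolding sub_laplacian_closure_def
  using assms by (auto intro!: test_function_L2 sub_laplacian_test_function exI[of _ "\<lambda>_. f"] simp: L2_norm_def)

section \<open>Duhamel's formula\<close>

lemma heat_semigroup_D:
  assumes "heat_semigroup T" "0 \<le> s" "f \<in> L2"
  shows "T s f \<in> L2" "L2_norm (T s f) \<le> L2_norm f"
  using assms by (auto simp: heat_semigroup_def contraction_semigroup_def)

text \<open>\<open>T\<^sub>s\<close> commutes with the difference quotients that define the generator at time zero.\<close>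

lemma heat_semigroup_quotient:
  assumes T: "heat_semigroup T" and f: "f \<in> L2" and u: "u \<in> L2" and s: "0 \<le> s" and k: "0 < k"
  shows "AE g in lborel. T s (\<lambda>z. (T k f z - f z) / k - u z) g = (T (s + k) f g - T s f g) / k - T s u g"
proof -
  have lin: "AE x in lborel. T s (\<lambda>z. a * v z + b * w z) x = a * T s v x + b * T s w x"
    if "v \<in> L2" "w \<in> L2" for a b v w
    using T s that by (simp add: heat_semigroup_def contraction_semigroup_def)
  have Tk: "T k f \<in> L2" using heat_semigroup_D[OF T _ f, of k] k by simp
  have d: "(\<lambda>z. 1 * T k f z + (-1) * f z) \<in> L2" using L2_diff[OF Tk f] by simp
  have "AE x in lborel. T (s + k) f x = T s (T k f) x"
    using T s k f by (simp add: heat_semigroup_def contraction_semigroup_def)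
  moreover note lin[OF Tk f, of 1 "-1"] lin[OF d u, of "1 / k" "-1"]
  ultimately show ?thesis by eventually_elim (simp add: diff_divide_distrib)
qed

lemma heat_semigroup_generator_orbit:
  assumes T: "heat_semigroup T" and f: "(f, u) \<in> generator T" and s: "0 \<le> s"
  shows "(T s f, T s u) \<in> generator T"
proof -
  have fu: "f \<in> L2" "u \<in> L2" and lim: "((\<lambda>k. L2_norm (\<lambda>x. (T k f x - f x) / k - u x)) \<longlongrightarrow> 0) (at_right 0)"
    using f by (auto simp: generator_def)
  have L2s: "T s f \<in> L2" "T s u \<in> L2" using heat_semigroup_D[OF T s] fu by auto
  have bound: "L2_norm (\<lambda>x. (T k (T s f) x - T s f x) / k - T s u x) \<le> L2_norm (\<lambda>x. (T k f x - f x) / k - u x)"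
    if k: "k > 0" for k
  proof -
    let ?r = "\<lambda>x. (T k f x - f x) / k - u x"
    have quot: "(\<lambda>x. (v x - w x) / k - z x) \<in> L2" if "v \<in> L2" "w \<in> L2" "z \<in> L2" for v w z :: "'a heis \<Rightarrow> real"
      using L2_diff[OF L2_scale[OF L2_diff[OF that(1,2)], of "1 / k"] that(3)] by simp
    have Tk: "T k f \<in> L2" and Tks: "T k (T s f) \<in> L2"
      using heat_semigroup_D[OF T] k fu L2s by auto
    have "AE x in lborel. T (k + s) f x = T k (T s f) x"
      using T s k fu by (simp add: heat_semigroup_def contraction_semigroup_def)
    with heat_semigroup_quotient[OF T fu s k]
    have "AE x in lborel. (T k (T s f) x - T s f x) / k - T s u x = T s ?r x"
      by eventually_elim (simp add: add.commute)
    then have "L2_norm (\<lambda>x. (T k (T s f) x - T s f x) / k - T s u x) = L2_norm (T s ?r)"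
      by (intro L2_norm_cong_AE quot heat_semigroup_D[OF T s] Tk Tks fu L2s)
    also have "\<dots> \<le> L2_norm ?r" by (intro quot heat_semigroup_D[OF T s] Tk fu)
    finally show ?thesis .
  qed
  have "((\<lambda>k. L2_norm (\<lambda>x. (T k (T s f) x - T s f x) / k - T s u x)) \<longlongrightarrow> 0) (at_right 0)"
    by (rule Lim_null_comparison[OF _ lim])
       (auto simp: eventually_at_right_field intro!: exI[of _ 1] bound)
  then show ?thesis using L2s by (simp add: generator_def)
qed

text \<open>The orbit of a test function stays in the domain of the generator, which is the closure of the
  sub-Laplacian; there integration by parts applies.\<close>

lemma heat_orbit_symmetric:
  assumes T: "heat_semigroup T" and f: "f \<in> test_functions" and s: "0 \<le> s"
    and U: "smooth U" "U \<in> L2" "sub_laplacian U \<in> L2"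
  shows "(LINT g|lborel. T s (sub_laplacian f) g * U g) = (LINT g|lborel. T s f g * sub_laplacian U g)"
proof -
  have "(f, sub_laplacian f) \<in> generator T"
    using test_function_in_closure[OF f] T by (simp add: heat_semigroup_def)
  then have "(T s f, T s (sub_laplacian f)) \<in> sub_laplacian_closure"
    using heat_semigroup_generator_orbit[OF T _ s] T by (simp add: heat_semigroup_def)
  then show ?thesis by (rule sub_laplacian_closure_by_parts) (fact U)+
qed

text \<open>One step of length \<open>k\<close> replaces \<open>(T\<^sub>s f, V)\<close> by \<open>(T\<^bsub>s+k\<^esub> f, U)\<close>, where \<open>V\<close> is the solution
  \<open>k\<close> units of time after \<open>U\<close>.  Moving \<open>T\<^sub>k - 1\<close> to the other side gives \<open>k \<Delta>U\<close>, which nearly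
  cancels \<open>V - U\<close>; what remains is controlled by the defect \<open>\<eta>\<close> of the heat equation, by the
  distance of the difference quotient from the generator, and by the Taylor error of the curve.\<close>

lemma duhamel_step:
  assumes T: "heat_semigroup T" and f: "f \<in> test_functions" and s: "0 \<le> s" and k: "0 < k"
    and U: "smooth U" "U \<in> L2" "sub_laplacian U \<in> L2" and L2: "U' \<in> L2" "V \<in> L2"
    and M: "L2_norm U \<le> M" and eta: "L2_norm (\<lambda>g. sub_laplacian U g - U' g) \<le> \<eta>"
    and B: "L2_norm (\<lambda>g. V g - U g - k * U' g) \<le> k\<^sup>2 * B"
  shows "\<bar>(LINT g|lborel. T (s + k) f g * U g) - (LINT g|lborel. T s f g * V g)\<bar>
    \<le> k * (L2_norm f * \<eta> + L2_norm (\<lambda>g. (T k f g - f g) / k - sub_laplacian f g) * M + k * L2_norm f * B)"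
proof -
  let ?r = "\<lambda>g. (T k f g - f g) / k - sub_laplacian f g"
  have fL2: "f \<in> L2" and Lf: "sub_laplacian f \<in> L2"
    using f by (auto intro: test_function_L2 sub_laplacian_test_function)
  have Tk: "T k f \<in> L2" and Ts: "T s f \<in> L2" and Tsk: "T (s + k) f \<in> L2" and TL: "T s (sub_laplacian f) \<in> L2"
    using heat_semigroup_D[OF T] s k fL2 Lf by auto
  have r: "?r \<in> L2" using L2_diff[OF L2_scale[OF L2_diff[OF Tk fL2], of "1 / k"] Lf] by simp
  then have Tr: "T s ?r \<in> L2" "L2_norm (T s ?r) \<le> L2_norm ?r" using heat_semigroup_D[OF T s] by auto
  have E: "(\<lambda>g. sub_laplacian U g - U' g) \<in> L2" and R: "(\<lambda>g. V g - U g - k * U' g) \<in> L2"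
    using U L2 by (auto intro!: L2_diff L2_scale)
  have "(LINT g|lborel. T (s + k) f g * U g)
      = (LINT g|lborel. T s f g * U g + k * (T s (sub_laplacian f) g * U g) + k * (T s ?r g * U g))"
  proof (rule integral_cong_AE)
    show "AE g in lborel. T (s + k) f g * U g
        = T s f g * U g + k * (T s (sub_laplacian f) g * U g) + k * (T s ?r g * U g)"
      using heat_semigroup_quotient[OF T fL2 Lf s k]
    proof eventually_elim
      case (elim g)
      have "T (s + k) f g = T s f g + k * T s (sub_laplacian f) g + k * T s ?r g"
        using k unfolding elim by (simp add: field_simps)
      then show ?case by (metis (no_types, lifting) distrib_right mult.assoc)
    qed
  qed (use L2_D(2)[OF Tsk] L2_D(2)[OF Ts] L2_D(2)[OF TL] L2_D(2)[OF Tr(1)] L2_D(2)[OF U(2)] in measurable)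
  also have "\<dots> = (LINT g|lborel. T s f g * U g) + k * (LINT g|lborel. T s (sub_laplacian f) g * U g)
      + k * (LINT g|lborel. T s ?r g * U g)"
    using Ts TL Tr U by (simp add: L2_mult_integrable)
  also have "(LINT g|lborel. T s (sub_laplacian f) g * U g) = (LINT g|lborel. T s f g * sub_laplacian U g)"
    by (rule heat_orbit_symmetric[OF T f s U])
  finally have 1: "(LINT g|lborel. T (s + k) f g * U g) = (LINT g|lborel. T s f g * U g)
      + k * (LINT g|lborel. T s f g * sub_laplacian U g) + k * (LINT g|lborel. T s ?r g * U g)" .
  have 2: "(LINT g|lborel. T s f g * (sub_laplacian U g - U' g))
      = (LINT g|lborel. T s f g * sub_laplacian U g) - (LINT g|lborel. T s f g * U' g)"
    using Ts U L2 by (simp add: right_diff_distrib L2_mult_integrable)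
  have 3: "(LINT g|lborel. T s f g * (V g - U g - k * U' g))
      = (LINT g|lborel. T s f g * V g) - (LINT g|lborel. T s f g * U g) - k * (LINT g|lborel. T s f g * U' g)"
  proof -
    have "(LINT g|lborel. T s f g * (V g - U g - k * U' g))
        = (LINT g|lborel. T s f g * V g - T s f g * U g - k * (T s f g * U' g))"
      by (simp add: algebra_simps)
    also have "\<dots> = (LINT g|lborel. T s f g * V g) - (LINT g|lborel. T s f g * U g) - k * (LINT g|lborel. T s f g * U' g)"
      using Ts U L2 by (simp add: L2_mult_integrable)
    finally show ?thesis .
  qed
  have nf: "L2_norm (T s f) \<le> L2_norm f" using heat_semigroup_D[OF T s fL2] by simp
  have "\<bar>LINT g|lborel. T s f g * (sub_laplacian U g - U' g)\<bar> \<le> L2_norm f * \<eta>"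
    by (rule order_trans[OF L2_pairing_bound[OF Ts E]]) (intro mult_mono nf eta; simp)
  moreover have "\<bar>LINT g|lborel. T s ?r g * U g\<bar> \<le> L2_norm ?r * M"
    by (rule order_trans[OF L2_pairing_bound[OF Tr(1) U(2)]]) (intro mult_mono Tr M; simp)
  moreover have "\<bar>LINT g|lborel. T s f g * (V g - U g - k * U' g)\<bar> \<le> L2_norm f * (k\<^sup>2 * B)"
    by (rule order_trans[OF L2_pairing_bound[OF Ts R]]) (intro mult_mono nf B; simp)
  moreover have "(LINT g|lborel. T (s + k) f g * U g) - (LINT g|lborel. T s f g * V g)
      = k * (LINT g|lborel. T s f g * (sub_laplacian U g - U' g)) + k * (LINT g|lborel. T s ?r g * U g)
        - (LINT g|lborel. T s f g * (V g - U g - k * U' g))"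
    unfolding 1 2 3 by (simp add: algebra_simps)
  moreover have "\<bar>k * a + k * b - c\<bar> \<le> k * A + k * A' + C"
    if "\<bar>a\<bar> \<le> A" "\<bar>b\<bar> \<le> A'" "\<bar>c\<bar> \<le> C" for a b c A A' C :: real
  proof -
    have "\<bar>k * a\<bar> \<le> k * A" "\<bar>k * b\<bar> \<le> k * A'" using that k by (simp_all add: abs_mult)
    with that(3) show ?thesis by linarith
  qed
  ultimately have "\<bar>(LINT g|lborel. T (s + k) f g * U g) - (LINT g|lborel. T s f g * V g)\<bar>
      \<le> k * (L2_norm f * \<eta>) + k * (L2_norm ?r * M) + L2_norm f * (k\<^sup>2 * B)"
    by presburger
  then show ?thesis by (simp add: algebra_simps power2_eq_square)
qed

text \<open>The interval \<open>[0, h]\<close> is cut into steps of equal length; as the length tends to zero, the last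
  two errors of each step are of smaller order than the length and only the defect \<open>\<eta>\<close> survives.\<close>

lemma duhamel:
  fixes U U' :: "real \<Rightarrow> 'n::finite heis \<Rightarrow> real"
  assumes T: "heat_semigroup T" and f: "f \<in> test_functions" and h: "0 < h"
    and U: "\<And>s. 0 \<le> s \<Longrightarrow> s \<le> h \<Longrightarrow> smooth (U s) \<and> U s \<in> L2 \<and> sub_laplacian (U s) \<in> L2 \<and> U' s \<in> L2"
    and M: "\<And>s. 0 \<le> s \<Longrightarrow> s \<le> h \<Longrightarrow> L2_norm (U s) \<le> M"
    and eta: "\<And>s. 0 \<le> s \<Longrightarrow> s \<le> h \<Longrightarrow> L2_norm (\<lambda>g. sub_laplacian (U s) g - U' s g) \<le> \<eta>"
    and B: "\<And>s k. 0 \<le> s \<Longrightarrow> 0 < k \<Longrightarrow> s + k \<le> h \<Longrightarrow>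
        L2_norm (\<lambda>g. U (s + k) g - U s g - k * U' s g) \<le> k\<^sup>2 * B"
  shows "\<bar>(LINT g|lborel. T h f g * U 0 g) - (LINT g|lborel. f g * U h g)\<bar> \<le> h * (L2_norm f * \<eta>)"
proof -
  define F where "F s = (LINT g|lborel. T s f g * U (h - s) g)" for s
  define r where "r k = L2_norm (\<lambda>g. (T k f g - f g) / k - sub_laplacian f g)" for k
  define b where "b k = L2_norm f * \<eta> + r k * M + k * L2_norm f * B" for k
  have fL2: "f \<in> L2" using f by (rule test_function_L2)
  have step: "\<bar>F (s + k) - F s\<bar> \<le> k * b k" if "0 \<le> s" "0 < k" "s + k \<le> h" for s k
  proof -
    have 1: "h - s = (h - (s + k)) + k" and 2: "0 \<le> h - (s + k)" "h - (s + k) \<le> h" "0 \<le> h - s" "h - s \<le> h"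
      using that by auto
    have 3: "L2_norm (\<lambda>g. U (h - s) g - U (h - (s + k)) g - k * U' (h - (s + k)) g) \<le> k\<^sup>2 * B"
      unfolding 1 by (rule B) (use that in auto)
    note u = U[OF 2(1,2), THEN conjunct1] U[OF 2(1,2), THEN conjunct2, THEN conjunct1]
      U[OF 2(1,2), THEN conjunct2, THEN conjunct2]
    show ?thesis unfolding F_def b_def r_def
      by (rule duhamel_step[OF T f that(1,2) u(1,2) u(3)[THEN conjunct1] u(3)[THEN conjunct2]
            U[OF 2(3,4), THEN conjunct2, THEN conjunct1] M[OF 2(1,2)] eta[OF 2(1,2)] 3])
  qed
  have total: "\<bar>F h - F 0\<bar> \<le> h * b (h / real (Suc N))" for N
  proof -
    define k where "k = h / real (Suc N)"
    have k: "0 < k" "real (Suc N) * k = h" using h by (auto simp: k_def)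
    have "F h - F 0 = (\<Sum>i<Suc N. F (real (Suc i) * k) - F (real i * k))"
      using sum_lessThan_telescope[of "\<lambda>i. F (real i * k)" "Suc N"] k(2) by simp
    also have "\<bar>\<dots>\<bar> \<le> (\<Sum>i<Suc N. k * b k)"
    proof (rule order_trans[OF sum_abs], rule sum_mono)
      fix i assume "i \<in> {..<Suc N}"
      then have "real (Suc i) \<le> real (Suc N)" by simp
      then have "real (Suc i) * k \<le> h" using k by (metis mult_right_mono less_imp_le)
      moreover have "real (Suc i) * k = real i * k + k" by (simp add: algebra_simps)
      ultimately show "\<bar>F (real (Suc i) * k) - F (real i * k)\<bar> \<le> k * b k"
        using step[of "real i * k" k] k by simp
    qed
    also have "\<dots> = h * b k" using k(2) by simp
    finally show ?thesis by (simp add: k_def)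
  qed
  have "(f, sub_laplacian f) \<in> generator T"
    using test_function_in_closure[OF f] T by (simp add: heat_semigroup_def)
  then have "(r \<longlongrightarrow> 0) (at_right 0)" by (simp add: generator_def r_def[abs_def])
  moreover have k0: "(\<lambda>N. h / real (Suc N)) \<longlonglongrightarrow> 0"
    using LIMSEQ_Suc[OF lim_const_over_n[of h]] by simp
  then have "filterlim (\<lambda>N. h / real (Suc N)) (at_right 0) sequentially"
    using h by (simp add: filterlim_at)
  ultimately have "(\<lambda>N. r (h / real (Suc N))) \<longlonglongrightarrow> 0" by (rule filterlim_compose)
  then have "(\<lambda>N. h * b (h / real (Suc N))) \<longlonglongrightarrow> h * (L2_norm f * \<eta> + 0 * M + 0 * L2_norm f * B)"
    unfolding b_def using k0 by (intro tendsto_intros)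
  then have "\<bar>F h - F 0\<bar> \<le> h * (L2_norm f * \<eta>)"
    using LIMSEQ_le_const[of _ _ "\<bar>F h - F 0\<bar>"] total by auto
  moreover have "F 0 = (LINT g|lborel. f g * U h g)"
    unfolding F_def
  proof (rule integral_cong_AE)
    have Uh: "U h \<in> L2" using U h by simp
    have "AE g in lborel. T 0 f g = f g"
      using T fL2 by (simp add: heat_semigroup_def contraction_semigroup_def)
    then show "AE g in lborel. T 0 f g * U (h - 0) g = f g * U h g" by eventually_elim simp
    show "(\<lambda>g. T 0 f g * U (h - 0) g) \<in> borel_measurable lborel" "(\<lambda>g. f g * U h g) \<in> borel_measurable lborel"
      using L2_D(2)[OF Uh] L2_D(2)[OF fL2] L2_D(2)[OF heat_semigroup_D(1)[OF T order_refl fL2]] by simp_all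
  qed
  ultimately show ?thesis by (simp add: F_def)
qed

section \<open>Gaussian weights\<close>

lemma integral_lborel_product:
  fixes f :: "'a::euclidean_space \<Rightarrow> real" and g :: "'b::euclidean_space \<Rightarrow> real"
  assumes f: "integrable lborel f" and g: "integrable lborel g"
  shows "integrable lborel (\<lambda>p. f (fst p) * g (snd p))"
    and "(LINT p|lborel. f (fst p) * g (snd p)) = (LINT x|lborel. f x) * (LINT y|lborel. g y)"
proof -
  have [measurable]: "f \<in> borel_measurable borel" "g \<in> borel_measurable borel"
    using borel_measurable_integrable[OF f] borel_measurable_integrable[OF g] by simp_all
  have int: "integrable (lborel \<Otimes>\<^sub>M lborel) (\<lambda>(x, y). f x * g y)"
    by (rule lborel_pair.Fubini_integrable) (use f g in \<open>auto simp: abs_mult\<close>)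
  then show "integrable lborel (\<lambda>p. f (fst p) * g (snd p))"
    by (simp add: lborel_prod case_prod_beta')
  have "(LINT p|lborel. f (fst p) * g (snd p)) = integral\<^sup>L (lborel \<Otimes>\<^sub>M lborel) (\<lambda>(x, y). f x * g y)"
    by (simp add: lborel_prod case_prod_beta')
  also have "\<dots> = (LINT x|lborel. LINT y|lborel. f x * g y)"
    using lborel_pair.integral_fst'[OF int] by simp
  finally show "(LINT p|lborel. f (fst p) * g (snd p)) = (LINT x|lborel. f x) * (LINT y|lborel. g y)"
    by simp
qed

lemma integrable_inverse_one_plus_square: "integrable lborel (\<lambda>t::real. 1 / (1 + t\<^sup>2))"
  using integrable_inverse_1_plus_square
  by (simp add: set_integrable_def einterval_def inverse_eq_divide cong: if_cong)

lemma integrable_gaussian_real: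
  assumes "c > 0" shows "integrable lborel (\<lambda>t::real. exp (- c * t\<^sup>2))"
proof (rule Bochner_Integration.integrable_bound)
  show "integrable lborel (\<lambda>t::real. (1 + 1 / c) * (1 / (1 + t\<^sup>2)))"
    using integrable_inverse_one_plus_square by (rule integrable_mult_right)
  show "AE t in lborel. norm (exp (- c * t\<^sup>2)) \<le> norm ((1 + 1 / c) * (1 / (1 + t\<^sup>2)))"
  proof (rule AE_I2)
    fix t :: real
    have "1 + t\<^sup>2 \<le> (1 + 1 / c) * (1 + c * t\<^sup>2)"
      using assms by (simp add: field_simps)
    also have "\<dots> \<le> (1 + 1 / c) * exp (c * t\<^sup>2)"
      using assms by (intro mult_left_mono) (auto simp: exp_ge_add_one_self)
    finally have "(1 + t\<^sup>2) * exp (- c * t\<^sup>2) \<le> 1 + 1 / c"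
      by (simp add: exp_minus field_simps)
    moreover have "1 + t\<^sup>2 > 0" by (simp add: add_pos_nonneg)
    ultimately show "norm (exp (- c * t\<^sup>2)) \<le> norm ((1 + 1 / c) * (1 / (1 + t\<^sup>2)))"
      using assms by (simp add: abs_mult pos_le_divide_eq mult.commute)
  qed
qed simp

lemma integrable_gaussian:
  assumes "c > 0" shows "integrable lborel (\<lambda>x::'a::euclidean_space. exp (- c * (x \<bullet> x)))"
proof (rule integrableI_bounded)
  have "(\<integral>\<^sup>+x. ennreal (norm (exp (- c * (x \<bullet> x)))) \<partial>(lborel :: 'a measure))
      = (\<integral>\<^sup>+x. (\<Prod>b\<in>Basis. ennreal (exp (- c * (x \<bullet> b)\<^sup>2))) \<partial>(lborel :: 'a measure))"
  proof (rule nn_integral_cong)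
    fix x :: 'a
    have "exp (- c * (x \<bullet> x)) = (\<Prod>b\<in>Basis. exp (- c * (x \<bullet> b)\<^sup>2))"
      by (subst euclidean_inner) (simp add: sum_distrib_left exp_sum power2_eq_square flip: sum_negf)
    then show "ennreal (norm (exp (- c * (x \<bullet> x)))) = (\<Prod>b\<in>Basis. ennreal (exp (- c * (x \<bullet> b)\<^sup>2)))"
      by (simp add: prod_ennreal abs_prod)
  qed
  also have "\<dots> = (\<Prod>b\<in>(Basis::'a set). \<integral>\<^sup>+t. ennreal (exp (- c * t\<^sup>2)) \<partial>lborel)"
    by (rule nn_integral_lborel_prod) auto
  also have "\<dots> < \<infinity>"
    using integrable_gaussian_real[OF assms]
    by (auto simp: integrable_iff_bounded less_top[symmetric] ennreal_prod_eq_top power_eq_top_ennreal)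
  finally show "(\<integral>\<^sup>+x. ennreal (norm (exp (- c * (x \<bullet> x)))) \<partial>(lborel :: 'a measure)) < \<infinity>" .
qed simp

definition horiz :: "'n::finite heis \<Rightarrow> real" where
  "horiz g = fst g \<bullet> fst g + fst (snd g) \<bullet> fst (snd g)"

definition vert :: "'n::finite heis \<Rightarrow> real" where
  "vert g = snd (snd g)"

lemma horiz_vert_simps [simp]: "horiz (x, y, t) = x \<bullet> x + y \<bullet> y" "vert (x, y, t) = t"
  by (simp_all add: horiz_def vert_def)

lemma horiz_nonneg [simp]: "0 \<le> horiz g" by (simp add: horiz_def)

lemma continuous_horiz: "continuous_on UNIV horiz" and continuous_vert: "continuous_on UNIV vert"
  unfolding horiz_def[abs_def] vert_def[abs_def] by (intro continuous_intros)+

lemma borel_horiz [measurable]: "horiz \<in> borel_measurable borel"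
  and borel_vert [measurable]: "vert \<in> borel_measurable borel"
  using continuous_horiz continuous_vert by (auto intro: borel_measurable_continuous_onI)

lemma integral_horiz_vert:
  fixes k :: "real \<Rightarrow> real"
  assumes c: "c > 0" and k: "integrable lborel k"
  shows "integrable lborel (\<lambda>g::'n::finite heis. exp (- c * horiz g) * k (vert g))" (is ?I)
    and "(LINT g|lborel. exp (- c * horiz (g::'n heis)) * k (vert g))
      = (LINT x|lborel. exp (- c * ((x::real^'n) \<bullet> x)))\<^sup>2 * (LINT t|lborel. k t)" (is ?E)
proof -
  let ?G = "\<lambda>x::real^'n. exp (- c * (x \<bullet> x))"
  note G = integrable_gaussian[OF c, where 'a="real^'n"]
  note 1 = integral_lborel_product[OF G k]
  note 2 = integral_lborel_product[OF G 1(1)]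
  have eq: "?G (fst g) * (?G (fst (snd g)) * k (snd (snd g))) = exp (- c * horiz g) * k (vert g)" for g :: "'n heis"
    by (simp add: horiz_def vert_def distrib_left exp_add exp_diff exp_minus field_simps)
  show ?I using 2(1) unfolding eq .
  show ?E using 2(2) 1(2) unfolding eq by (simp add: power2_eq_square)
qed

definition gauss_weight :: "real \<Rightarrow> real \<Rightarrow> 'n::finite heis \<Rightarrow> real" where
  "gauss_weight c e g = exp (- c * horiz g - e * (vert g)\<^sup>2)"

lemma gauss_weight_square: "(gauss_weight c e g)\<^sup>2 = exp (- (2 * c) * horiz g) * exp (- (2 * e) * (vert g)\<^sup>2)"
  by (simp add: gauss_weight_def power2_eq_square exp_add[symmetric] exp_diff field_simps)

lemma borel_gauss_weight [measurable]: "gauss_weight c e \<in> borel_measurable borel"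
  unfolding gauss_weight_def[abs_def] by measurable

lemma gauss_weight_L2: "c > 0 \<Longrightarrow> e > 0 \<Longrightarrow> gauss_weight c e \<in> L2"
  using integral_horiz_vert(1)[OF _ integrable_gaussian_real, of "2 * c" "2 * e"]
  by (simp add: L2_def gauss_weight_square)

lemma gauss_weight_nonneg [simp]: "0 \<le> gauss_weight c e g" by (simp add: gauss_weight_def)

text \<open>Slow vertical decay costs a factor \<open>1/\<eta>\<close> in the norm.  The parametrisation of the rate by
  \<open>\<eta>\<^sup>4\<close> makes all powers integral.\<close>

lemma gauss_weight_norm_scaling:
  assumes "c > 0" "e > 0" "\<eta> > 0"
  shows "L2_norm (gauss_weight c (\<eta> ^ 4 * e) :: 'n::finite heis \<Rightarrow> real) = L2_norm (gauss_weight c e :: 'n heis \<Rightarrow> real) / \<eta>"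
proof -
  have scale: "(LINT t|lborel. exp (- (2 * (\<eta> ^ 4 * e)) * t\<^sup>2)) = (LINT t|lborel. exp (- (2 * e) * t\<^sup>2)) / \<eta>\<^sup>2"
  proof -
    have "(LINT t|lborel. exp (- (2 * e) * t\<^sup>2)) = \<bar>\<eta>\<^sup>2\<bar> *\<^sub>R (LINT t|lborel. exp (- (2 * e) * (0 + \<eta>\<^sup>2 * t)\<^sup>2))"
      using assms by (intro lborel_integral_real_affine) simp
    also have "(\<lambda>t. exp (- (2 * e) * (0 + \<eta>\<^sup>2 * t)\<^sup>2)) = (\<lambda>t. exp (- (2 * (\<eta> ^ 4 * e)) * t\<^sup>2))"
      by (rule ext) (simp add: power_mult_distrib mult_ac)
    finally show ?thesis using assms by simp
  qed
  have norm: "(LINT g|lborel. (gauss_weight c e' (g::'n heis))\<^sup>2)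
      = (LINT x|lborel. exp (- (2 * c) * ((x::real^'n) \<bullet> x)))\<^sup>2 * (LINT t|lborel. exp (- (2 * e') * t\<^sup>2))" if "e' > 0" for e'
    unfolding gauss_weight_square using assms that
    by (intro integral_horiz_vert(2) integrable_gaussian_real) auto
  have "\<eta> ^ 4 * e > 0" using assms by simp
  then have "(LINT g|lborel. (gauss_weight c (\<eta> ^ 4 * e) (g::'n heis))\<^sup>2) = (LINT g|lborel. (gauss_weight c e (g::'n heis))\<^sup>2) / \<eta>\<^sup>2"
    using assms by (subst (1 2) norm) (simp_all only: scale times_divide_eq_right)
  then show ?thesis using assms by (simp add: L2_norm_def real_sqrt_divide)
qed

section \<open>Gaussian solutions of the heat equation at one frequency\<close>

text \<open>For \<open>\<psi>'' = - \<omega>\<^sup>2 \<psi>\<close> and \<open>\<rho> = |x|\<^sup>2 + |y|\<^sup>2\<close> the sub-Laplacian maps \<open>\<psi>(t) e\<^bsup>-m\<rho>\<^esup>\<close> to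
  \<open>(4m\<^sup>2\<rho> - 4nm - 4\<omega>\<^sup>2\<rho>) \<psi>(t) e\<^bsup>-m\<rho>\<^esup>\<close>.  Hence \<open>\<psi>(t) w\<^bsup>-n\<^esup> e\<^bsup>-m\<rho>\<^esup>\<close> solves the heat equation when
  \<open>m' = 4\<omega>\<^sup>2 - 4m\<^sup>2\<close> and \<open>w' = 4mw\<close>.  This Riccati system linearises to \<open>w'' = 16\<omega>\<^sup>2 w\<close>; the solution
  below has \<open>w(0) = 1\<close> and \<open>m(0) = \<mu>\<close>.\<close>

definition mehler_w :: "real \<Rightarrow> real \<Rightarrow> real \<Rightarrow> real" where
  "mehler_w \<omega> \<mu> s = cosh (4 * \<omega> * s) + \<mu> / \<omega> * sinh (4 * \<omega> * s)"

definition mehler_m :: "real \<Rightarrow> real \<Rightarrow> real \<Rightarrow> real" where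
  "mehler_m \<omega> \<mu> s = (\<mu> * cosh (4 * \<omega> * s) + \<omega> * sinh (4 * \<omega> * s)) / mehler_w \<omega> \<mu> s"

definition mehler_v :: "nat \<Rightarrow> real \<Rightarrow> real \<Rightarrow> real \<Rightarrow> real \<Rightarrow> real" where
  "mehler_v n \<omega> \<mu> r s = exp (- mehler_m \<omega> \<mu> s * r) / mehler_w \<omega> \<mu> s ^ n"

lemma mehler_w_ge_1: "\<omega> > 0 \<Longrightarrow> \<mu> > 0 \<Longrightarrow> s \<ge> 0 \<Longrightarrow> mehler_w \<omega> \<mu> s \<ge> 1"
  unfolding mehler_w_def
  using cosh_real_ge_1[of "4 * \<omega> * s"] by (intro add_increasing2 mult_nonneg_nonneg) simp_all

lemma mehler_0 [simp]: "mehler_w \<omega> \<mu> 0 = 1" "mehler_m \<omega> \<mu> 0 = \<mu>"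
  by (simp_all add: mehler_w_def mehler_m_def)

lemma sinh_le_mult_cosh: "0 \<le> (r::real) \<Longrightarrow> sinh r \<le> r * cosh r"
proof (rule DERIV_nonneg_imp_nondecreasing[of 0 r "\<lambda>r. r * cosh r - sinh r", simplified], goal_cases)
  case (1) then show ?case by simp
next
  case (2 x)
  then show ?case by (intro exI[of _ "x * sinh x"]) (auto intro!: derivative_eq_intros)
qed

text \<open>The lower bound is the limit of \<open>m(h)\<close> as \<open>\<omega> \<rightarrow> 0\<close>.  It does not involve \<open>\<omega>\<close>, which
  keeps the later estimates integrable at low frequencies.\<close>

lemma mehler_m_bounds:
  assumes "\<omega> > 0" "\<mu> > 0" "0 \<le> s" "s \<le> h"
  shows "\<mu> / (1 + 4 * h * \<mu>) \<le> mehler_m \<omega> \<mu> s" "mehler_m \<omega> \<mu> s \<le> \<omega> + \<mu>"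
proof -
  let ?C = "cosh (4 * \<omega> * s)" and ?S = "sinh (4 * \<omega> * s)"
  have pos: "?C > 0" "?S \<ge> 0" using assms by (simp_all add: cosh_real_pos)
  have w: "mehler_w \<omega> \<mu> s > 0" using mehler_w_ge_1[OF assms(1-3)] by simp
  \<comment> \<open>At low frequency \<open>sinh (4\<omega>s) / \<omega>\<close> stays bounded by \<open>4s cosh (4\<omega>s)\<close>.\<close>
  have "?S \<le> 4 * \<omega> * s * ?C" using assms by (intro sinh_le_mult_cosh) simp
  then have "\<mu> / \<omega> * ?S \<le> \<mu> / \<omega> * (4 * \<omega> * s * ?C)" using assms by (intro mult_left_mono) auto
  also have "\<dots> = 4 * s * \<mu> * ?C" using assms by simp
  also have "\<dots> \<le> 4 * h * \<mu> * ?C" using assms pos by simp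
  finally have "mehler_w \<omega> \<mu> s \<le> (1 + 4 * h * \<mu>) * ?C" unfolding mehler_w_def by (simp add: algebra_simps)
  then have "\<mu> * mehler_w \<omega> \<mu> s \<le> \<mu> * ((1 + 4 * h * \<mu>) * ?C)" using assms by simp
  also have "\<dots> \<le> (1 + 4 * h * \<mu>) * (\<mu> * ?C + \<omega> * ?S)" using assms pos by (simp add: algebra_simps)
  finally show "\<mu> / (1 + 4 * h * \<mu>) \<le> mehler_m \<omega> \<mu> s"
    unfolding mehler_m_def using w assms by (simp add: field_simps add_pos_nonneg)
  have "\<mu> * ?C + \<omega> * ?S \<le> (\<omega> + \<mu>) * (?C + \<mu> / \<omega> * ?S)"
  proof -
    have "(\<omega> + \<mu>) * (?C + \<mu> / \<omega> * ?S) - (\<mu> * ?C + \<omega> * ?S) = \<omega> * (?C - ?S) + \<mu> * ?S + \<mu> * \<mu> / \<omega> * ?S"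
      using assms by (simp add: field_simps)
    moreover have "?S \<le> ?C" using sinh_less_cosh_real[of "4 * \<omega> * s"] by simp
    ultimately show ?thesis using assms pos by (smt (verit) divide_nonneg_pos mult_nonneg_nonneg)
  qed
  then show "mehler_m \<omega> \<mu> s \<le> \<omega> + \<mu>"
    unfolding mehler_m_def using w by (simp add: mehler_w_def pos_divide_le_eq)
qed

lemma mehler_w_deriv:
  assumes "\<omega> > 0" "\<mu> > 0" "0 \<le> s"
  shows "(mehler_w \<omega> \<mu> has_real_derivative 4 * mehler_m \<omega> \<mu> s * mehler_w \<omega> \<mu> s) (at s)"
proof -
  have w: "mehler_w \<omega> \<mu> s > 0" using mehler_w_ge_1[OF assms] by simp
  have "(mehler_w \<omega> \<mu> has_real_derivative 4 * (\<mu> * cosh (4 * \<omega> * s) + \<omega> * sinh (4 * \<omega> * s))) (at s)"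
    unfolding mehler_w_def[abs_def] using assms by (auto intro!: derivative_eq_intros simp: field_simps)
  then show ?thesis using w by (simp add: mehler_m_def)
qed

lemma mehler_m_deriv:
  assumes "\<omega> > 0" "\<mu> > 0" "0 \<le> s"
  shows "(mehler_m \<omega> \<mu> has_real_derivative 4 * \<omega>\<^sup>2 - 4 * (mehler_m \<omega> \<mu> s)\<^sup>2) (at s)"
proof -
  let ?N = "\<lambda>s. \<mu> * cosh (4 * \<omega> * s) + \<omega> * sinh (4 * \<omega> * s)"
  have w: "mehler_w \<omega> \<mu> s > 0" using mehler_w_ge_1[OF assms] by simp
  have N: "(?N has_real_derivative 4 * \<omega>\<^sup>2 * mehler_w \<omega> \<mu> s) (at s)"
    using assms by (auto intro!: derivative_eq_intros simp: mehler_w_def field_simps power2_eq_square)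
  have "((\<lambda>s. ?N s / mehler_w \<omega> \<mu> s) has_real_derivative
      (4 * \<omega>\<^sup>2 * mehler_w \<omega> \<mu> s * mehler_w \<omega> \<mu> s - ?N s * (4 * mehler_m \<omega> \<mu> s * mehler_w \<omega> \<mu> s))
        / (mehler_w \<omega> \<mu> s * mehler_w \<omega> \<mu> s)) (at s)"
    by (rule DERIV_divide[OF N mehler_w_deriv[OF assms]]) (use w in simp)
  also have "(\<lambda>s. ?N s / mehler_w \<omega> \<mu> s) = mehler_m \<omega> \<mu>" by (simp add: mehler_m_def[abs_def])
  also have "?N s = mehler_m \<omega> \<mu> s * mehler_w \<omega> \<mu> s" using w by (simp add: mehler_m_def)
  also have "(4 * \<omega>\<^sup>2 * mehler_w \<omega> \<mu> s * mehler_w \<omega> \<mu> s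
        - mehler_m \<omega> \<mu> s * mehler_w \<omega> \<mu> s * (4 * mehler_m \<omega> \<mu> s * mehler_w \<omega> \<mu> s))
        / (mehler_w \<omega> \<mu> s * mehler_w \<omega> \<mu> s) = 4 * \<omega>\<^sup>2 - 4 * (mehler_m \<omega> \<mu> s)\<^sup>2"
    using w by (simp add: field_simps power2_eq_square)
  finally show ?thesis .
qed

lemma heis_field_gaussian:
  fixes i :: "'n::finite"
  assumes "\<And>t. (\<psi> has_real_derivative \<psi>' t) (at t)"
  shows "heis_field (Inl i) (\<lambda>g. \<psi> (vert g) * exp (- m * horiz g))
      = (\<lambda>(x, y, t). (2 * (y $ i) * \<psi>' t - 2 * m * (x $ i) * \<psi> t) * exp (- m * (x \<bullet> x + y \<bullet> y)))" (is ?X)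
    and "heis_field (Inr i) (\<lambda>g. \<psi> (vert g) * exp (- m * horiz g))
      = (\<lambda>(x, y, t). (- 2 * (x $ i) * \<psi>' t - 2 * m * (y $ i) * \<psi> t) * exp (- m * (x \<bullet> x + y \<bullet> y)))" (is ?Y)
proof -
  have ip: "(x + s *\<^sub>R axis i 1) \<bullet> (x + s *\<^sub>R axis i 1) = x \<bullet> x + 2 * s * (x $ i) + s\<^sup>2" for x :: "real^'n" and s
    by (simp add: inner_add_left inner_add_right inner_axis inner_axis' axis_eq_axis algebra_simps power2_eq_square)
  have t: "deriv (\<lambda>s. \<psi> s * E) t = \<psi>' t * E" for E t
    by (rule DERIV_imp_deriv) (auto intro!: derivative_eq_intros assms)
  have x: "deriv (\<lambda>s. A * exp (- m * (X + 2 * s * a + s\<^sup>2 + Y))) 0 = - 2 * m * a * A * exp (- m * (X + Y))" for A X Y a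
    by (rule DERIV_imp_deriv) (auto intro!: derivative_eq_intros simp: algebra_simps)
  have y: "deriv (\<lambda>s. A * exp (- m * (X + (Y + 2 * s * a + s\<^sup>2)))) 0 = - 2 * m * a * A * exp (- m * (X + Y))" for A X Y a
    by (rule DERIV_imp_deriv) (auto intro!: derivative_eq_intros simp: algebra_simps)
  show ?X by (rule ext) (auto simp only: heis_field.simps horiz_vert_simps ip t x split: prod.split, simp add: algebra_simps)
  show ?Y by (rule ext) (auto simp only: heis_field.simps horiz_vert_simps ip t y split: prod.split, simp add: algebra_simps)
qed

text \<open>The mixed terms \<open>x\<^sub>i y\<^sub>i\<close> of \<open>X\<^sub>i\<^sup>2\<close> and \<open>Y\<^sub>i\<^sup>2\<close> cancel, because a function of \<open>|x|\<^sup>2 + |y|\<^sup>2\<close> is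
  invariant under the rotation that they generate.\<close>

lemma sub_laplacian_gaussian:
  fixes g :: "'n::finite heis"
  assumes "\<And>t. (\<psi> has_real_derivative \<psi>' t) (at t)" "\<And>t. (\<psi>' has_real_derivative \<psi>'' t) (at t)"
  shows "sub_laplacian (\<lambda>g. \<psi> (vert g) * exp (- m * horiz g)) g
    = exp (- m * horiz g) * (\<psi> (vert g) * (4 * m\<^sup>2 * horiz g - 4 * real CARD('n) * m) + 4 * horiz g * \<psi>'' (vert g))"
proof (cases g)
  case (fields x y t)
  let ?f = "\<lambda>g::'n heis. \<psi> (vert g) * exp (- m * horiz g)"
  let ?E = "exp (- m * (x \<bullet> x + y \<bullet> y))"
  have ip: "(x + s *\<^sub>R axis i 1) \<bullet> (x + s *\<^sub>R axis i 1) = x \<bullet> x + 2 * s * (x $ i) + s\<^sup>2"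
    "(x + s *\<^sub>R axis i 1) $ i = x $ i + s" for x :: "real^'n" and s i
    by (simp add: inner_add_left inner_add_right inner_axis inner_axis' algebra_simps power2_eq_square, simp add: axis_def)
  have d: "(\<psi> has_real_derivative \<psi>' t * s) F" "(\<psi>' has_real_derivative \<psi>'' t * s) F"
    if "F = at t" "s = 1" for F s using assms that by auto
  have X: "heis_field (Inl i) (heis_field (Inl i) ?f) (x, y, t)
      = ((4 * m\<^sup>2 * (x $ i)\<^sup>2 - 2 * m) * \<psi> t - 8 * m * (x $ i) * (y $ i) * \<psi>' t + 4 * (y $ i)\<^sup>2 * \<psi>'' t) * ?E" for i
  proof -
    have "deriv (\<lambda>s. (2 * (y $ i) * \<psi>' t - 2 * m * (x $ i + s) * \<psi> t) * exp (- m * (x \<bullet> x + 2 * s * (x $ i) + s\<^sup>2 + y \<bullet> y))) 0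
        = (- 2 * m * \<psi> t - 2 * m * (x $ i) * (2 * (y $ i) * \<psi>' t - 2 * m * (x $ i) * \<psi> t)) * ?E"
      by (rule DERIV_imp_deriv) (auto intro!: derivative_eq_intros simp: algebra_simps)
    moreover have "deriv (\<lambda>s. (2 * (y $ i) * \<psi>' s - 2 * m * (x $ i) * \<psi> s) * ?E) t
        = (2 * (y $ i) * \<psi>'' t - 2 * m * (x $ i) * \<psi>' t) * ?E"
      by (rule DERIV_imp_deriv) (auto intro!: derivative_eq_intros assms)
    ultimately show ?thesis
      by (simp only: heis_field_gaussian[OF assms(1)] heis_field.simps prod.case ip)
         (simp add: algebra_simps power2_eq_square)
  qed
  have Y: "heis_field (Inr i) (heis_field (Inr i) ?f) (x, y, t)
      = ((4 * m\<^sup>2 * (y $ i)\<^sup>2 - 2 * m) * \<psi> t + 8 * m * (x $ i) * (y $ i) * \<psi>' t + 4 * (x $ i)\<^sup>2 * \<psi>'' t) * ?E" for i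
  proof -
    have "deriv (\<lambda>s. (- 2 * (x $ i) * \<psi>' t - 2 * m * (y $ i + s) * \<psi> t) * exp (- m * (x \<bullet> x + (y \<bullet> y + 2 * s * (y $ i) + s\<^sup>2)))) 0
        = (- 2 * m * \<psi> t - 2 * m * (y $ i) * (- 2 * (x $ i) * \<psi>' t - 2 * m * (y $ i) * \<psi> t)) * ?E"
      by (rule DERIV_imp_deriv) (auto intro!: derivative_eq_intros simp: algebra_simps)
    moreover have "deriv (\<lambda>s. (- 2 * (x $ i) * \<psi>' s - 2 * m * (y $ i) * \<psi> s) * ?E) t
        = (- 2 * (x $ i) * \<psi>'' t - 2 * m * (y $ i) * \<psi>' t) * ?E"
      by (rule DERIV_imp_deriv) (auto intro!: derivative_eq_intros assms)
    ultimately show ?thesis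
      by (simp only: heis_field_gaussian[OF assms(1)] heis_field.simps prod.case ip)
         (simp add: algebra_simps power2_eq_square)
  qed
  have nx: "x \<bullet> x = (\<Sum>i\<in>UNIV. (x $ i)\<^sup>2)" for x :: "real^'n"
    by (simp add: inner_vec_def power2_eq_square)
  have "sub_laplacian ?f (x, y, t) = (\<Sum>i\<in>UNIV. heis_field (Inl i) (heis_field (Inl i) ?f) (x, y, t)
      + heis_field (Inr i) (heis_field (Inr i) ?f) (x, y, t))"
    unfolding sub_laplacian_def UNIV_Plus_UNIV[symmetric]
    by (simp only: sum.Plus finite sum.distrib comp_def)
  also have "\<dots> = (\<Sum>i\<in>UNIV. (x $ i)\<^sup>2 * ((4 * m\<^sup>2 * \<psi> t + 4 * \<psi>'' t) * ?E) + (y $ i)\<^sup>2 * ((4 * m\<^sup>2 * \<psi> t + 4 * \<psi>'' t) * ?E)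
      - 4 * m * \<psi> t * ?E)"
    unfolding X Y by (rule sum.cong) (simp_all add: algebra_simps)
  also have "\<dots> = (x \<bullet> x) * ((4 * m\<^sup>2 * \<psi> t + 4 * \<psi>'' t) * ?E) + (y \<bullet> y) * ((4 * m\<^sup>2 * \<psi> t + 4 * \<psi>'' t) * ?E)
      - real CARD('n) * (4 * m * \<psi> t * ?E)"
    by (simp only: sum.distrib sum_subtractf sum_constant nx sum_distrib_right)
  finally show ?thesis by (simp add: fields algebra_simps)
qed

lemma smooth_horiz: "smooth (horiz :: 'n::finite heis \<Rightarrow> real)"
proof -
  have 1: "smooth (\<lambda>g::'n heis. fst g \<bullet> b)" and 2: "smooth (\<lambda>g::'n heis. fst (snd g) \<bullet> b)" for b
    by (intro smooth_bounded_linear bounded_linear_compose[OF bounded_linear_inner_left] bounded_linear_fst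
        bounded_linear_compose[OF bounded_linear_fst] bounded_linear_snd)+
  show ?thesis unfolding horiz_def[abs_def] by (intro smooth_add smooth_inner 1 2)
qed

lemma smooth_vert: "smooth vert"
  unfolding vert_def[abs_def]
  by (intro smooth_bounded_linear bounded_linear_compose[OF bounded_linear_snd] bounded_linear_snd)

lemma second_order_taylor_bound:
  fixes g :: "real \<Rightarrow> real"
  assumes "0 < k"
    and "\<And>x. s \<le> x \<Longrightarrow> x \<le> s + k \<Longrightarrow> (g has_real_derivative g' x) (at x)"
    and "\<And>x. s \<le> x \<Longrightarrow> x \<le> s + k \<Longrightarrow> (g' has_real_derivative g'' x) (at x)"
    and "\<And>x. s \<le> x \<Longrightarrow> x \<le> s + k \<Longrightarrow> \<bar>g'' x\<bar> \<le> B"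
  shows "\<bar>g (s + k) - g s - k * g' s\<bar> \<le> k\<^sup>2 * B"
proof -
  obtain z where z: "s < z" "z < s + k" "g (s + k) - g s = (s + k - s) * g' z"
    using MVT2[of s "s + k" g g'] assms by auto
  obtain w where w: "s < w" "w < z" "g' z - g' s = (z - s) * g'' w"
    using MVT2[of s z g' g''] assms z by auto
  have "0 \<le> B" using assms(4)[of s] assms(1) by simp
  have "g (s + k) - g s - k * g' s = k * (g' z - g' s)" using z(3) by (simp add: algebra_simps)
  also have "\<dots> = k * ((z - s) * g'' w)" using w(3) by simp
  also have "\<bar>\<dots>\<bar> = k * ((z - s) * \<bar>g'' w\<bar>)" using assms(1) z by (simp add: abs_mult)
  also have "\<dots> \<le> k * (k * B)"
    using assms(1,4) z w \<open>0 \<le> B\<close> by (intro mult_left_mono mult_mono) auto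
  finally show ?thesis by (simp add: power2_eq_square)
qed

text \<open>The logarithmic derivative of \<open>mehler_v\<close> in time; the primed version is its derivative.\<close>

definition mehler_rate :: "nat \<Rightarrow> real \<Rightarrow> real \<Rightarrow> real \<Rightarrow> real \<Rightarrow> real" where
  "mehler_rate n \<omega> \<mu> r s = - 4 * real n * mehler_m \<omega> \<mu> s - (4 * \<omega>\<^sup>2 - 4 * (mehler_m \<omega> \<mu> s)\<^sup>2) * r"

definition mehler_rate' :: "nat \<Rightarrow> real \<Rightarrow> real \<Rightarrow> real \<Rightarrow> real \<Rightarrow> real" where
  "mehler_rate' n \<omega> \<mu> r s = (4 * \<omega>\<^sup>2 - 4 * (mehler_m \<omega> \<mu> s)\<^sup>2) * (8 * mehler_m \<omega> \<mu> s * r - 4 * real n)"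

lemma mehler_v_deriv:
  assumes "\<omega> > 0" "\<mu> > 0" "0 \<le> s"
  shows "(mehler_v n \<omega> \<mu> r has_real_derivative mehler_v n \<omega> \<mu> r s * mehler_rate n \<omega> \<mu> r s) (at s)"
proof -
  have w: "mehler_w \<omega> \<mu> s > 0" using mehler_w_ge_1[OF assms] by simp
  let ?E = "\<lambda>s. exp (- mehler_m \<omega> \<mu> s * r)" and ?m = "mehler_m \<omega> \<mu> s" and ?w = "mehler_w \<omega> \<mu> s"
  have E: "(?E has_real_derivative ?E s * (- (4 * \<omega>\<^sup>2 - 4 * ?m\<^sup>2) * r)) (at s)"
    by (auto intro!: derivative_eq_intros mehler_m_deriv assms) (simp add: algebra_simps)
  have W: "((\<lambda>s. mehler_w \<omega> \<mu> s ^ n) has_real_derivative real n * (4 * ?m * ?w) * ?w ^ (n - 1)) (at s)"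
    by (auto intro!: derivative_eq_intros mehler_w_deriv assms)
  have "(mehler_v n \<omega> \<mu> r has_real_derivative
      (?E s * (- (4 * \<omega>\<^sup>2 - 4 * ?m\<^sup>2) * r) * ?w ^ n - ?E s * (real n * (4 * ?m * ?w) * ?w ^ (n - 1)))
        / (?w ^ n * ?w ^ n)) (at s)"
    unfolding mehler_v_def[abs_def] by (rule DERIV_divide[OF E W]) (use w in simp)
  also have "real n * (4 * ?m * ?w) * ?w ^ (n - 1) = 4 * real n * ?m * ?w ^ n" by (cases n) simp_all
  also have "(?E s * (- (4 * \<omega>\<^sup>2 - 4 * ?m\<^sup>2) * r) * ?w ^ n - ?E s * (4 * real n * ?m * ?w ^ n)) / (?w ^ n * ?w ^ n)
      = mehler_v n \<omega> \<mu> r s * mehler_rate n \<omega> \<mu> r s"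
  proof -
    have "(e * q * W - e * (p * W)) / (W * W) = e / W * (- p + q)" if "W \<noteq> 0" for e q p W :: real
      using that by (simp add: field_simps)
    then show ?thesis using w by (simp add: mehler_v_def mehler_rate_def) (simp add: algebra_simps)
  qed
  finally show ?thesis .
qed

lemma mehler_v_deriv2:
  assumes "\<omega> > 0" "\<mu> > 0" "0 \<le> s"
  shows "((\<lambda>s. mehler_v n \<omega> \<mu> r s * mehler_rate n \<omega> \<mu> r s) has_real_derivative
    mehler_v n \<omega> \<mu> r s * ((mehler_rate n \<omega> \<mu> r s)\<^sup>2 + mehler_rate' n \<omega> \<mu> r s)) (at s)"
proof -
  have "((\<lambda>s. mehler_rate n \<omega> \<mu> r s) has_real_derivative mehler_rate' n \<omega> \<mu> r s) (at s)"
    unfolding mehler_rate_def mehler_rate'_def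
    by (auto intro!: derivative_eq_intros mehler_m_deriv assms simp: algebra_simps)
  from DERIV_mult[OF mehler_v_deriv[OF assms] this] show ?thesis
    by (simp add: algebra_simps power2_eq_square)
qed

text \<open>Half of the exponential rate pays for the polynomial.\<close>

lemma polynomial_times_exp_bound:
  assumes "c > 0" "0 \<le> (r::real)"
  shows "(1 + r)\<^sup>2 * exp (- c * r) \<le> (1 + 4 / c)\<^sup>2 * exp (- (c / 2) * r)"
proof -
  have "1 + r \<le> (1 + 4 / c) * (1 + c / 4 * r)" using assms by (simp add: field_simps)
  also have "\<dots> \<le> (1 + 4 / c) * exp (c / 4 * r)"
    using assms by (intro mult_left_mono) (auto simp: exp_ge_add_one_self)
  finally have "(1 + r)\<^sup>2 \<le> ((1 + 4 / c) * exp (c / 4 * r))\<^sup>2" using assms by (intro power_mono) auto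
  also have "\<dots> = (1 + 4 / c)\<^sup>2 * exp (c / 2 * r)"
    by (simp add: power_mult_distrib exp_double[symmetric])
  finally have "(1 + r)\<^sup>2 * exp (- c * r) \<le> (1 + 4 / c)\<^sup>2 * exp (c / 2 * r) * exp (- c * r)"
    by (intro mult_right_mono) auto
  also have "\<dots> = (1 + 4 / c)\<^sup>2 * exp (- (c / 2) * r)"
    by (simp add: mult.assoc exp_add[symmetric] field_simps)
  finally show ?thesis .
qed

lemma mehler_v_le:
  assumes "\<omega> > 0" "\<mu> > 0" "0 \<le> s" "s \<le> h" "0 \<le> r"
  shows "0 < mehler_v n \<omega> \<mu> r s" "mehler_v n \<omega> \<mu> r s \<le> exp (- (\<mu> / (1 + 4 * h * \<mu>)) * r)"
proof -
  have w: "mehler_w \<omega> \<mu> s \<ge> 1" using mehler_w_ge_1[OF assms(1-3)] .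
  show "0 < mehler_v n \<omega> \<mu> r s" using w by (simp add: mehler_v_def)
  have "mehler_v n \<omega> \<mu> r s \<le> exp (- mehler_m \<omega> \<mu> s * r) / 1"
    unfolding mehler_v_def using w by (intro divide_left_mono one_le_power) auto
  also have "\<dots> \<le> exp (- (\<mu> / (1 + 4 * h * \<mu>)) * r)"
    using mult_right_mono[OF mehler_m_bounds(1)[OF assms(1-4)] assms(5)] by simp
  finally show "mehler_v n \<omega> \<mu> r s \<le> exp (- (\<mu> / (1 + 4 * h * \<mu>)) * r)" .
qed

lemma mehler_v_bounds:
  assumes "\<omega> > 0" "\<mu> > 0" "h > 0"
  obtains D where "D > 0" "\<And>r s. 0 \<le> s \<Longrightarrow> s \<le> h \<Longrightarrow> 0 \<le> r \<Longrightarrow>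
      \<bar>mehler_v n \<omega> \<mu> r s\<bar> \<le> D * exp (- (\<mu> / (1 + 4 * h * \<mu>) / 2) * r) \<and>
      \<bar>mehler_v n \<omega> \<mu> r s * mehler_rate n \<omega> \<mu> r s\<bar> \<le> D * exp (- (\<mu> / (1 + 4 * h * \<mu>) / 2) * r) \<and>
      \<bar>mehler_v n \<omega> \<mu> r s * ((mehler_rate n \<omega> \<mu> r s)\<^sup>2 + mehler_rate' n \<omega> \<mu> r s)\<bar>
        \<le> D * exp (- (\<mu> / (1 + 4 * h * \<mu>) / 2) * r)"
proof -
  define c where "c = \<mu> / (1 + 4 * h * \<mu>)"
  define C where "C = \<omega> + \<mu>"
  define Q where "Q = 4 * \<omega>\<^sup>2 + 4 * C\<^sup>2"
  define A where "A = 4 * real n * C + Q"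
  define A' where "A' = 1 + A + A\<^sup>2 + Q * (8 * C + 4 * real n)"
  have c: "c > 0" using assms by (simp add: c_def add_pos_pos)
  have C: "C > 0" using assms by (simp add: C_def)
  have Q: "Q > 0" using C by (simp add: Q_def add_nonneg_pos)
  have A: "A \<ge> 0" using C Q by (simp add: A_def)
  have A': "A' > 0" "1 \<le> A'" "A \<le> A'" "A\<^sup>2 + Q * (8 * C + 4 * real n) \<le> A'"
    using A Q C by (auto simp: A'_def add_nonneg_pos)
  have main: "\<bar>mehler_v n \<omega> \<mu> r s * B\<bar> \<le> A' * (1 + 4 / c)\<^sup>2 * exp (- (c / 2) * r)"
    if "0 \<le> s" "s \<le> h" "0 \<le> r" "\<bar>B\<bar> \<le> A' * (1 + r)\<^sup>2" for r s B
  proof -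
    note v = mehler_v_le[OF assms(1,2) that(1-3), of n, folded c_def]
    have "\<bar>mehler_v n \<omega> \<mu> r s * B\<bar> = mehler_v n \<omega> \<mu> r s * \<bar>B\<bar>" using v by (simp add: abs_mult)
    also have "\<dots> \<le> exp (- c * r) * (A' * (1 + r)\<^sup>2)" using v that by (intro mult_mono) auto
    also have "\<dots> = A' * ((1 + r)\<^sup>2 * exp (- c * r))" by simp
    also have "\<dots> \<le> A' * ((1 + 4 / c)\<^sup>2 * exp (- (c / 2) * r))"
      using A' by (intro mult_left_mono polynomial_times_exp_bound[OF c that(3)]) auto
    finally show ?thesis by simp
  qed
  have ineq: "\<bar>1\<bar> \<le> A' * (1 + r)\<^sup>2" "\<bar>mehler_rate n \<omega> \<mu> r s\<bar> \<le> A' * (1 + r)\<^sup>2"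
    "\<bar>(mehler_rate n \<omega> \<mu> r s)\<^sup>2 + mehler_rate' n \<omega> \<mu> r s\<bar> \<le> A' * (1 + r)\<^sup>2"
    if s: "0 \<le> s" "s \<le> h" and r: "0 \<le> r" for r s
  proof -
    let ?m = "mehler_m \<omega> \<mu> s"
    have m: "0 \<le> ?m" "?m \<le> C"
      using mehler_m_bounds[OF assms(1,2) s] c by (auto simp: C_def c_def)
    have m2: "?m\<^sup>2 \<le> C\<^sup>2" using m by (intro power_mono) auto
    have q: "\<bar>4 * \<omega>\<^sup>2 - 4 * ?m\<^sup>2\<bar> \<le> Q" using m2 zero_le_power2[of \<omega>] zero_le_power2[of ?m] unfolding Q_def abs_le_iff by linarith
    have r1: "1 \<le> (1 + r)\<^sup>2" "1 + r \<le> (1 + r)\<^sup>2" using r by (simp_all add: power2_eq_square algebra_simps)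
    show "\<bar>1\<bar> \<le> A' * (1 + r)\<^sup>2" using mult_mono[OF A'(2) r1(1)] A' by simp
    have "\<bar>mehler_rate n \<omega> \<mu> r s\<bar> \<le> \<bar>4 * real n * ?m\<bar> + \<bar>(4 * \<omega>\<^sup>2 - 4 * ?m\<^sup>2) * r\<bar>"
      unfolding mehler_rate_def by linarith
    also have "\<dots> \<le> 4 * real n * C + Q * r"
      using m q r by (intro add_mono) (auto simp: abs_mult intro!: mult_mono)
    also have "\<dots> \<le> A * (1 + r)"
      using C Q r by (simp add: A_def algebra_simps)
    finally have rate: "\<bar>mehler_rate n \<omega> \<mu> r s\<bar> \<le> A * (1 + r)" .
    also have "\<dots> \<le> A' * (1 + r)\<^sup>2" using A A' r1 r by (intro mult_mono) auto
    finally show "\<bar>mehler_rate n \<omega> \<mu> r s\<bar> \<le> A' * (1 + r)\<^sup>2" .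
    have sq: "(mehler_rate n \<omega> \<mu> r s)\<^sup>2 \<le> A\<^sup>2 * (1 + r)\<^sup>2"
      using power_mono[OF rate abs_ge_zero, of 2] by (simp add: power_mult_distrib)
    have "\<bar>8 * ?m * r - 4 * real n\<bar> \<le> 8 * C * r + 4 * real n"
      using mult_right_mono[OF m(2) r] mult_nonneg_nonneg[OF m(1) r] of_nat_0_le_iff[of n, where 'a=real]
      unfolding abs_le_iff mult.assoc by linarith
    also have "\<dots> \<le> (8 * C + 4 * real n) * (1 + r)" using C r by (simp add: algebra_simps)
    also have "\<dots> \<le> (8 * C + 4 * real n) * (1 + r)\<^sup>2" using C r1 by (intro mult_left_mono) auto
    finally have "\<bar>mehler_rate' n \<omega> \<mu> r s\<bar> \<le> Q * ((8 * C + 4 * real n) * (1 + r)\<^sup>2)"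
      unfolding mehler_rate'_def abs_mult using q Q by (intro mult_mono) auto
    then have "\<bar>(mehler_rate n \<omega> \<mu> r s)\<^sup>2 + mehler_rate' n \<omega> \<mu> r s\<bar>
        \<le> A\<^sup>2 * (1 + r)\<^sup>2 + Q * ((8 * C + 4 * real n) * (1 + r)\<^sup>2)"
      using sq by (intro order_trans[OF abs_triangle_ineq] add_mono) auto
    also have "\<dots> = (A\<^sup>2 + Q * (8 * C + 4 * real n)) * (1 + r)\<^sup>2"
      by (simp add: algebra_simps)
    also have "\<dots> \<le> A' * (1 + r)\<^sup>2" using A' by (intro mult_right_mono) auto
    finally show "\<bar>(mehler_rate n \<omega> \<mu> r s)\<^sup>2 + mehler_rate' n \<omega> \<mu> r s\<bar> \<le> A' * (1 + r)\<^sup>2" .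
  qed
  show ?thesis
  proof
    show "A' * (1 + 4 / c)\<^sup>2 > 0"
      using A'(1) c by (intro mult_pos_pos zero_less_power add_pos_pos divide_pos_pos) auto
  qed (use main[OF _ _ _ ineq(1)] main[OF _ _ _ ineq(2)] main[OF _ _ _ ineq(3)] in \<open>auto simp: c_def\<close>)
qed

text \<open>A plane wave \<open>cos \<omega>t\<close> is not square integrable, so it is cut off by a wide Gaussian.  The wave
  satisfies \<open>\<psi>'' = - \<omega>\<^sup>2 \<psi>\<close> up to \<open>cutoff_error\<close>.\<close>

definition cutoff_wave :: "real \<Rightarrow> real \<Rightarrow> real \<Rightarrow> real" where
  "cutoff_wave e \<omega> t = exp (- e * t\<^sup>2) * cos (\<omega> * t)"

definition cutoff_wave' :: "real \<Rightarrow> real \<Rightarrow> real \<Rightarrow> real" where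
  "cutoff_wave' e \<omega> t = exp (- e * t\<^sup>2) * (- 2 * e * t * cos (\<omega> * t) - \<omega> * sin (\<omega> * t))"

definition cutoff_error :: "real \<Rightarrow> real \<Rightarrow> real \<Rightarrow> real" where
  "cutoff_error e \<omega> t = exp (- e * t\<^sup>2) * ((4 * e\<^sup>2 * t\<^sup>2 - 2 * e) * cos (\<omega> * t) + 4 * e * \<omega> * t * sin (\<omega> * t))"

lemma cutoff_wave_deriv:
  "(cutoff_wave e \<omega> has_real_derivative cutoff_wave' e \<omega> t) (at t)"
  "(cutoff_wave' e \<omega> has_real_derivative cutoff_error e \<omega> t - \<omega>\<^sup>2 * cutoff_wave e \<omega> t) (at t)"
  unfolding cutoff_wave_def[abs_def] cutoff_wave'_def[abs_def] cutoff_error_def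
  by (auto intro!: derivative_eq_intros simp: algebra_simps power2_eq_square)

lemma cutoff_wave_bound: "\<bar>cutoff_wave e \<omega> t\<bar> \<le> exp (- e * t\<^sup>2)"
  unfolding cutoff_wave_def abs_mult using mult_left_mono[OF abs_cos_le_one[of "\<omega> * t"], of "exp (- e * t\<^sup>2)"] by simp

text \<open>With \<open>x = \<eta>\<^sup>2 |t|\<close> every term of the error has a factor \<open>\<eta>\<^sup>2\<close>; what is left is at most a
  polynomial in \<open>x\<close> with coefficients of order \<open>1 + \<omega>\<close>, times \<open>exp (- x\<^sup>2)\<close>.\<close>

lemma cutoff_error_bound:
  assumes "0 < \<eta>" "\<eta> \<le> 1" "\<omega> > 0"
  shows "\<bar>cutoff_error (\<eta> ^ 4) \<omega> t\<bar> \<le> 16 * (1 + \<omega>) * \<eta>\<^sup>2 * exp (- (\<eta> ^ 4 * (1 / 2)) * t\<^sup>2)"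
proof -
  define x where "x = \<eta>\<^sup>2 * \<bar>t\<bar>"
  have x0: "0 \<le> x" by (simp add: x_def)
  have x2: "\<eta> ^ 4 * t\<^sup>2 = x\<^sup>2" by (simp add: x_def power_mult_distrib)
  have e2: "\<eta> ^ 4 \<le> \<eta>\<^sup>2" using assms by (intro power_decreasing) auto
  have "\<bar>(4 * (\<eta> ^ 4)\<^sup>2 * t\<^sup>2 - 2 * \<eta> ^ 4) * cos (\<omega> * t)\<bar> \<le> (4 * (\<eta> ^ 4)\<^sup>2 * t\<^sup>2 + 2 * \<eta> ^ 4) * 1"
    unfolding abs_mult by (intro mult_mono abs_cos_le_one) (auto simp: abs_le_iff add_nonneg_nonneg)
  also have "(\<eta> ^ 4)\<^sup>2 * t\<^sup>2 = \<eta> ^ 4 * x\<^sup>2"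
    unfolding x2[symmetric] power2_eq_square[of "\<eta> ^ 4"] by (rule mult.assoc)
  then have "(4 * (\<eta> ^ 4)\<^sup>2 * t\<^sup>2 + 2 * \<eta> ^ 4) * 1 = \<eta> ^ 4 * (4 * x\<^sup>2 + 2)" by (simp add: algebra_simps)
  also have "\<dots> \<le> \<eta>\<^sup>2 * (4 * x\<^sup>2 + 2)" using e2 by (intro mult_right_mono) auto
  finally have 1: "\<bar>(4 * (\<eta> ^ 4)\<^sup>2 * t\<^sup>2 - 2 * \<eta> ^ 4) * cos (\<omega> * t)\<bar> \<le> \<eta>\<^sup>2 * (4 * x\<^sup>2 + 2)" .
  have "\<bar>4 * \<eta> ^ 4 * \<omega> * t * sin (\<omega> * t)\<bar> \<le> (4 * \<eta> ^ 4 * \<omega> * \<bar>t\<bar>) * 1"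
    using assms unfolding abs_mult by (intro mult_mono abs_sin_le_one) auto
  also have "\<dots> = \<eta>\<^sup>2 * (4 * \<omega> * x)" by (simp add: x_def power2_eq_square numeral_eq_Suc)
  finally have 2: "\<bar>4 * \<eta> ^ 4 * \<omega> * t * sin (\<omega> * t)\<bar> \<le> \<eta>\<^sup>2 * (4 * \<omega> * x)" .
  have xx: "2 * x \<le> 1 + x\<^sup>2" using zero_le_power2[of "x - 1"] by (simp add: power2_diff)
  have "0 \<le> \<omega> * x\<^sup>2" "2 * (\<omega> * x) \<le> \<omega> + \<omega> * x\<^sup>2"
    using assms mult_left_mono[OF xx, of \<omega>] by (simp_all add: algebra_simps)
  moreover have "(1 + \<omega>) * (8 * x\<^sup>2 + 16) = 8 * x\<^sup>2 + 16 + 8 * (\<omega> * x\<^sup>2) + 16 * \<omega>"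
    by (simp add: algebra_simps)
  ultimately have "4 * x\<^sup>2 + 2 + 4 * \<omega> * x \<le> (1 + \<omega>) * (8 * x\<^sup>2 + 16)"
    using assms(3) zero_le_power2[of x] mult.assoc[of 4 \<omega> x] by linarith
  also have "\<dots> = 16 * (1 + \<omega>) * (1 + x\<^sup>2 / 2)" by (simp add: algebra_simps)
  also have "\<dots> \<le> 16 * (1 + \<omega>) * exp (x\<^sup>2 / 2)" using assms by (intro mult_left_mono exp_ge_add_one_self) auto
  finally have 3: "4 * x\<^sup>2 + 2 + 4 * \<omega> * x \<le> 16 * (1 + \<omega>) * exp (x\<^sup>2 / 2)" .
  have "\<bar>cutoff_error (\<eta> ^ 4) \<omega> t\<bar> = exp (- x\<^sup>2)
      * \<bar>(4 * (\<eta> ^ 4)\<^sup>2 * t\<^sup>2 - 2 * \<eta> ^ 4) * cos (\<omega> * t) + 4 * \<eta> ^ 4 * \<omega> * t * sin (\<omega> * t)\<bar>"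
    by (simp add: cutoff_error_def abs_mult x2)
  also have "\<dots> \<le> exp (- x\<^sup>2) * (\<eta>\<^sup>2 * (4 * x\<^sup>2 + 2) + \<eta>\<^sup>2 * (4 * \<omega> * x))"
    by (intro mult_left_mono order_trans[OF abs_triangle_ineq] add_mono 1 2) auto
  also have "\<dots> = \<eta>\<^sup>2 * exp (- x\<^sup>2) * (4 * x\<^sup>2 + 2 + 4 * \<omega> * x)" by (simp add: algebra_simps)
  also have "\<dots> \<le> \<eta>\<^sup>2 * exp (- x\<^sup>2) * (16 * (1 + \<omega>) * exp (x\<^sup>2 / 2))"
    by (intro mult_left_mono 3) auto
  also have "\<dots> = 16 * (1 + \<omega>) * \<eta>\<^sup>2 * exp (- x\<^sup>2 + x\<^sup>2 / 2)" unfolding exp_add by (simp add: mult_ac)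
  also have "- x\<^sup>2 + x\<^sup>2 / 2 = - (\<eta> ^ 4 * (1 / 2)) * t\<^sup>2" using x2 by simp
  finally show ?thesis .
qed

lemma gauss_weight_eq: "gauss_weight c e g = exp (- c * horiz g) * exp (- e * (vert g)\<^sup>2)"
  by (simp add: gauss_weight_def exp_add[symmetric])

text \<open>The gain \<open>\<eta>\<^sup>2\<close> of \<open>cutoff_error_bound\<close> beats the loss \<open>1/\<eta>\<close> of \<open>gauss_weight_norm_scaling\<close>.
  The constant does not depend on \<open>\<omega>\<close>, so that the estimate can be integrated over the frequency.\<close>

lemma duhamel_single_frequency:
  fixes f :: "'n::finite heis \<Rightarrow> real"
  assumes T: "heat_semigroup T" and f: "f \<in> test_functions" and h: "0 < h" and \<mu>: "0 < \<mu>"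
  obtains K where "0 \<le> K" "\<And>\<omega> \<eta>. \<omega> > 0 \<Longrightarrow> 0 < \<eta> \<Longrightarrow> \<eta> \<le> 1 \<Longrightarrow>
    \<bar>(LINT g|lborel. T h f g * (cutoff_wave (\<eta> ^ 4) \<omega> (vert g) * exp (- \<mu> * horiz g)))
      - (LINT g|lborel. f g * (cutoff_wave (\<eta> ^ 4) \<omega> (vert g) * mehler_v CARD('n) \<omega> \<mu> (horiz g) h))\<bar>
    \<le> K * (1 + \<omega>) * \<eta>"
proof -
  define c where "c = \<mu> / (1 + 4 * h * \<mu>)"
  define N where "N = L2_norm (gauss_weight (c / 2) (1 / 2) :: 'n heis \<Rightarrow> real)"
  define K where "K = h * (L2_norm f * (128 / c * N))"
  let ?n = "CARD('n)"
  have c: "c > 0" using \<mu> h by (simp add: c_def add_pos_pos)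
  have bound: "\<bar>(LINT g|lborel. T h f g * (cutoff_wave (\<eta> ^ 4) \<omega> (vert g) * exp (- \<mu> * horiz g)))
      - (LINT g|lborel. f g * (cutoff_wave (\<eta> ^ 4) \<omega> (vert g) * mehler_v ?n \<omega> \<mu> (horiz g) h))\<bar>
    \<le> K * (1 + \<omega>) * \<eta>" if \<omega>: "\<omega> > 0" and \<eta>: "0 < \<eta>" "\<eta> \<le> 1" for \<omega> \<eta>
  proof -
    let ?e = "\<eta> ^ 4"
    obtain D where D: "D > 0" and Db: "\<And>r s. 0 \<le> s \<Longrightarrow> s \<le> h \<Longrightarrow> 0 \<le> r \<Longrightarrow>
      \<bar>mehler_v ?n \<omega> \<mu> r s\<bar> \<le> D * exp (- (c / 2) * r) \<and>
      \<bar>mehler_v ?n \<omega> \<mu> r s * mehler_rate ?n \<omega> \<mu> r s\<bar> \<le> D * exp (- (c / 2) * r) \<and>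
      \<bar>mehler_v ?n \<omega> \<mu> r s * ((mehler_rate ?n \<omega> \<mu> r s)\<^sup>2 + mehler_rate' ?n \<omega> \<mu> r s)\<bar> \<le> D * exp (- (c / 2) * r)"
      using mehler_v_bounds[OF \<omega> \<mu> h, of ?n] unfolding c_def by metis
    define W where "W g = D * gauss_weight (c / 2) ?e g" for g :: "'n heis"
    have W: "W \<in> L2" using c \<eta> unfolding W_def[abs_def] by (intro L2_scale gauss_weight_L2) auto
    have W_eq: "W g = exp (- ?e * (vert g)\<^sup>2) * (D * exp (- (c / 2) * horiz g))" for g
      by (simp add: W_def gauss_weight_eq)
    have W_le: "\<bar>cutoff_wave ?e \<omega> (vert g) * b\<bar> \<le> W g" if "\<bar>b\<bar> \<le> D * exp (- (c / 2) * horiz g)" for g b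
      unfolding abs_mult W_eq using that by (intro mult_mono cutoff_wave_bound) auto
    define U where "U s g = cutoff_wave ?e \<omega> (vert g) * mehler_v ?n \<omega> \<mu> (horiz g) s" for s and g :: "'n heis"
    define U' where "U' s g = cutoff_wave ?e \<omega> (vert g) * (mehler_v ?n \<omega> \<mu> (horiz g) s * mehler_rate ?n \<omega> \<mu> (horiz g) s)"
      for s and g :: "'n heis"
    have [measurable]: "cutoff_wave ?e \<omega> \<in> borel_measurable borel" "cutoff_error ?e \<omega> \<in> borel_measurable borel"
      unfolding cutoff_wave_def[abs_def] cutoff_error_def[abs_def] by measurable
    have meas: "U s \<in> borel_measurable borel" "U' s \<in> borel_measurable borel" for s
      unfolding U_def[abs_def] U'_def[abs_def] mehler_v_def mehler_rate_def by measurable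
    have U_alt: "U s = (\<lambda>g. (cutoff_wave ?e \<omega> (vert g) * (1 / mehler_w \<omega> \<mu> s ^ ?n)) * exp (- mehler_m \<omega> \<mu> s * horiz g))" for s
      unfolding U_def[abs_def] mehler_v_def by simp
    have smooth: "smooth (U s)" for s
    proof -
      have "smooth (\<lambda>g::'n heis. exp (- ?e * (vert g * vert g)) * cos (\<omega> * vert g) * (1 / mehler_w \<omega> \<mu> s ^ ?n)
          * exp (- mehler_m \<omega> \<mu> s * horiz g))"
        by (intro smooth_mult smooth_exp smooth_cos smooth_const smooth_vert smooth_horiz)
      then show ?thesis by (simp add: U_alt cutoff_wave_def power2_eq_square)
    qed
    have lap: "sub_laplacian (U s) g - U' s g = 4 * horiz g * mehler_v ?n \<omega> \<mu> (horiz g) s * cutoff_error ?e \<omega> (vert g)" for s g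
    proof -
      let ?a = "1 / mehler_w \<omega> \<mu> s ^ ?n"
      have "sub_laplacian (U s) g = exp (- mehler_m \<omega> \<mu> s * horiz g) *
        (cutoff_wave ?e \<omega> (vert g) * ?a * (4 * (mehler_m \<omega> \<mu> s)\<^sup>2 * horiz g - 4 * real ?n * mehler_m \<omega> \<mu> s)
          + 4 * horiz g * ((cutoff_error ?e \<omega> (vert g) - \<omega>\<^sup>2 * cutoff_wave ?e \<omega> (vert g)) * ?a))"
        unfolding U_alt by (rule sub_laplacian_gaussian[where \<psi>'="\<lambda>t. cutoff_wave' ?e \<omega> t * ?a"]) (intro DERIV_cmult_right cutoff_wave_deriv)+
      then show ?thesis unfolding U'_def mehler_v_def mehler_rate_def
        by (simp add: divide_inverse) (simp add: algebra_simps)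
    qed
    let ?E = "\<lambda>g::'n heis. (128 / c * (1 + \<omega>) * \<eta>\<^sup>2) * gauss_weight (c / 2) (?e * (1 / 2)) g"
    have E: "?E \<in> L2" using c \<eta> by (intro L2_scale gauss_weight_L2) auto
    have err: "\<bar>sub_laplacian (U s) g - U' s g\<bar> \<le> ?E g" if s: "0 \<le> s" "s \<le> h" for s g
    proof -
      note v = mehler_v_le[OF \<omega> \<mu> s horiz_nonneg, of ?n g, folded c_def]
      have "(c / 2) * horiz g \<le> exp (c / 2 * horiz g)"
        using exp_ge_add_one_self[of "c / 2 * horiz g"] by linarith
      \<comment> \<open>The factor \<open>horiz g\<close> of the defect costs half of the decay rate \<open>c\<close>.\<close>
      then have "horiz g \<le> 2 / c * exp (c / 2 * horiz g)" using c by (simp add: field_simps)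
      then have "horiz g * mehler_v ?n \<omega> \<mu> (horiz g) s \<le> 2 / c * exp (c / 2 * horiz g) * exp (- c * horiz g)"
        using v c by (intro mult_mono) auto
      also have "\<dots> = 2 / c * exp (- (c / 2) * horiz g)"
        by (simp add: mult.assoc exp_add[symmetric])
      finally have 1: "\<bar>4 * horiz g * mehler_v ?n \<omega> \<mu> (horiz g) s\<bar> \<le> 8 / c * exp (- (c / 2) * horiz g)"
        using v by (simp add: abs_mult)
      have "\<bar>sub_laplacian (U s) g - U' s g\<bar>
          \<le> (8 / c * exp (- (c / 2) * horiz g)) * (16 * (1 + \<omega>) * \<eta>\<^sup>2 * exp (- (?e * (1 / 2)) * (vert g)\<^sup>2))"
        unfolding lap abs_mult[of _ "cutoff_error _ _ _"] using c \<omega>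
        by (intro mult_mono 1 cutoff_error_bound \<eta>) auto
      also have "\<dots> = ?E g"
        by (simp add: gauss_weight_eq)
      finally show ?thesis .
    qed
    have L2: "U s \<in> L2" "U' s \<in> L2" "sub_laplacian (U s) \<in> L2" if s: "0 \<le> s" "s \<le> h" for s
    proof -
      show "U s \<in> L2" by (rule L2_bound[OF W meas(1)]) (use Db[OF s] in \<open>auto simp: U_def intro!: W_le\<close>)
      show U': "U' s \<in> L2" by (rule L2_bound[OF W meas(2)]) (use Db[OF s] in \<open>auto simp: U'_def intro!: W_le\<close>)
      have "(\<lambda>g. sub_laplacian (U s) g - U' s g) \<in> L2"
      proof (rule L2_bound[OF E])
        show "(\<lambda>g. sub_laplacian (U s) g - U' s g) \<in> borel_measurable borel"
          unfolding lap mehler_v_def by measurable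
      qed (use err s in auto)
      from L2_add[OF this U'] show "sub_laplacian (U s) \<in> L2" by simp
    qed
    have "\<bar>(LINT g|lborel. T h f g * U 0 g) - (LINT g|lborel. f g * U h g)\<bar> \<le> h * (L2_norm f * L2_norm ?E)"
    proof (rule duhamel[OF T f h, where M="L2_norm W" and U'=U' and B="L2_norm W"])
      show "smooth (U s) \<and> U s \<in> L2 \<and> sub_laplacian (U s) \<in> L2 \<and> U' s \<in> L2" if "0 \<le> s" "s \<le> h" for s
        using smooth L2[OF that] by auto
      show "L2_norm (U s) \<le> L2_norm W" if s: "0 \<le> s" "s \<le> h" for s
        by (rule L2_norm_mono[OF W meas(1)]) (use Db[OF s] in \<open>auto simp: U_def intro!: W_le\<close>)
      show "L2_norm (\<lambda>g. sub_laplacian (U s) g - U' s g) \<le> L2_norm ?E" if "0 \<le> s" "s \<le> h" for s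
      proof (rule L2_norm_mono[OF E])
        show "(\<lambda>g. sub_laplacian (U s) g - U' s g) \<in> borel_measurable borel"
          unfolding lap mehler_v_def by measurable
      qed (use err that in auto)
      show "L2_norm (\<lambda>g. U (s + k) g - U s g - k * U' s g) \<le> k\<^sup>2 * L2_norm W"
        if s: "0 \<le> s" and k: "0 < k" and sk: "s + k \<le> h" for s k
      proof -
        have "L2_norm (\<lambda>g. U (s + k) g - U s g - k * U' s g) \<le> L2_norm (\<lambda>g. k\<^sup>2 * W g)"
        proof (rule L2_norm_mono[OF L2_scale[OF W]])
          show "(\<lambda>g. U (s + k) g - U s g - k * U' s g) \<in> borel_measurable borel"
            using meas by measurable
          fix g :: "'n heis"
          let ?v = "mehler_v ?n \<omega> \<mu> (horiz g)" and ?v' = "\<lambda>s. mehler_v ?n \<omega> \<mu> (horiz g) s * mehler_rate ?n \<omega> \<mu> (horiz g) s"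
          have "\<bar>?v (s + k) - ?v s - k * ?v' s\<bar> \<le> k\<^sup>2 * (D * exp (- (c / 2) * horiz g))"
            using s sk Db by (intro second_order_taylor_bound[OF k mehler_v_deriv mehler_v_deriv2]) (auto simp: \<omega> \<mu>)
          then have "\<bar>cutoff_wave ?e \<omega> (vert g)\<bar> * \<bar>?v (s + k) - ?v s - k * ?v' s\<bar>
              \<le> exp (- ?e * (vert g)\<^sup>2) * (k\<^sup>2 * (D * exp (- (c / 2) * horiz g)))"
            by (intro mult_mono cutoff_wave_bound) auto
          then show "\<bar>U (s + k) g - U s g - k * U' s g\<bar> \<le> k\<^sup>2 * W g"
            unfolding W_eq U_def U'_def abs_mult[symmetric] by (simp add: algebra_simps)
        qed
        then show ?thesis by (simp add: L2_norm_scale)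
      qed
    qed
    also have "L2_norm ?E = 128 / c * (1 + \<omega>) * \<eta>\<^sup>2 * (N / \<eta>)"
      unfolding L2_norm_scale N_def by (subst gauss_weight_norm_scaling) (use c \<omega> \<eta> in auto)
    also have "h * (L2_norm f * (128 / c * (1 + \<omega>) * \<eta>\<^sup>2 * (N / \<eta>))) = K * (1 + \<omega>) * \<eta>"
      using \<eta> by (simp add: K_def power2_eq_square)
    finally show ?thesis by (simp add: U_def mehler_v_def)
  qed
  have "0 \<le> K" using h c by (simp add: K_def N_def)
  with that bound show ?thesis by blast
qed

section \<open>Superposition of frequencies\<close>

lemma borel_measurable_hyperbolic [measurable (raw)]:
  fixes f :: "'a \<Rightarrow> real"
  assumes "f \<in> borel_measurable M"
  shows "(\<lambda>x. cosh (f x)) \<in> borel_measurable M" "(\<lambda>x. sinh (f x)) \<in> borel_measurable M"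
  using assms unfolding cosh_def sinh_def by measurable

lemma integrable_exp_decay:
  assumes "\<delta> > 0"
  shows "integrable lborel (\<lambda>\<omega>::real. indicator {0<..} \<omega> * exp (- \<delta> * \<omega>))"
proof (rule Bochner_Integration.integrable_bound)
  let ?C = "2 * (1 + 1 / \<delta>\<^sup>2)"
  show "integrable lborel (\<lambda>t::real. ?C * (1 / (1 + t\<^sup>2)))"
    using integrable_inverse_one_plus_square by (rule integrable_mult_right)
  show "AE t in lborel. norm (indicator {0<..} t * exp (- \<delta> * t)) \<le> norm (?C * (1 / (1 + t\<^sup>2)))"
  proof (rule AE_I2)
    fix t :: real
    show "norm (indicator {0<..} t * exp (- \<delta> * t)) \<le> norm (?C * (1 / (1 + t\<^sup>2)))"
    proof (cases "t > 0")
      case True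
      have "1 + t\<^sup>2 \<le> (1 + 1 / \<delta>\<^sup>2) * (1 + (\<delta> * t)\<^sup>2)"
        using assms by (simp add: field_simps power_mult_distrib)
      also have "\<dots> \<le> (1 + 1 / \<delta>\<^sup>2) * (2 * exp (\<delta> * t))"
        using exp_lower_Taylor_quadratic[of "\<delta> * t"] mult_pos_pos[OF assms True] by (intro mult_left_mono) auto
      finally have "(1 + t\<^sup>2) * exp (- \<delta> * t) \<le> ?C" by (simp add: exp_minus field_simps)
      moreover have "1 + t\<^sup>2 > 0" by (simp add: add_pos_nonneg)
      ultimately have "exp (- \<delta> * t) \<le> ?C * (1 / (1 + t\<^sup>2))" by (simp add: pos_le_divide_eq mult.commute)
      then show ?thesis using True by simp
    qed simp
  qed
qed simp

lemma integrable_linear_exp_decay: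
  assumes "\<delta> > 0"
  shows "integrable lborel (\<lambda>\<omega>::real. indicator {0<..} \<omega> * ((1 + \<omega>) * exp (- \<delta> * \<omega>)))"
proof (rule Bochner_Integration.integrable_bound)
  show "integrable lborel (\<lambda>\<omega>::real. (1 + 2 / \<delta>) * (indicator {0<..} \<omega> * exp (- (\<delta> / 2) * \<omega>)))"
    by (intro integrable_mult_right integrable_exp_decay) (use assms in simp)
  show "AE \<omega> in lborel. norm (indicator {0<..} \<omega> * ((1 + \<omega>) * exp (- \<delta> * \<omega>)))
      \<le> norm ((1 + 2 / \<delta>) * (indicator {0<..} \<omega> * exp (- (\<delta> / 2) * \<omega>)))"
  proof (rule AE_I2)
    fix \<omega> :: real
    show "norm (indicator {0<..} \<omega> * ((1 + \<omega>) * exp (- \<delta> * \<omega>)))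
      \<le> norm ((1 + 2 / \<delta>) * (indicator {0<..} \<omega> * exp (- (\<delta> / 2) * \<omega>)))"
    proof (cases "\<omega> > 0")
      case True
      have "1 + \<omega> \<le> (1 + 2 / \<delta>) * (1 + \<delta> / 2 * \<omega>)" using assms True by (simp add: field_simps)
      also have "\<dots> \<le> (1 + 2 / \<delta>) * exp (\<delta> / 2 * \<omega>)" using assms
        by (intro mult_left_mono) (auto simp: exp_ge_add_one_self)
      finally have "(1 + \<omega>) * exp (- \<delta> * \<omega>) \<le> (1 + 2 / \<delta>) * exp (\<delta> / 2 * \<omega>) * exp (- \<delta> * \<omega>)"
        by (intro mult_right_mono) auto
      also have "\<dots> = (1 + 2 / \<delta>) * exp (- (\<delta> / 2) * \<omega>)"
        by (simp add: mult.assoc exp_add[symmetric])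
      finally show ?thesis using True assms by (simp add: abs_mult)
    qed simp
  qed
qed simp

definition poisson :: "real \<Rightarrow> real \<Rightarrow> real" where
  "poisson \<delta> t = \<delta> / (\<delta>\<^sup>2 + t\<^sup>2)"

lemma borel_poisson [measurable]: "poisson \<delta> \<in> borel_measurable borel"
  unfolding poisson_def[abs_def] by measurable

lemma poisson_bounds:
  assumes "\<delta> > 0"
  shows "0 < poisson \<delta> t" "poisson \<delta> t \<le> 1 / \<delta>" "poisson \<delta> t \<le> (\<delta> * (1 + 1 / \<delta>\<^sup>2)) * (1 / (1 + t\<^sup>2))"
proof -
  have pos: "\<delta>\<^sup>2 + t\<^sup>2 > 0" "1 + t\<^sup>2 > 0" using assms by (simp_all add: add_pos_nonneg)
  show "0 < poisson \<delta> t" using pos assms by (simp add: poisson_def)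
  have "\<delta> * \<delta> \<le> \<delta>\<^sup>2 + t\<^sup>2" by (simp add: power2_eq_square)
  then show "poisson \<delta> t \<le> 1 / \<delta>" using pos assms by (simp add: poisson_def divide_le_eq pos_le_divide_eq mult.commute)
  have "1 + t\<^sup>2 \<le> (1 + 1 / \<delta>\<^sup>2) * (\<delta>\<^sup>2 + t\<^sup>2)" using assms by (simp add: field_simps)
  then have "1 / (\<delta>\<^sup>2 + t\<^sup>2) \<le> (1 + 1 / \<delta>\<^sup>2) * (1 / (1 + t\<^sup>2))"
    using pos by (simp add: field_simps)
  from mult_left_mono[OF this, of \<delta>] show "poisson \<delta> t \<le> (\<delta> * (1 + 1 / \<delta>\<^sup>2)) * (1 / (1 + t\<^sup>2))"
    using assms by (simp add: poisson_def)
qed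

lemma integrable_poisson: assumes "\<delta> > 0" shows "integrable lborel (poisson \<delta>)"
proof (rule Bochner_Integration.integrable_bound)
  show "integrable lborel (\<lambda>t::real. (\<delta> * (1 + 1 / \<delta>\<^sup>2)) * (1 / (1 + t\<^sup>2)))"
    using integrable_inverse_one_plus_square by (rule integrable_mult_right)
qed (use poisson_bounds[OF assms] assms in \<open>auto intro!: AE_I2 simp: less_imp_le abs_mult add_nonneg_nonneg\<close>)

lemma integral_poisson:
  assumes "\<delta> > 0" shows "(LINT t|lborel. poisson \<delta> t) = (LINT t|lborel. 1 / (1 + (t::real)\<^sup>2))"
proof -
  have "(LINT t|lborel. poisson \<delta> t) = \<bar>\<delta>\<bar> *\<^sub>R (LINT t|lborel. poisson \<delta> (0 + \<delta> * t))"
    using assms by (intro lborel_integral_real_affine) simp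
  also have "(\<lambda>t. poisson \<delta> (0 + \<delta> * t)) = (\<lambda>t. 1 / \<delta> * (1 / (1 + t\<^sup>2)))"
  proof
    fix t :: real
    have "\<delta>\<^sup>2 + (\<delta> * t)\<^sup>2 = \<delta> * (\<delta> * (1 + t\<^sup>2))" by (simp add: power2_eq_square algebra_simps)
    then show "poisson \<delta> (0 + \<delta> * t) = 1 / \<delta> * (1 / (1 + t\<^sup>2))" using assms by (simp add: poisson_def)
  qed
  also have "\<bar>\<delta>\<bar> *\<^sub>R (LINT t|lborel. 1 / \<delta> * (1 / (1 + t\<^sup>2))) = (LINT t|lborel. 1 / (1 + t\<^sup>2))"
    unfolding integral_mult_right_zero using assms by simp
  finally show ?thesis .
qed

text \<open>Superposing cosines with an exponential weight gives an explicit positive kernel.\<close>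

lemma poisson_cosine_transform:
  assumes "\<delta> > 0"
  shows "(LINT \<omega>|lborel. indicator {0<..} \<omega> * (exp (- \<delta> * \<omega>) * cos (\<omega> * t))) = poisson \<delta> t"
proof -
  let ?f = "\<lambda>\<omega>. exp (- \<delta> * \<omega>) * cos (\<omega> * t)"
  let ?F = "\<lambda>\<omega>. exp (- \<delta> * \<omega>) * (t * sin (\<omega> * t) - \<delta> * cos (\<omega> * t)) / (\<delta>\<^sup>2 + t\<^sup>2)"
  have pos: "\<delta>\<^sup>2 + t\<^sup>2 > 0" using assms by (simp add: add_pos_nonneg)
  have "(LBINT \<omega>=ereal 0..\<infinity>. ?f \<omega>) = 0 - (- \<delta> / (\<delta>\<^sup>2 + t\<^sup>2))"
  proof (rule interval_integral_FTC_integrable[where F="?F"])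
    show "(?F has_vector_derivative ?f x) (at x)" for x
    proof -
      have "(?F has_real_derivative (exp (- \<delta> * x) * (t\<^sup>2 * cos (x * t) + \<delta> * t * sin (x * t))
          - \<delta> * exp (- \<delta> * x) * (t * sin (x * t) - \<delta> * cos (x * t))) / (\<delta>\<^sup>2 + t\<^sup>2)) (at x)"
        by (auto intro!: derivative_eq_intros simp: power2_eq_square) (use assms in \<open>simp_all add: algebra_simps\<close>)
      moreover have "exp (- \<delta> * x) * (t\<^sup>2 * cos (x * t) + \<delta> * t * sin (x * t))
          - \<delta> * exp (- \<delta> * x) * (t * sin (x * t) - \<delta> * cos (x * t)) = ?f x * (\<delta>\<^sup>2 + t\<^sup>2)"
        by (simp add: power2_eq_square algebra_simps)
      ultimately show ?thesis using pos assms by (simp add: has_real_derivative_iff_has_vector_derivative)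
    qed
    show "isCont ?f x" for x by (intro continuous_intros)
    show "set_integrable lborel (einterval (ereal 0) \<infinity>) ?f"
      unfolding set_integrable_def einterval_eq
    proof (rule Bochner_Integration.integrable_bound[OF integrable_exp_decay[OF assms]])
      show "AE x in lborel. norm (indicator {0<..} x *\<^sub>R ?f x) \<le> norm (indicator {0<..} x * exp (- \<delta> * x))"
      proof (rule AE_I2)
        fix x :: real
        have "exp (- \<delta> * x) * \<bar>cos (x * t)\<bar> \<le> exp (- \<delta> * x) * 1" by (intro mult_left_mono abs_cos_le_one) auto
        then show "norm (indicator {0<..} x *\<^sub>R ?f x) \<le> norm (indicator {0<..} x * exp (- \<delta> * x))"
          by (simp add: abs_mult indicator_def)
      qed
    qed simp
    have "isCont ?F 0" by (intro continuous_intros) (use pos in auto)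
    then have "(?F \<longlongrightarrow> ?F 0) (at_right 0)"
      by (simp add: continuous_at filterlim_at_split)
    then show "((?F \<circ> real_of_ereal) \<longlongrightarrow> - \<delta> / (\<delta>\<^sup>2 + t\<^sup>2)) (at_right (ereal 0))"
      by (simp add: ereal_tendsto_simps)
    have "((\<lambda>x. (\<bar>t\<bar> + \<delta>) * exp (- \<delta> * x) / (\<delta>\<^sup>2 + t\<^sup>2)) \<longlongrightarrow> 0) at_top"
      using assms by real_asymp
    then have "(?F \<longlongrightarrow> 0) at_top"
    proof (rule Lim_null_comparison[rotated], intro always_eventually allI)
      fix x
      have "\<bar>t * sin (x * t) - \<delta> * cos (x * t)\<bar> \<le> \<bar>t\<bar> * \<bar>sin (x * t)\<bar> + \<delta> * \<bar>cos (x * t)\<bar>"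
        using assms abs_triangle_ineq4[of "t * sin (x * t)" "\<delta> * cos (x * t)"] by (simp add: abs_mult)
      also have "\<dots> \<le> \<bar>t\<bar> * 1 + \<delta> * 1" using assms by (intro add_mono mult_left_mono) auto
      finally have "exp (- \<delta> * x) * \<bar>t * sin (x * t) - \<delta> * cos (x * t)\<bar> \<le> exp (- \<delta> * x) * (\<bar>t\<bar> + \<delta>)"
        by (intro mult_left_mono) auto
      then show "norm (?F x) \<le> (\<bar>t\<bar> + \<delta>) * exp (- \<delta> * x) / (\<delta>\<^sup>2 + t\<^sup>2)"
        using pos by (simp add: abs_mult divide_right_mono mult.commute)
    qed
    then show "((?F \<circ> real_of_ereal) \<longlongrightarrow> 0) (at_left \<infinity>)"
      by (simp add: ereal_tendsto_simps)
  qed simp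
  then show ?thesis
    by (simp add: interval_integral_to_infinity_eq set_lebesgue_integral_def poisson_def)
qed

lemma integral_swap_lborel:
  fixes F :: "'a::euclidean_space \<Rightarrow> 'b::euclidean_space \<Rightarrow> real"
  assumes "integrable lborel (\<lambda>p. F (fst p) (snd p))"
  shows "(LINT x|lborel. LINT y|lborel. F x y) = (LINT p|lborel. F (fst p) (snd p))"
    and "(LINT y|lborel. LINT x|lborel. F x y) = (LINT p|lborel. F (fst p) (snd p))"
    and "integrable lborel (\<lambda>x. LINT y|lborel. F x y)"
proof -
  have int: "integrable (lborel \<Otimes>\<^sub>M lborel) (case_prod F)"
    using assms by (simp add: lborel_prod case_prod_beta')
  show "(LINT x|lborel. LINT y|lborel. F x y) = (LINT p|lborel. F (fst p) (snd p))"
    using lborel_pair.integral_fst[OF int] by (simp add: lborel_prod case_prod_beta')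
  show "(LINT y|lborel. LINT x|lborel. F x y) = (LINT p|lborel. F (fst p) (snd p))"
    using lborel_pair.integral_snd[OF int] by (simp add: lborel_prod case_prod_beta')
  show "integrable lborel (\<lambda>x. LINT y|lborel. F x y)"
    using lborel_pair.integrable_fst[OF int] .
qed

lemma gaussian_poisson_L2:
  assumes "\<mu> > 0" "\<delta> > 0"
  shows "(\<lambda>g::'n::finite heis. exp (- \<mu> * horiz g) * poisson \<delta> (vert g)) \<in> L2"
proof -
  have "integrable lborel (\<lambda>t. (poisson \<delta> t)\<^sup>2)"
  proof (rule Bochner_Integration.integrable_bound)
    show "integrable lborel (\<lambda>t. 1 / \<delta> * poisson \<delta> t)"
      by (intro integrable_mult_right integrable_poisson assms)
    show "AE t in lborel. norm ((poisson \<delta> t)\<^sup>2) \<le> norm (1 / \<delta> * poisson \<delta> t)"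
    proof (rule AE_I2)
      fix t
      have "poisson \<delta> t * poisson \<delta> t \<le> 1 / \<delta> * poisson \<delta> t"
        using poisson_bounds[OF assms(2), of t] by (intro mult_right_mono) auto
      then show "norm ((poisson \<delta> t)\<^sup>2) \<le> norm (1 / \<delta> * poisson \<delta> t)"
        using poisson_bounds[OF assms(2), of t] assms by (simp add: power2_eq_square)
    qed
  qed simp
  then have "integrable lborel (\<lambda>g::'n heis. exp (- (2 * \<mu>) * horiz g) * (poisson \<delta> (vert g))\<^sup>2)"
    using assms by (intro integral_horiz_vert) auto
  moreover have "(exp (- \<mu> * horiz g) * poisson \<delta> (vert g))\<^sup>2 = exp (- (2 * \<mu>) * horiz g) * (poisson \<delta> (vert g))\<^sup>2" for g :: "'n heis"
    by (simp add: power_mult_distrib power2_eq_square exp_add[symmetric])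
  ultimately show ?thesis by (simp add: L2_def)
qed

lemma L2_abs_mult_integrable:
  assumes "f \<in> L2" "u \<in> L2"
  shows "integrable lborel (\<lambda>x. \<bar>f x\<bar> * \<bar>u x\<bar>)"
  using integrable_abs[OF L2_mult_integrable[OF assms]] by (simp add: abs_mult)

lemma borel_mehler_v [measurable (raw)]:
  fixes f r :: "'a \<Rightarrow> real"
  assumes "f \<in> borel_measurable M" "r \<in> borel_measurable M"
  shows "(\<lambda>x. mehler_v n (f x) \<mu> (r x) s) \<in> borel_measurable M"
  unfolding mehler_v_def mehler_m_def mehler_w_def using assms by measurable

lemma borel_cutoff_wave [measurable (raw)]:
  fixes f r :: "'a \<Rightarrow> real"
  assumes "f \<in> borel_measurable M" "r \<in> borel_measurable M"
  shows "(\<lambda>x. cutoff_wave e (f x) (r x)) \<in> borel_measurable M"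
  unfolding cutoff_wave_def using assms by measurable

lemma borel_measurable_components [measurable]:
  "fst \<in> (borel :: ('a::second_countable_topology \<times> 'b::second_countable_topology) measure) \<rightarrow>\<^sub>M borel"
  "snd \<in> (borel :: ('a::second_countable_topology \<times> 'b::second_countable_topology) measure) \<rightarrow>\<^sub>M borel"
  by (simp_all add: borel_prod[symmetric])

text \<open>At a single frequency the pairing of \<open>T\<^sub>h f\<close> with an uncut wave need not converge.  Integration
  over the frequency therefore comes before the removal of the cutoff, \<open>\<eta> \<rightarrow> 0\<close>: it replaces the
  wave by the Poisson kernel, for which the limit is dominated.\<close>

lemma superposed_identity:
  fixes f :: "'n::finite heis \<Rightarrow> real"
  assumes T: "heat_semigroup T" and f: "f \<in> test_functions" and h: "0 < h" and \<mu>: "0 < \<mu>" and \<delta>: "0 < \<delta>"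
  shows "(LINT g|lborel. T h f g * (exp (- \<mu> * horiz g) * poisson \<delta> (vert g)))
    = (LINT q|lborel. (indicator {0<..} (fst q) * exp (- \<delta> * fst q))
        * (f (snd q) * (cos (fst q * vert (snd q)) * mehler_v CARD('n) (fst q) \<mu> (horiz (snd q)) h)))"
proof -
  let ?n = "CARD('n)"
  define a where "a \<omega> = indicator {0<..} \<omega> * exp (- \<delta> * \<omega>)" for \<omega> :: real
  define V where "V = T h f"
  define \<eta> where "\<eta> k = 1 / real (Suc k)" for k
  have \<eta>: "0 < \<eta> k" "\<eta> k \<le> 1" for k by (simp_all add: \<eta>_def)
  have \<eta>0: "\<eta> \<longlonglongrightarrow> 0" unfolding \<eta>_def using LIMSEQ_Suc[OF lim_const_over_n[of 1]] by simp
  have a: "0 \<le> a \<omega>" "\<omega> \<le> 0 \<Longrightarrow> a \<omega> = 0" for \<omega> by (auto simp: a_def)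
  have a_int: "integrable lborel a" unfolding a_def[abs_def] by (rule integrable_exp_decay[OF \<delta>])
  have VL2: "V \<in> L2" unfolding V_def using heat_semigroup_D[OF T] h test_function_L2[OF f] by simp
  note [measurable] = L2_D(2)[OF VL2] L2_D(2)[OF test_function_L2[OF f]]
  have [measurable]: "a \<in> borel_measurable borel" unfolding a_def[abs_def] by measurable
  have f_int: "integrable lborel (\<lambda>g. \<bar>f g\<bar>)" using test_function_integrable[OF f] by simp
  have wave1: "\<bar>cutoff_wave (\<eta> k ^ 4) \<omega> t\<bar> \<le> 1" for k \<omega> t
    using order_trans[OF cutoff_wave_bound[of "\<eta> k ^ 4" \<omega> t]] \<eta>[of k] by simp
  have v1: "\<bar>a \<omega> * (c * mehler_v ?n \<omega> \<mu> (horiz g) h)\<bar> \<le> a \<omega> * \<bar>c\<bar>" for \<omega> c and g :: "'n heis"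
  proof (cases "\<omega> > 0")
    case True
    have "mehler_v ?n \<omega> \<mu> (horiz g) h \<le> 1" "0 < mehler_v ?n \<omega> \<mu> (horiz g) h"
      using mehler_v_le[OF True \<mu>, of h h "horiz g" ?n] h \<mu>
      by (auto intro: order_trans simp: divide_nonneg_nonneg)
    then have "\<bar>c * mehler_v ?n \<omega> \<mu> (horiz g) h\<bar> \<le> \<bar>c\<bar>"
      by (simp add: abs_mult mult_left_le)
    then show ?thesis using a(1)[of \<omega>] by (simp add: abs_mult mult_left_mono)
  qed (use a(2)[of \<omega>] in simp)
  define A where "A k \<omega> g = a \<omega> * (V g * (cutoff_wave (\<eta> k ^ 4) \<omega> (vert g) * exp (- \<mu> * horiz g)))" for k \<omega> and g :: "'n heis"
  define B where "B k \<omega> g = a \<omega> * (f g * (cutoff_wave (\<eta> k ^ 4) \<omega> (vert g) * mehler_v ?n \<omega> \<mu> (horiz g) h))" for k \<omega> and g :: "'n heis"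
  define B0 where "B0 \<omega> g = a \<omega> * (f g * (cos (\<omega> * vert g) * mehler_v ?n \<omega> \<mu> (horiz g) h))" for \<omega> and g :: "'n heis"
  have B_le: "\<bar>B k \<omega> g\<bar> \<le> a \<omega> * \<bar>f g\<bar>" for k \<omega> g
  proof -
    have "\<bar>B k \<omega> g\<bar> \<le> a \<omega> * \<bar>f g * cutoff_wave (\<eta> k ^ 4) \<omega> (vert g)\<bar>"
      using v1[of \<omega> "f g * cutoff_wave (\<eta> k ^ 4) \<omega> (vert g)" g] by (simp add: B_def mult.assoc)
    also have "\<dots> \<le> a \<omega> * \<bar>f g\<bar>" using wave1 a by (intro mult_left_mono) (auto simp: abs_mult mult_left_le)
    finally show ?thesis .
  qed
  have A_int: "integrable lborel (\<lambda>q. A k (fst q) (snd q))" for k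
  proof (rule Bochner_Integration.integrable_bound)
    have "\<eta> k ^ 4 > 0" using \<eta>[of k] by simp
    then show "integrable lborel (\<lambda>q. a (fst q) * (\<bar>V (snd q)\<bar> * \<bar>gauss_weight \<mu> (\<eta> k ^ 4) (snd q)\<bar>))"
      by (intro integral_lborel_product(1) a_int L2_abs_mult_integrable VL2 gauss_weight_L2 \<mu>)
    show "AE q in lborel. norm (A k (fst q) (snd q)) \<le> norm (a (fst q) * (\<bar>V (snd q)\<bar> * \<bar>gauss_weight \<mu> (\<eta> k ^ 4) (snd q)\<bar>))"
    proof (rule AE_I2)
      fix q :: "real \<times> 'n heis"
      have "\<bar>cutoff_wave (\<eta> k ^ 4) (fst q) (vert (snd q)) * exp (- \<mu> * horiz (snd q))\<bar> \<le> gauss_weight \<mu> (\<eta> k ^ 4) (snd q)"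
        unfolding gauss_weight_eq abs_mult by (subst mult.commute, intro mult_mono cutoff_wave_bound) auto
      then show "norm (A k (fst q) (snd q)) \<le> norm (a (fst q) * (\<bar>V (snd q)\<bar> * \<bar>gauss_weight \<mu> (\<eta> k ^ 4) (snd q)\<bar>))"
        unfolding A_def real_norm_def abs_mult[of "a (fst q)"] abs_mult[of "V (snd q)"]
        using a by (simp add: mult_left_mono)
    qed
    show "(\<lambda>q. A k (fst q) (snd q)) \<in> borel_measurable lborel" unfolding A_def by measurable
  qed
  have B_int: "integrable lborel (\<lambda>q. B k (fst q) (snd q))" for k
    by (rule Bochner_Integration.integrable_bound[OF integral_lborel_product(1)[OF a_int f_int]])
      (unfold B_def, measurable, use B_le a in \<open>auto intro!: AE_I2 simp: abs_mult[of "a _" "\<bar>f _\<bar>"] B_def[symmetric]\<close>)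
  obtain K where K: "0 \<le> K" "\<And>\<omega> \<eta>. \<omega> > 0 \<Longrightarrow> 0 < \<eta> \<Longrightarrow> \<eta> \<le> 1 \<Longrightarrow>
    \<bar>(LINT g|lborel. V g * (cutoff_wave (\<eta> ^ 4) \<omega> (vert g) * exp (- \<mu> * horiz g)))
      - (LINT g|lborel. f g * (cutoff_wave (\<eta> ^ 4) \<omega> (vert g) * mehler_v ?n \<omega> \<mu> (horiz g) h))\<bar>
    \<le> K * (1 + \<omega>) * \<eta>"
    unfolding V_def by (rule duhamel_single_frequency[OF T f h \<mu>]) blast
  define M where "M = (LINT \<omega>|lborel. indicator {0<..} \<omega> * ((1 + \<omega>) * exp (- \<delta> * \<omega>)))"
  \<comment> \<open>The estimate at one frequency, integrated against \<open>e\<^bsup>-\<delta>\<omega>\<^esup>\<close>.\<close>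
  have diff: "\<bar>(LINT q|lborel. A k (fst q) (snd q)) - (LINT q|lborel. B k (fst q) (snd q))\<bar> \<le> \<eta> k * (K * M)" for k
  proof -
    have "(LINT q|lborel. A k (fst q) (snd q)) - (LINT q|lborel. B k (fst q) (snd q))
        = (LINT \<omega>|lborel. (LINT g|lborel. A k \<omega> g) - (LINT g|lborel. B k \<omega> g))"
      using integral_swap_lborel[OF A_int[of k]] integral_swap_lborel[OF B_int[of k]] by simp
    also have "\<bar>\<dots>\<bar> \<le> (LINT \<omega>|lborel. \<eta> k * K * (indicator {0<..} \<omega> * ((1 + \<omega>) * exp (- \<delta> * \<omega>))))"
      unfolding real_norm_def[symmetric]
    proof (rule Bochner_Integration.integral_norm_bound_integral)
      show "integrable lborel (\<lambda>\<omega>. (LINT g|lborel. A k \<omega> g) - (LINT g|lborel. B k \<omega> g))"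
        by (intro Bochner_Integration.integrable_diff integral_swap_lborel(3) A_int B_int)
      show "integrable lborel (\<lambda>\<omega>. \<eta> k * K * (indicator {0<..} \<omega> * ((1 + \<omega>) * exp (- \<delta> * \<omega>))))"
        by (intro integrable_mult_right integrable_linear_exp_decay \<delta>)
      show "norm ((LINT g|lborel. A k \<omega> g) - (LINT g|lborel. B k \<omega> g)) \<le> \<eta> k * K * (indicator {0<..} \<omega> * ((1 + \<omega>) * exp (- \<delta> * \<omega>)))" for \<omega>
      proof (cases "\<omega> > 0")
        case True
        have "\<bar>(LINT g|lborel. A k \<omega> g) - (LINT g|lborel. B k \<omega> g)\<bar> = a \<omega> *
            \<bar>(LINT g|lborel. V g * (cutoff_wave (\<eta> k ^ 4) \<omega> (vert g) * exp (- \<mu> * horiz g)))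
            - (LINT g|lborel. f g * (cutoff_wave (\<eta> k ^ 4) \<omega> (vert g) * mehler_v ?n \<omega> \<mu> (horiz g) h))\<bar>"
          unfolding A_def B_def integral_mult_right_zero right_diff_distrib[symmetric] using a by (simp add: abs_mult)
        also have "\<dots> \<le> a \<omega> * (K * (1 + \<omega>) * \<eta> k)" using K(2)[OF True \<eta>] a by (intro mult_left_mono) auto
        finally show ?thesis using True by (simp add: a_def mult_ac)
      qed (use a(2)[of \<omega>] in \<open>simp add: A_def B_def\<close>)
    qed
    also have "\<dots> = \<eta> k * (K * M)" unfolding integral_mult_right_zero M_def by simp
    finally show ?thesis .
  qed
  have diff0: "(\<lambda>k. (LINT q|lborel. A k (fst q) (snd q)) - (LINT q|lborel. B k (fst q) (snd q))) \<longlonglongrightarrow> 0"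
    by (rule Lim_null_comparison[where g="\<lambda>k. \<eta> k * (K * M)"])
       (use diff tendsto_mult_right[OF \<eta>0, of "K * M"] in auto)
  have wave0: "(\<lambda>k. exp (- (\<eta> k ^ 4) * t\<^sup>2)) \<longlonglongrightarrow> 1" for t
  proof -
    have "(\<lambda>k. exp (- (\<eta> k ^ 4) * t\<^sup>2)) \<longlonglongrightarrow> exp (- (0 ^ 4) * t\<^sup>2)" by (intro tendsto_intros \<eta>0)
    then show ?thesis by simp
  qed
  have A_lim: "(\<lambda>k. LINT q|lborel. A k (fst q) (snd q)) \<longlonglongrightarrow> (LINT g|lborel. V g * (exp (- \<mu> * horiz g) * poisson \<delta> (vert g)))"
  proof -
    have eq: "(LINT q|lborel. A k (fst q) (snd q))
        = (LINT g|lborel. exp (- (\<eta> k ^ 4) * (vert g)\<^sup>2) * (V g * (exp (- \<mu> * horiz g) * poisson \<delta> (vert g))))" for k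
    proof -
      have "(LINT \<omega>|lborel. A k \<omega> g) = exp (- (\<eta> k ^ 4) * (vert g)\<^sup>2) * (V g * (exp (- \<mu> * horiz g) * poisson \<delta> (vert g)))" for g
      proof -
        have "(LINT \<omega>|lborel. A k \<omega> g) = (LINT \<omega>|lborel. (V g * (exp (- \<mu> * horiz g) * exp (- (\<eta> k ^ 4) * (vert g)\<^sup>2)))
            * (indicator {0<..} \<omega> * (exp (- \<delta> * \<omega>) * cos (\<omega> * vert g))))"
          by (intro Bochner_Integration.integral_cong) (simp_all add: A_def a_def cutoff_wave_def mult_ac)
        also have "\<dots> = (V g * (exp (- \<mu> * horiz g) * exp (- (\<eta> k ^ 4) * (vert g)\<^sup>2))) * poisson \<delta> (vert g)"
          unfolding integral_mult_right_zero poisson_cosine_transform[OF \<delta>] ..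
        finally show ?thesis by (simp only: mult_ac)
      qed
      then show ?thesis using integral_swap_lborel(2)[OF A_int[of k]] by simp
    qed
    show ?thesis unfolding eq
    proof (rule integral_dominated_convergence)
      show "integrable lborel (\<lambda>g. \<bar>V g\<bar> * \<bar>exp (- \<mu> * horiz g) * poisson \<delta> (vert g)\<bar>)"
        by (rule L2_abs_mult_integrable[OF VL2 gaussian_poisson_L2[OF \<mu> \<delta>]])
      show "AE g in lborel. (\<lambda>k. exp (- (\<eta> k ^ 4) * (vert g)\<^sup>2) * (V g * (exp (- \<mu> * horiz g) * poisson \<delta> (vert g))))
          \<longlonglongrightarrow> V g * (exp (- \<mu> * horiz g) * poisson \<delta> (vert g))"
        by (rule AE_I2) (use tendsto_mult_right[OF wave0] in force)
      show "AE g in lborel. norm (exp (- (\<eta> k ^ 4) * (vert g)\<^sup>2) * (V g * (exp (- \<mu> * horiz g) * poisson \<delta> (vert g))))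
          \<le> \<bar>V g\<bar> * \<bar>exp (- \<mu> * horiz g) * poisson \<delta> (vert g)\<bar>" for k
      proof (rule AE_I2)
        fix g :: "'n heis"
        have "exp (- (\<eta> k ^ 4) * (vert g)\<^sup>2) \<le> 1" by simp
        then show "norm (exp (- (\<eta> k ^ 4) * (vert g)\<^sup>2) * (V g * (exp (- \<mu> * horiz g) * poisson \<delta> (vert g))))
          \<le> \<bar>V g\<bar> * \<bar>exp (- \<mu> * horiz g) * poisson \<delta> (vert g)\<bar>"
          unfolding real_norm_def abs_mult[of "exp (- (\<eta> k ^ 4) * (vert g)\<^sup>2)"] abs_mult[of "V g", symmetric]
          by (intro mult_left_le_one_le) auto
      qed
    qed measurable
  qed
  have B_lim: "(\<lambda>k. LINT q|lborel. B k (fst q) (snd q)) \<longlonglongrightarrow> (LINT q|lborel. B0 (fst q) (snd q))"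
  proof (rule integral_dominated_convergence[OF _ _ integral_lborel_product(1)[OF a_int f_int]])
    show "(\<lambda>q. B0 (fst q) (snd q)) \<in> borel_measurable lborel" unfolding B0_def by measurable
    show "(\<lambda>q. B k (fst q) (snd q)) \<in> borel_measurable lborel" for k unfolding B_def by measurable
    show "AE q in lborel. (\<lambda>k. B k (fst q) (snd q)) \<longlonglongrightarrow> B0 (fst q) (snd q)"
    proof (rule AE_I2)
      fix q :: "real \<times> 'n heis"
      have "(\<lambda>k. exp (- (\<eta> k ^ 4) * (vert (snd q))\<^sup>2) * B0 (fst q) (snd q)) \<longlonglongrightarrow> 1 * B0 (fst q) (snd q)"
        by (intro tendsto_mult_right wave0)
      moreover have "B k (fst q) (snd q) = exp (- (\<eta> k ^ 4) * (vert (snd q))\<^sup>2) * B0 (fst q) (snd q)" for k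
        by (simp add: B_def B0_def cutoff_wave_def)
      ultimately show "(\<lambda>k. B k (fst q) (snd q)) \<longlonglongrightarrow> B0 (fst q) (snd q)" by simp
    qed
  qed (use B_le in auto)
  have "(LINT g|lborel. V g * (exp (- \<mu> * horiz g) * poisson \<delta> (vert g))) - (LINT q|lborel. B0 (fst q) (snd q)) = 0"
    by (rule LIMSEQ_unique[OF tendsto_diff[OF A_lim B_lim] diff0])
  then show ?thesis by (simp add: V_def B0_def a_def)
qed

section \<open>The explicit heat kernel\<close>

lemma gaussian_integral_scaling:
  assumes "\<mu> > 0"
  shows "(LINT x|lborel. exp (- 1 * ((x::real^'n::finite) \<bullet> x)))\<^sup>2
    = \<mu> ^ CARD('n) * (LINT x|lborel. exp (- \<mu> * ((x::real^'n) \<bullet> x)))\<^sup>2"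
proof -
  have c: "sqrt \<mu> \<noteq> 0" using assms by simp
  let ?G = "\<lambda>x::real^'n. exp (- 1 * (x \<bullet> x))"
  have "(LINT x|lborel. ?G x)
      = (LINT x|density (distr lborel borel (\<lambda>x. 0 + sqrt \<mu> *\<^sub>R x)) (\<lambda>_. ennreal (\<bar>sqrt \<mu>\<bar> ^ DIM(real^'n))). ?G x)"
    using lborel_affine[OF c, of "0 :: real^'n"] by simp
  also have "\<dots> = (LINT x|distr lborel borel (\<lambda>x. 0 + sqrt \<mu> *\<^sub>R x). \<bar>sqrt \<mu>\<bar> ^ DIM(real^'n) *\<^sub>R ?G x)"
    by (rule integral_density) auto
  also have "\<dots> = (LINT x|lborel. \<bar>sqrt \<mu>\<bar> ^ DIM(real^'n) *\<^sub>R ?G (0 + sqrt \<mu> *\<^sub>R x))"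
    by (rule integral_distr) auto
  also have "\<dots> = sqrt \<mu> ^ CARD('n) * (LINT x|lborel. exp (- \<mu> * ((x::real^'n) \<bullet> x)))"
  proof -
    have "exp (- 1 * ((0 + sqrt \<mu> *\<^sub>R x) \<bullet> (0 + sqrt \<mu> *\<^sub>R x))) = exp (- \<mu> * (x \<bullet> x))" for x :: "real^'n"
      using assms by (simp add: mult.assoc[symmetric])
    then show ?thesis using assms by (simp only: real_scaleR_def integral_mult_right_zero) (simp add: DIM_cart)
  qed
  finally show ?thesis using assms
    by (simp add: power_mult_distrib power_mult[symmetric] mult.commute[of _ 2] power_mult[of "sqrt \<mu>" 2])
qed

text \<open>The mass, for every \<open>\<mu>\<close> and \<open>\<delta>\<close>, of the kernel \<open>\<mu>\<^sup>n e\<^bsup>-\<mu>\<rho>\<^esup> poisson \<delta> t\<close>.\<close>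

definition identity_mass :: "'n::finite itself \<Rightarrow> real" where
  "identity_mass _ = (LINT x|lborel. exp (- 1 * ((x::real^'n) \<bullet> x)))\<^sup>2 * (LINT t|lborel. 1 / (1 + (t::real)\<^sup>2))"

lemma integral_pos_if_pos:
  fixes f :: "'a::euclidean_space \<Rightarrow> real"
  assumes "integrable lborel f" "\<And>x. f x > 0" shows "(LINT x|lborel. f x) > 0"
proof -
  have "(LINT x|lborel. f x) \<noteq> 0"
  proof
    assume "(LINT x|lborel. f x) = 0"
    then have "AE x in lborel. f x = 0"
      using integral_nonneg_eq_0_iff_AE[OF assms(1)] assms(2) by (simp add: less_imp_le)
    then have "AE x in (lborel :: 'a measure). False" by eventually_elim (use assms(2) in \<open>metis less_irrefl\<close>)
    then show False by (auto simp: AE_iff_null emeasure_lborel_UNIV dest!: null_setsD1)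
  qed
  moreover have "(LINT x|lborel. f x) \<ge> 0" by (rule Bochner_Integration.integral_nonneg) (simp add: assms(2) less_imp_le)
  ultimately show ?thesis by simp
qed

lemma identity_mass_pos: "identity_mass TYPE('n::finite) > 0"
  unfolding identity_mass_def
  by (intro mult_pos_pos zero_less_power integral_pos_if_pos integrable_gaussian integrable_inverse_one_plus_square)
     (auto simp: add_pos_nonneg)

lemma power_times_exp_tendsto_zero:
  assumes "c > 0" shows "(\<lambda>k. real (Suc k) ^ N * exp (- c * real (Suc k))) \<longlonglongrightarrow> 0"
proof -
  have "((\<lambda>x::real. x ^ N * exp (- c * x)) \<longlongrightarrow> 0) at_top"
  proof -
    have "filterlim (\<lambda>x. c * x) at_top at_top"
      using filterlim_tendsto_pos_mult_at_top[OF tendsto_const assms filterlim_ident] .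
    from filterlim_compose[OF tendsto_power_div_exp_0[of N] this]
    have "((\<lambda>x. (1 / c) ^ N * ((c * x) ^ N / exp (c * x))) \<longlongrightarrow> (1 / c) ^ N * 0) at_top"
      by (intro tendsto_mult_left)
    moreover have "(1 / c) ^ N * ((c * x) ^ N / exp (c * x)) = x ^ N * exp (- c * x)" for x
      using assms by (simp add: power_mult_distrib exp_minus field_simps)
    ultimately show ?thesis by simp
  qed
  moreover have "filterlim (\<lambda>k. real (Suc k)) at_top sequentially"
    using filterlim_compose[OF filterlim_real_sequentially filterlim_Suc] .
  ultimately show ?thesis by (rule filterlim_compose)
qed

lemma norm_heis_square: "(norm g)\<^sup>2 = horiz g + (vert g)\<^sup>2"
  by (cases g) (simp add: norm_Pair power2_norm_eq_inner horiz_def vert_def)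

text \<open>Near the origin continuity of \<open>W\<close> suffices.  Far from it \<open>V\<close> is only square integrable, so the
  kernel must be small there in \<open>L\<^sup>2\<close>.  The choice \<open>\<delta> = \<mu>\<^bsup>-n-1\<^esup>\<close> makes \<open>\<mu>\<^sup>n \<delta>\<close> tend to zero, which deals with
  large \<open>|t|\<close> uniformly in \<open>x\<close> and \<open>y\<close>; altogether the kernel is far from the origin at most a null
  sequence times one fixed function that is both integrable and square integrable.\<close>

lemma gaussian_poisson_approximate_identity:
  fixes V W :: "'n::finite heis \<Rightarrow> real"
  defines "\<mu> \<equiv> \<lambda>k. real (Suc k)" and "\<delta> \<equiv> \<lambda>k. 1 / real (Suc k) ^ (CARD('n) + 1)"
  assumes V: "V \<in> L2" and VW: "AE g in lborel. V g = W g" and W: "isCont W 0"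
  shows "(\<lambda>k. \<mu> k ^ CARD('n) * (LINT g|lborel. V g * (exp (- \<mu> k * horiz g) * poisson (\<delta> k) (vert g))))
    \<longlonglongrightarrow> identity_mass TYPE('n) * W 0"
proof -
  let ?n = "CARD('n)"
  define I where "I k = \<mu> k ^ ?n * (LINT g|lborel. V g * (exp (- \<mu> k * horiz g) * poisson (\<delta> k) (vert g)))" for k
  define K where "K k g = \<mu> k ^ ?n * (exp (- \<mu> k * horiz g) * poisson (\<delta> k) (vert g))" for k and g :: "'n heis"
  define C where "C = identity_mass TYPE('n)"
  have \<mu>: "\<mu> k \<ge> 1" "\<mu> k > 0" for k by (simp_all add: \<mu>_def)
  have \<delta>: "\<delta> k > 0" "\<delta> k \<le> 1" "\<mu> k ^ ?n * \<delta> k = 1 / \<mu> k" "1 / (\<delta> k)\<^sup>2 = \<mu> k ^ (2 * ?n + 2)" for k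
  proof -
    have d: "\<delta> k = 1 / \<mu> k ^ (?n + 1)" by (simp add: \<delta>_def \<mu>_def)
    have p: "\<mu> k ^ (?n + 1) \<ge> 1" using one_le_power[OF \<mu>(1)] .
    show "\<delta> k > 0" "\<delta> k \<le> 1" using p by (simp_all add: d divide_le_eq)
    show "\<mu> k ^ ?n * \<delta> k = 1 / \<mu> k" using \<mu>(2)[of k] by (simp add: d)
    have "1 / (\<delta> k)\<^sup>2 = (\<mu> k ^ (?n + 1))\<^sup>2" using p by (simp add: d power_divide)
    also have "\<dots> = \<mu> k ^ (2 * ?n + 2)" by (simp only: power_mult[symmetric]) (simp add: mult.commute)
    finally show "1 / (\<delta> k)\<^sup>2 = \<mu> k ^ (2 * ?n + 2)" .
  qed
  have K_L2: "K k \<in> L2" for k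
    unfolding K_def[abs_def] by (intro L2_scale gaussian_poisson_L2 \<mu> \<delta>)
  have K_nonneg: "0 \<le> K k g" for k g
    using \<mu>(2)[of k] poisson_bounds(1)[OF \<delta>(1)[of k], of "vert g"] by (simp add: K_def less_imp_le)
  have K_int: "integrable lborel (K k)" and K_mass: "(LINT g|lborel. K k g) = C" for k
  proof -
    show "integrable lborel (K k)"
      unfolding K_def[abs_def] by (intro integrable_mult_right integral_horiz_vert \<mu> integrable_poisson \<delta>)
    have "(LINT g|lborel. K k g) = \<mu> k ^ ?n * ((LINT x|lborel. exp (- \<mu> k * ((x::real^'n) \<bullet> x)))\<^sup>2
        * (LINT t|lborel. poisson (\<delta> k) t))"
      unfolding K_def integral_mult_right_zero
      by (subst integral_horiz_vert(2)) (auto intro: \<mu> integrable_poisson \<delta>)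
    also have "\<dots> = C"
      unfolding C_def identity_mass_def gaussian_integral_scaling[OF \<mu>(2)[of k]] integral_poisson[OF \<delta>(1)] by simp
    finally show "(LINT g|lborel. K k g) = C" .
  qed
  define w where "w g = exp (- (1 / 2) * horiz g) * poisson 1 (vert g)" for g :: "'n heis"
  have w_L2: "w \<in> L2" unfolding w_def[abs_def] by (rule gaussian_poisson_L2) auto
  have w_int: "integrable lborel w" unfolding w_def[abs_def] by (intro integral_horiz_vert integrable_poisson) auto
  have w_nonneg: "0 \<le> w g" for g by (simp add: w_def poisson_def add_nonneg_nonneg)
  define Z where "Z = (LINT g|lborel. \<bar>V g\<bar> * w g + \<bar>W 0\<bar> * w g)"
  have Z_int: "integrable lborel (\<lambda>g. \<bar>V g\<bar> * w g + \<bar>W 0\<bar> * w g)"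
    using L2_abs_mult_integrable[OF V w_L2] w_int w_nonneg by (simp add: abs_of_nonneg)
  have Z0: "0 \<le> Z" unfolding Z_def by (rule Bochner_Integration.integral_nonneg) (simp add: w_nonneg)
  have main: "\<exists>N. \<forall>k\<ge>N. \<bar>I k - C * W 0\<bar>
      \<le> \<epsilon> * C + \<epsilon> * Z" if \<epsilon>: "\<epsilon> > 0" for \<epsilon>
  proof -
    obtain d where d: "d > 0" "\<And>g. dist g 0 < d \<Longrightarrow> dist (W g) (W 0) < \<epsilon>"
      using W \<epsilon> unfolding continuous_at_eps_delta by blast
    define \<rho> where "\<rho> = min 1 (d\<^sup>2 / 2)"
    have \<rho>: "\<rho> > 0" "\<rho> \<le> 1" "2 * \<rho> \<le> d\<^sup>2" using d by (auto simp: \<rho>_def min_def)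
    define a where "a k = (1 + 1 / \<rho>\<^sup>2) / \<mu> k + \<mu> k ^ (2 * ?n + 1) * exp (- (\<rho> / 2) * \<mu> k)" for k
    have near: "\<bar>W g - W 0\<bar> \<le> \<epsilon>" if "horiz g < \<rho>" "\<bar>vert g\<bar> < \<rho>" for g
    proof -
      have "(vert g)\<^sup>2 \<le> \<rho> * \<rho>" using that power_mono[of "\<bar>vert g\<bar>" \<rho> 2] by (simp add: power2_eq_square)
      also have "\<dots> \<le> \<rho>" using \<rho> by (simp add: mult_left_le)
      finally have "(norm g)\<^sup>2 < d\<^sup>2" using that \<rho> by (simp add: norm_heis_square)
      then have "dist g 0 < d" using d(1) by (simp add: power_less_imp_less_base)
      from d(2)[OF this] show ?thesis by (simp add: dist_real_def)
    qed
    \<comment> \<open>Small \<open>t\<close> but large \<open>\<rho>\<close>: the Gaussian beats the powers of \<open>\<mu>\<close>; large \<open>t\<close>: the factor \<open>\<mu>\<^sup>n \<delta> = 1/\<mu>\<close> remains.\<close>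
    have far: "K k g \<le> a k * w g" if "\<not> (horiz g < \<rho> \<and> \<bar>vert g\<bar> < \<rho>)" for k g
    proof -
      let ?t = "vert g"
      have K_eq: "K k g = exp (- \<mu> k * horiz g) * (1 / \<mu> k * (1 / ((\<delta> k)\<^sup>2 + ?t\<^sup>2)))"
      proof -
        have "K k g = exp (- \<mu> k * horiz g) * ((\<mu> k ^ ?n * \<delta> k) * (1 / ((\<delta> k)\<^sup>2 + ?t\<^sup>2)))"
          by (simp add: K_def poisson_def)
        then show ?thesis unfolding \<delta>(3) .
      qed
      have posd: "0 < (\<delta> k)\<^sup>2 + ?t\<^sup>2" using \<delta>(1)[of k] by (simp add: add_pos_nonneg)
      have pos1: "0 < 1 + ?t\<^sup>2" by (simp add: add_pos_nonneg)
      have w_eq: "w g = exp (- (1 / 2) * horiz g) * (1 / (1 + ?t\<^sup>2))" by (simp add: w_def poisson_def)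
      show ?thesis
      proof (cases "\<bar>?t\<bar> < \<rho>")
        case True
        then have r: "\<rho> \<le> horiz g" using that by simp
        have "(\<rho> / 2) * \<mu> k + 1 / 2 * horiz g \<le> \<mu> k * horiz g"
        proof -
          have "\<rho> * \<mu> k \<le> horiz g * \<mu> k" "1 * horiz g \<le> \<mu> k * horiz g"
            using r \<mu>[of k] by (intro mult_right_mono; simp)+
          then show ?thesis by (simp add: mult.commute)
        qed
        then have 1: "exp (- \<mu> k * horiz g) \<le> exp (- (\<rho> / 2) * \<mu> k) * exp (- (1 / 2) * horiz g)"
          by (simp add: exp_add[symmetric])
        have "(\<delta> k)\<^sup>2 * (1 + ?t\<^sup>2) \<le> (\<delta> k)\<^sup>2 + ?t\<^sup>2"
          using \<delta>(1,2)[of k] power_le_one[of "\<delta> k" 2] mult_left_le[of "(\<delta> k)\<^sup>2" "?t\<^sup>2"]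
          by (simp add: algebra_simps)
        then have "1 / ((\<delta> k)\<^sup>2 + ?t\<^sup>2) \<le> 1 / (\<delta> k)\<^sup>2 * (1 / (1 + ?t\<^sup>2))"
          using posd pos1 \<delta>(1)[of k] by (simp add: frac_le)
        then have "1 / \<mu> k * (1 / ((\<delta> k)\<^sup>2 + ?t\<^sup>2)) \<le> 1 / \<mu> k * (\<mu> k ^ (2 * ?n + 2) * (1 / (1 + ?t\<^sup>2)))"
          unfolding \<delta>(4) using \<mu>(2)[of k] by (intro mult_left_mono) auto
        also have "\<dots> = \<mu> k ^ (2 * ?n + 1) * (1 / (1 + ?t\<^sup>2))" using \<mu>(2)[of k] by (simp add: power_add)
        finally have 2: "1 / \<mu> k * (1 / ((\<delta> k)\<^sup>2 + ?t\<^sup>2)) \<le> \<mu> k ^ (2 * ?n + 1) * (1 / (1 + ?t\<^sup>2))" .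
        have "K k g \<le> exp (- (\<rho> / 2) * \<mu> k) * exp (- (1 / 2) * horiz g) * (\<mu> k ^ (2 * ?n + 1) * (1 / (1 + ?t\<^sup>2)))"
          unfolding K_eq by (rule mult_mono[OF 1 2]) (use \<mu>(2)[of k] posd in auto)
        also have "\<dots> = \<mu> k ^ (2 * ?n + 1) * exp (- (\<rho> / 2) * \<mu> k) * w g" by (simp add: w_eq)
        also have "\<dots> \<le> a k * w g"
          unfolding a_def using \<mu>(2)[of k] \<rho> by (intro mult_right_mono w_nonneg) simp
        finally show ?thesis .
      next
        case False
        have t2: "?t\<^sup>2 \<ge> \<rho>\<^sup>2" using False \<rho> power_mono[of \<rho> "\<bar>?t\<bar>" 2] by simp
        then have tpos: "?t\<^sup>2 > 0" using \<rho> by (smt (verit) zero_less_power)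
        have "1 + ?t\<^sup>2 \<le> (1 + 1 / \<rho>\<^sup>2) * ?t\<^sup>2" using t2 \<rho> by (simp add: field_simps)
        also have "\<dots> \<le> (1 + 1 / \<rho>\<^sup>2) * ((\<delta> k)\<^sup>2 + ?t\<^sup>2)" using \<rho> by (intro mult_left_mono) auto
        finally have 2: "1 / ((\<delta> k)\<^sup>2 + ?t\<^sup>2) \<le> (1 + 1 / \<rho>\<^sup>2) * (1 / (1 + ?t\<^sup>2))"
          using posd pos1 by (simp add: divide_simps mult.commute)
        have "1 / 2 * horiz g \<le> \<mu> k * horiz g" using \<mu>(1)[of k] by (intro mult_right_mono) auto
        then have 1: "exp (- \<mu> k * horiz g) \<le> exp (- (1 / 2) * horiz g)" by simp
        have "K k g \<le> exp (- (1 / 2) * horiz g) * (1 / \<mu> k * ((1 + 1 / \<rho>\<^sup>2) * (1 / (1 + ?t\<^sup>2))))"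
          unfolding K_eq using \<mu>(2)[of k] posd by (intro mult_mono 1 2) auto
        also have "\<dots> = (1 + 1 / \<rho>\<^sup>2) / \<mu> k * w g" by (simp add: w_eq)
        also have "\<dots> \<le> a k * w g"
          unfolding a_def using \<mu>(2)[of k] \<rho> by (intro mult_right_mono w_nonneg) simp
        finally show ?thesis .
      qed
    qed
    have a_nonneg: "0 \<le> a k" for k using \<mu>(2)[of k] by (simp add: a_def less_imp_le)
    have a0: "a \<longlonglongrightarrow> 0"
    proof -
      have "(\<lambda>k. (1 + 1 / \<rho>\<^sup>2) / \<mu> k) \<longlonglongrightarrow> 0"
        unfolding \<mu>_def using LIMSEQ_Suc[OF lim_const_over_n[of "1 + 1 / \<rho>\<^sup>2"]] by simp
      moreover have "(\<lambda>k. \<mu> k ^ (2 * ?n + 1) * exp (- (\<rho> / 2) * \<mu> k)) \<longlonglongrightarrow> 0"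
        unfolding \<mu>_def using \<rho> by (intro power_times_exp_tendsto_zero) simp
      ultimately show ?thesis unfolding a_def[abs_def] using tendsto_add by fastforce
    qed
    have est: "\<bar>I k - C * W 0\<bar>
        \<le> \<epsilon> * C + a k * Z" for k
    proof -
      have "I k = (LINT g|lborel. V g * K k g)"
        unfolding I_def integral_mult_right_zero[symmetric] by (intro Bochner_Integration.integral_cong) (auto simp: K_def)
      moreover have "C * W 0 = (LINT g|lborel. W 0 * K k g)" by (simp add: K_mass)
      ultimately have "I k - C * W 0
          = (LINT g|lborel. V g * K k g - W 0 * K k g)"
        using L2_mult_integrable[OF V K_L2[of k]] K_int by simp
      also have "\<bar>\<dots>\<bar> \<le> (LINT g|lborel. \<bar>V g * K k g - W 0 * K k g\<bar>)" by (rule integral_abs_bound)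
      also have "\<dots> \<le> (LINT g|lborel. \<epsilon> * K k g + a k * (\<bar>V g\<bar> * w g + \<bar>W 0\<bar> * w g))"
      proof (rule integral_mono_AE)
        show "integrable lborel (\<lambda>g. \<bar>V g * K k g - W 0 * K k g\<bar>)"
          using L2_mult_integrable[OF V K_L2[of k]] K_int by simp
        show "integrable lborel (\<lambda>g. \<epsilon> * K k g + a k * (\<bar>V g\<bar> * w g + \<bar>W 0\<bar> * w g))"
          by (intro Bochner_Integration.integrable_add[OF integrable_mult_right[OF K_int] integrable_mult_right[OF Z_int]])
        show "AE g in lborel. \<bar>V g * K k g - W 0 * K k g\<bar> \<le> \<epsilon> * K k g + a k * (\<bar>V g\<bar> * w g + \<bar>W 0\<bar> * w g)"
          using VW
        proof eventually_elim
          case (elim g)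
          have eq: "\<bar>V g * K k g - W 0 * K k g\<bar> = \<bar>V g - W 0\<bar> * K k g"
            using K_nonneg[of k g] by (simp add: left_diff_distrib[symmetric] abs_mult)
          show ?case
          proof (cases "horiz g < \<rho> \<and> \<bar>vert g\<bar> < \<rho>")
            case True
            then have "\<bar>V g - W 0\<bar> * K k g \<le> \<epsilon> * K k g"
              using near[of g] elim K_nonneg by (intro mult_right_mono) auto
            moreover have "0 \<le> a k * (\<bar>V g\<bar> * w g + \<bar>W 0\<bar> * w g)" using a_nonneg w_nonneg by simp
            ultimately show ?thesis unfolding eq by linarith
          next
            case False
            have "\<bar>V g - W 0\<bar> * K k g \<le> (\<bar>V g\<bar> + \<bar>W 0\<bar>) * (a k * w g)"
              using far[OF False] K_nonneg by (intro mult_mono abs_triangle_ineq4) auto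
            also have "\<dots> = a k * (\<bar>V g\<bar> * w g + \<bar>W 0\<bar> * w g)" by (simp add: algebra_simps)
            finally show ?thesis unfolding eq using K_nonneg[of k g] \<epsilon> by (simp add: add_increasing)
          qed
        qed
      qed
      also have "\<dots> = \<epsilon> * C + a k * Z"
        using K_int Z_int by (simp add: K_mass Z_def)
      finally show ?thesis .
    qed
    from order_tendstoD(2)[OF a0 \<epsilon>] obtain N where N: "\<And>k. k \<ge> N \<Longrightarrow> a k < \<epsilon>"
      by (auto simp: eventually_sequentially)
    show ?thesis
    proof (intro exI[of _ N] allI impI)
      fix k assume "N \<le> k"
      then have "a k * Z \<le> \<epsilon> * Z" using N[of k] Z0 by (intro mult_right_mono) auto
      then have "\<epsilon> * C + a k * Z \<le> \<epsilon> * C + \<epsilon> * Z" by (rule add_left_mono)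
      with est[of k] show "\<bar>I k - C * W 0\<bar>
          \<le> \<epsilon> * C + \<epsilon> * Z" by (rule order_trans)
    qed
  qed
  show ?thesis
    unfolding I_def[symmetric]
  proof (rule LIMSEQ_I)
    fix r :: real assume r: "r > 0"
    have C0: "C > 0" unfolding C_def by (rule identity_mass_pos)
    define \<epsilon> where "\<epsilon> = r / 2 / (C + Z)"
    have CZ: "C + Z > 0" using C0 Z0 by simp
    have "\<epsilon> > 0" using r CZ by (simp add: \<epsilon>_def)
    have "\<epsilon> * C + \<epsilon> * Z = \<epsilon> * (C + Z)" by (rule distrib_left[symmetric])
    also have "\<dots> = r / 2"
    proof -
      have "x / y * y = x" if "y \<noteq> 0" for x y :: real using that by simp
      then show ?thesis unfolding \<epsilon>_def using CZ by (metis less_irrefl)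
    qed
    finally have less: "\<epsilon> * C + \<epsilon> * Z < r" using r by linarith
    obtain N where N: "\<forall>k\<ge>N. \<bar>I k - C * W 0\<bar>
        \<le> \<epsilon> * C + \<epsilon> * Z"
      using main[OF \<open>\<epsilon> > 0\<close>] ..
    show "\<exists>N. \<forall>k\<ge>N. norm (I k
        - identity_mass TYPE('n) * W 0) < r"
      unfolding C_def[symmetric] real_norm_def
    proof (intro exI[of _ N] allI impI)
      fix k assume "N \<le> k"
      then have "\<bar>I k - C * W 0\<bar>
          \<le> \<epsilon> * C + \<epsilon> * Z" by (rule N[THEN spec, THEN mp])
      then show "\<bar>I k - C * W 0\<bar> < r"
        using less by (rule order_le_less_trans)
    qed
  qed
qed

lemma continuous_on_integral_dominated:
  fixes F :: "'b::metric_space \<Rightarrow> 'a \<Rightarrow> real"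
  assumes cont: "\<And>x. x \<in> space M \<Longrightarrow> continuous_on S (\<lambda>g. F g x)"
    and meas: "\<And>g. g \<in> S \<Longrightarrow> F g \<in> borel_measurable M"
    and bnd: "\<And>g x. g \<in> S \<Longrightarrow> x \<in> space M \<Longrightarrow> \<bar>F g x\<bar> \<le> w x"
    and w: "integrable M w"
  shows "continuous_on S (\<lambda>g. LINT x|M. F g x)"
  unfolding continuous_on_sequentially
proof (intro allI ballI impI, elim conjE)
  fix X a assume a: "a \<in> S" and X: "\<forall>n. X n \<in> S" "X \<longlonglongrightarrow> a"
  have "(\<lambda>i. LINT x|M. F (X i) x) \<longlonglongrightarrow> (LINT x|M. F a x)"
  proof (rule integral_dominated_convergence[OF _ _ w])
    show "F a \<in> borel_measurable M" "\<And>i. F (X i) \<in> borel_measurable M" using meas a X by auto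
    show "AE x in M. (\<lambda>i. F (X i) x) \<longlonglongrightarrow> F a x"
      using cont a X by (auto intro!: AE_I2 simp: continuous_on_sequentially comp_def)
    show "\<And>i. AE x in M. norm (F (X i) x) \<le> w x" using bnd X by (auto intro!: AE_I2)
  qed
  then show "((\<lambda>g. LINT x|M. F g x) \<circ> X) \<longlonglongrightarrow> (LINT x|M. F a x)" by (simp add: comp_def)
qed

lemma continuous_heis_mult: "continuous_on S (\<lambda>q. heis_mult (fst q) (snd q))"
proof -
  have "(\<lambda>q. heis_mult (fst q) (snd q)) = (\<lambda>q :: 'a heis \<times> 'a heis. (fst (fst q) + fst (snd q), fst (snd (fst q)) + fst (snd (snd q)),
      snd (snd (fst q)) + snd (snd (snd q)) + 2 * (fst (snd (fst q)) \<bullet> fst (snd q)) - 2 * (fst (fst q) \<bullet> fst (snd (snd q)))))"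
    by (auto simp: fun_eq_iff)
  then show ?thesis by (simp only:) (intro continuous_intros)
qed

lemma heis_mult_zero [simp]: "heis_mult k 0 = k"
  by (cases k) (simp add: zero_prod_def)

text \<open>The test function confines the integration to a compact set, on which the kernel is bounded.\<close>

lemma heis_convolution_continuous:
  fixes f P :: "'n::finite heis \<Rightarrow> real"
  assumes f: "f \<in> test_functions" and P: "continuous_on UNIV P"
  shows "isCont (heis_convolution f P) 0"
proof -
  let ?S = "support_closure f"
  let ?m = "\<lambda>q :: 'n heis \<times> 'n heis. P (heis_mult (- fst q) (snd q))"
  have m: "continuous_on T ?m" for T
  proof -
    have "continuous_on T (\<lambda>q :: 'n heis \<times> 'n heis. (\<lambda>r. heis_mult (fst r) (snd r)) (- fst q, snd q))"
      by (rule continuous_on_compose2[OF continuous_heis_mult[of UNIV]]) (auto intro!: continuous_intros)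
    then show ?thesis by (intro continuous_on_compose2[OF P]) auto
  qed
  have "compact (?S \<times> (cball 0 1 :: 'n heis set))" by (intro compact_Times test_functions_D(2)[OF f] compact_cball)
  then have "bounded (?m ` (?S \<times> cball 0 1))"
    by (intro compact_imp_bounded compact_continuous_image m)
  then obtain M where M: "\<And>k g. k \<in> ?S \<Longrightarrow> g \<in> cball 0 1 \<Longrightarrow> \<bar>P (heis_mult (- k) g)\<bar> \<le> M"
    by (force simp: bounded_iff)
  have "continuous_on (ball 0 1) (heis_convolution f P)"
    unfolding heis_convolution_def[abs_def]
  proof (rule continuous_on_integral_dominated[where w="\<lambda>k. \<bar>f k\<bar> * M"])
    show "integrable lborel (\<lambda>k. \<bar>f k\<bar> * M)"
      by (intro integrable_mult_left integrable_abs test_function_integrable f)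
    show "continuous_on (ball 0 1) (\<lambda>g. f k * P (heis_mult (- k) g))" for k
    proof -
      have "continuous_on (ball 0 1) (\<lambda>g. ?m (k, g))"
        by (rule continuous_on_compose2[OF m[of UNIV]]) (auto intro!: continuous_intros)
      then show ?thesis by (intro continuous_intros) simp
    qed
    show "(\<lambda>k. f k * P (heis_mult (- k) g)) \<in> borel_measurable lborel" for g
    proof -
      have "continuous_on UNIV (\<lambda>k. ?m (k, g))"
        by (rule continuous_on_compose2[OF m[of UNIV]]) (auto intro!: continuous_intros)
      then have "continuous_on UNIV (\<lambda>k. f k * P (heis_mult (- k) g))"
        using smooth_continuous[OF test_functions_D(1)[OF f]] by (intro continuous_on_mult) simp_all
      then show ?thesis by (simp add: borel_measurable_continuous_onI)
    qed
    show "\<bar>f k * P (heis_mult (- k) g)\<bar> \<le> \<bar>f k\<bar> * M" if "g \<in> ball 0 1" for g k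
      using M[of k g] that not_in_support[of k f] by (cases "k \<in> ?S") (auto simp: abs_mult intro!: mult_left_mono)
  qed
  then show ?thesis by (simp add: continuous_on_eq_continuous_at)
qed

text \<open>The limit of \<open>\<mu>\<^sup>n mehler_v\<close> as \<open>\<mu> \<rightarrow> \<infinity>\<close>, that is, as the initial Gaussian shrinks to a point.\<close>

definition heat_profile :: "nat \<Rightarrow> real \<Rightarrow> real \<Rightarrow> real \<Rightarrow> real" where
  "heat_profile n h \<omega> r = (\<omega> / sinh (4 * \<omega> * h)) ^ n * exp (- (\<omega> * cosh (4 * \<omega> * h) / sinh (4 * \<omega> * h)) * r)"

definition heat_formula :: "real \<Rightarrow> 'n::finite heis \<Rightarrow> real" where
  "heat_formula h g = (LINT \<omega>|lborel. indicator {0<..} \<omega> * (cos (\<omega> * vert g) * heat_profile CARD('n) h \<omega> (horiz g)))"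

lemma borel_heat_profile [measurable (raw)]:
  fixes f r k :: "'a \<Rightarrow> real"
  assumes "f \<in> borel_measurable M" "r \<in> borel_measurable M" "k \<in> borel_measurable M"
  shows "(\<lambda>x. heat_profile n (k x) (f x) (r x)) \<in> borel_measurable M"
  unfolding heat_profile_def using assms by measurable

lemma inverse_sinh_bound:
  fixes x :: real
  assumes "x > 0" shows "x / sinh x \<le> 4 * exp (- x / 2)"
proof -
  have "1 + x / 2 \<le> exp (x / 2)" by (rule exp_ge_add_one_self)
  moreover have "exp (- (3 * x / 2)) \<le> 1" using assms by simp
  ultimately have "2 * ((1 + x / 2) - 1) \<le> 2 * (exp (x / 2) - exp (- (3 * x / 2)))"
    by (intro mult_left_mono diff_mono) auto
  then have "x \<le> 2 * (exp (x / 2) - exp (- (3 * x / 2)))" by simp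
  also have "\<dots> = 4 * exp (- x / 2) * sinh x"
    by (simp add: sinh_def right_diff_distrib exp_add[symmetric])
  finally show ?thesis using assms by (simp add: divide_le_eq)
qed

lemma frequency_factor_bound:
  fixes \<omega> h :: real
  assumes "\<omega> > 0" "h > 0" "n \<ge> 1"
  shows "0 < \<omega> / sinh (4 * \<omega> * h)" "(\<omega> / sinh (4 * \<omega> * h)) ^ n \<le> (1 / h) ^ n * exp (- (2 * h) * \<omega>)"
proof -
  have s: "0 < sinh (4 * \<omega> * h)" using assms by simp
  show pos: "0 < \<omega> / sinh (4 * \<omega> * h)" using assms s by simp
  have "4 * h * (\<omega> / sinh (4 * \<omega> * h)) \<le> 4 * exp (- (4 * \<omega> * h) / 2)"
    using inverse_sinh_bound[of "4 * \<omega> * h"] assms by (simp add: mult_ac)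
  then have "\<omega> / sinh (4 * \<omega> * h) \<le> (1 / h) * exp (- (2 * h) * \<omega>)"
    using assms by (simp add: field_simps)
  then have "(\<omega> / sinh (4 * \<omega> * h)) ^ n \<le> ((1 / h) * exp (- (2 * h) * \<omega>)) ^ n"
    using pos by (intro power_mono) auto
  also have "\<dots> = (1 / h) ^ n * exp (- (2 * h) * \<omega>) ^ n" by (rule power_mult_distrib)
  also have "\<dots> \<le> (1 / h) ^ n * exp (- (2 * h) * \<omega>) ^ 1"
    using assms by (intro mult_left_mono power_decreasing) auto
  finally show "(\<omega> / sinh (4 * \<omega> * h)) ^ n \<le> (1 / h) ^ n * exp (- (2 * h) * \<omega>)" by simp
qed

lemma heat_profile_bound:
  assumes "\<omega> > 0" "h > 0" "r \<ge> 0" "n \<ge> 1"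
  shows "0 < heat_profile n h \<omega> r" "heat_profile n h \<omega> r \<le> (1 / h) ^ n * exp (- (2 * h) * \<omega>)"
proof -
  note q = frequency_factor_bound[OF assms(1,2,4)]
  have c: "0 \<le> \<omega> * cosh (4 * \<omega> * h) / sinh (4 * \<omega> * h)" using assms by (simp add: less_imp_le cosh_real_pos)
  show "0 < heat_profile n h \<omega> r" using q(1) by (simp add: heat_profile_def)
  have "heat_profile n h \<omega> r \<le> (\<omega> / sinh (4 * \<omega> * h)) ^ n * 1"
    unfolding heat_profile_def using q(1) mult_nonneg_nonneg[OF c assms(3)] by (intro mult_left_mono) auto
  with q(2) show "heat_profile n h \<omega> r \<le> (1 / h) ^ n * exp (- (2 * h) * \<omega>)" by simp
qed

lemma mehler_v_le_factor:
  assumes "\<omega> > 0" "h > 0" "\<mu> > 0" "r \<ge> 0"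
  shows "0 \<le> \<mu> ^ n * mehler_v n \<omega> \<mu> r h" "\<mu> ^ n * mehler_v n \<omega> \<mu> r h \<le> (\<omega> / sinh (4 * \<omega> * h)) ^ n"
proof -
  have s: "0 < sinh (4 * \<omega> * h)" using assms by simp
  have w: "\<mu> * (sinh (4 * \<omega> * h) / \<omega>) \<le> mehler_w \<omega> \<mu> h"
    by (simp add: mehler_w_def cosh_real_pos less_imp_le)
  have pos: "0 < \<mu> * (sinh (4 * \<omega> * h) / \<omega>)" using s assms by simp
  have "0 \<le> mehler_m \<omega> \<mu> h"
    using mehler_m_bounds(1)[OF assms(1,3), of h h] assms
    by (smt (verit) divide_nonneg_nonneg mult_nonneg_nonneg)
  then have "exp (- mehler_m \<omega> \<mu> h * r) \<le> 1" using assms(4) by (simp add: mult_nonneg_nonneg)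
  then have "mehler_v n \<omega> \<mu> r h \<le> 1 / (\<mu> * (sinh (4 * \<omega> * h) / \<omega>)) ^ n"
    unfolding mehler_v_def using w pos by (intro frac_le power_mono) auto
  then have "\<mu> ^ n * mehler_v n \<omega> \<mu> r h \<le> \<mu> ^ n * (1 / (\<mu> * (sinh (4 * \<omega> * h) / \<omega>)) ^ n)"
    using assms by (intro mult_left_mono) auto
  also have "\<dots> = (\<omega> / sinh (4 * \<omega> * h)) ^ n"
    using assms s by (simp add: power_mult_distrib power_divide)
  finally show "\<mu> ^ n * mehler_v n \<omega> \<mu> r h \<le> (\<omega> / sinh (4 * \<omega> * h)) ^ n" .
  show "0 \<le> \<mu> ^ n * mehler_v n \<omega> \<mu> r h" using order_less_le_trans[OF pos w] assms by (simp add: mehler_v_def)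
qed

lemma mehler_v_tendsto_heat_profile:
  assumes "\<omega> > 0" "h > 0"
  shows "(\<lambda>k. real (Suc k) ^ n * mehler_v n \<omega> (real (Suc k)) r h) \<longlonglongrightarrow> heat_profile n h \<omega> r"
proof -
  let ?C = "cosh (4 * \<omega> * h)" and ?S = "sinh (4 * \<omega> * h)"
  have s: "0 < ?S" using assms by simp
  define W where "W k = ?C / real (Suc k) + ?S / \<omega>" for k
  define N where "N k = ?C + \<omega> * ?S / real (Suc k)" for k
  have Wpos: "W k > 0" for k using s assms by (simp add: W_def add_nonneg_pos cosh_real_pos less_imp_le)
  have w: "mehler_w \<omega> (real (Suc k)) h = real (Suc k) * W k" for k
    by (simp add: mehler_w_def W_def distrib_left)
  have m: "mehler_m \<omega> (real (Suc k)) h = N k / W k" for k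
  proof -
    have "real (Suc k) * ?C + \<omega> * ?S = real (Suc k) * N k" by (simp add: N_def distrib_left)
    then show ?thesis unfolding mehler_m_def w by simp
  qed
  have v: "real (Suc k) ^ n * mehler_v n \<omega> (real (Suc k)) r h = exp (- (N k / W k) * r) / W k ^ n" for k
    unfolding mehler_v_def m w by (simp add: power_mult_distrib)
  have "W \<longlonglongrightarrow> 0 + ?S / \<omega>" unfolding W_def
    by (intro tendsto_intros LIMSEQ_Suc[OF lim_const_over_n])
  moreover have "N \<longlonglongrightarrow> ?C + 0" unfolding N_def
    by (intro tendsto_intros LIMSEQ_Suc[OF lim_const_over_n])
  ultimately have "(\<lambda>k. exp (- (N k / W k) * r) / W k ^ n) \<longlonglongrightarrow> exp (- ((?C + 0) / (0 + ?S / \<omega>)) * r) / (0 + ?S / \<omega>) ^ n"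
    using s assms by (intro tendsto_intros) auto
  also have "exp (- ((?C + 0) / (0 + ?S / \<omega>)) * r) / (0 + ?S / \<omega>) ^ n = heat_profile n h \<omega> r"
    using s assms by (simp add: heat_profile_def power_divide mult.commute)
  finally show ?thesis unfolding v .
qed

lemma frequency_dominant_integrable:
  fixes h :: real
  assumes "h > 0"
  shows "integrable lborel (\<lambda>\<omega>. indicator {0<..} \<omega> * ((1 / h) ^ n * exp (- (2 * h) * \<omega>)))"
proof -
  have "integrable lborel (\<lambda>\<omega>. (1 / h) ^ n * (indicator {0<..} \<omega> * exp (- (2 * h) * \<omega>)))"
    by (intro integrable_mult_right integrable_exp_decay) (use assms in simp)
  then show ?thesis by (simp add: mult_ac)
qed

lemma heat_formula_continuous: assumes "h > 0" shows "continuous_on UNIV (heat_formula h :: 'n::finite heis \<Rightarrow> real)"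
  unfolding heat_formula_def[abs_def]
proof (rule continuous_on_integral_dominated[OF _ _ _ frequency_dominant_integrable[OF assms, of "CARD('n)"]])
  fix \<omega> :: real
  show "continuous_on UNIV (\<lambda>g::'n heis. indicator {0<..} \<omega> * (cos (\<omega> * vert g) * heat_profile CARD('n) h \<omega> (horiz g)))"
    unfolding heat_profile_def by (intro continuous_intros continuous_vert continuous_horiz)
next
  fix g :: "'n heis" and \<omega> :: real
  have "\<bar>cos (\<omega> * vert g) * heat_profile CARD('n) h \<omega> (horiz g)\<bar> \<le> 1 * ((1 / h) ^ CARD('n) * exp (- (2 * h) * \<omega>))" if "\<omega> > 0"
    unfolding abs_mult using heat_profile_bound[OF that assms horiz_nonneg, of "CARD('n)" g]
    by (intro mult_mono) auto
  then show "\<bar>indicator {0<..} \<omega> * (cos (\<omega> * vert g) * heat_profile CARD('n) h \<omega> (horiz g))\<bar>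
      \<le> indicator {0<..} \<omega> * ((1 / h) ^ CARD('n) * exp (- (2 * h) * \<omega>))"
    by (auto simp: indicator_def)
qed measurable

text \<open>Both sides of \<open>superposed_identity\<close>, multiplied by \<open>\<mu>\<^sup>n\<close>, converge as \<open>\<mu> \<rightarrow> \<infinity>\<close>: the left by the
  approximate identity, the right by domination through \<open>mehler_v_le_factor\<close>.\<close>

lemma heat_semigroup_at_zero:
  fixes f :: "'n::finite heis \<Rightarrow> real"
  assumes T: "heat_semigroup T" and f: "f \<in> test_functions" and h: "0 < h"
    and W: "AE g in lborel. T h f g = W g" "isCont W 0"
  shows "identity_mass TYPE('n) * W 0 = (LINT g|lborel. f g * heat_formula h g)"
proof -
  let ?n = "CARD('n)"
  define \<mu> where "\<mu> k = real (Suc k)" for k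
  define \<delta> where "\<delta> k = 1 / real (Suc k) ^ (?n + 1)" for k
  have \<mu>: "\<mu> k > 0" and \<delta>: "\<delta> k > 0" for k by (simp_all add: \<mu>_def \<delta>_def)
  have fL2: "f \<in> L2" using f by (rule test_function_L2)
  note [measurable] = L2_D(2)[OF fL2]
  have V: "T h f \<in> L2" using heat_semigroup_D[OF T _ fL2] h by simp
  define A where "A k q = indicator {0<..} (fst q) * (exp (- \<delta> k * fst q)
      * (f (snd q) * (cos (fst q * vert (snd q)) * (\<mu> k ^ ?n * mehler_v ?n (fst q) (\<mu> k) (horiz (snd q)) h))))"
    for k and q :: "real \<times> 'n heis"
  define A0 where "A0 q = indicator {0<..} (fst q) * (f (snd q) * (cos (fst q * vert (snd q)) * heat_profile ?n h (fst q) (horiz (snd q))))"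
    for q :: "real \<times> 'n heis"
  define b where "b \<omega> = indicator {0<..} \<omega> * ((1 / h) ^ ?n * exp (- (2 * h) * \<omega>))" for \<omega>
  have b_int: "integrable lborel b" unfolding b_def by (rule frequency_dominant_integrable[OF h])
  have dom_int: "integrable lborel (\<lambda>q. b (fst q) * \<bar>f (snd q)\<bar>)"
    by (rule integral_lborel_product(1)[OF b_int integrable_abs[OF test_function_integrable[OF f]]])
  have lhs: "(\<lambda>k. \<mu> k ^ ?n * (LINT g|lborel. T h f g * (exp (- \<mu> k * horiz g) * poisson (\<delta> k) (vert g))))
      \<longlonglongrightarrow> identity_mass TYPE('n) * W 0"
    using gaussian_poisson_approximate_identity[OF V W] unfolding \<mu>_def \<delta>_def .
  have rhs: "\<mu> k ^ ?n * (LINT g|lborel. T h f g * (exp (- \<mu> k * horiz g) * poisson (\<delta> k) (vert g))) = (LINT q|lborel. A k q)" for k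
    unfolding superposed_identity[OF T f h \<mu> \<delta>] integral_mult_right_zero[symmetric]
    by (intro Bochner_Integration.integral_cong) (simp_all add: A_def mult_ac)
  have A_lim: "(\<lambda>k. LINT q|lborel. A k q) \<longlonglongrightarrow> (LINT q|lborel. A0 q)"
  proof (rule integral_dominated_convergence[OF _ _ dom_int])
    show "A0 \<in> borel_measurable lborel" unfolding A0_def[abs_def] by measurable
    show "A k \<in> borel_measurable lborel" for k unfolding A_def[abs_def] by measurable
    show "AE q in lborel. (\<lambda>k. A k q) \<longlonglongrightarrow> A0 q"
    proof (rule AE_I2)
      fix q :: "real \<times> 'n heis"
      show "(\<lambda>k. A k q) \<longlonglongrightarrow> A0 q"
      proof (cases "fst q > 0")
        case True
        have d0: "\<delta> \<longlonglongrightarrow> 0"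
        proof -
          have "(\<lambda>k. (1 / real (Suc k)) ^ (?n + 1)) \<longlonglongrightarrow> 0 ^ (?n + 1)"
            by (intro tendsto_power LIMSEQ_Suc[OF lim_const_over_n])
          then show ?thesis by (simp add: \<delta>_def[abs_def] power_divide)
        qed
        have "(\<lambda>k. A k q) \<longlonglongrightarrow> indicator {0<..} (fst q) * (exp (- 0 * fst q)
            * (f (snd q) * (cos (fst q * vert (snd q)) * heat_profile ?n h (fst q) (horiz (snd q)))))"
          unfolding A_def using mehler_v_tendsto_heat_profile[OF True h, of ?n "horiz (snd q)"]
          by (intro tendsto_intros d0) (simp add: \<mu>_def)
        then show ?thesis by (simp add: A0_def)
      qed (simp add: A_def A0_def)
    qed
    show "AE q in lborel. norm (A k q) \<le> b (fst q) * \<bar>f (snd q)\<bar>" for k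
    proof (rule AE_I2)
      fix q :: "real \<times> 'n heis"
      show "norm (A k q) \<le> b (fst q) * \<bar>f (snd q)\<bar>"
      proof (cases "fst q > 0")
        case True
        define v where "v = \<mu> k ^ ?n * mehler_v ?n (fst q) (\<mu> k) (horiz (snd q)) h"
        have v: "0 \<le> v" "v \<le> (1 / h) ^ ?n * exp (- (2 * h) * fst q)"
          using mehler_v_le_factor[OF True h \<mu>[of k] horiz_nonneg, of ?n "snd q"] frequency_factor_bound(2)[OF True h, of ?n]
          by (auto simp: v_def)
        have e: "exp (- \<delta> k * fst q) \<le> 1" using True \<delta>[of k] by simp
        have "A k q = exp (- \<delta> k * fst q) * (f (snd q) * (cos (fst q * vert (snd q)) * v))"
          using True by (simp add: A_def v_def)
        then have "norm (A k q) = exp (- \<delta> k * fst q) * (\<bar>f (snd q)\<bar> * (\<bar>cos (fst q * vert (snd q))\<bar> * v))"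
          using v(1) by (simp add: abs_mult)
        also have "\<dots> \<le> 1 * (\<bar>f (snd q)\<bar> * (1 * ((1 / h) ^ ?n * exp (- (2 * h) * fst q))))"
          using v e by (intro mult_mono) auto
        finally show ?thesis using True by (simp add: b_def mult_ac)
      qed (simp add: A_def b_def)
    qed
  qed
  have A0_int: "integrable lborel A0"
  proof (rule Bochner_Integration.integrable_bound[OF dom_int])
    show "A0 \<in> borel_measurable lborel" unfolding A0_def[abs_def] by measurable
    show "AE q in lborel. norm (A0 q) \<le> norm (b (fst q) * \<bar>f (snd q)\<bar>)"
    proof (rule AE_I2)
      fix q :: "real \<times> 'n heis"
      show "norm (A0 q) \<le> norm (b (fst q) * \<bar>f (snd q)\<bar>)"
      proof (cases "fst q > 0")
        case True
        note v = heat_profile_bound[OF True h horiz_nonneg, of ?n "snd q"]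
        have "norm (A0 q) = \<bar>f (snd q)\<bar> * (\<bar>cos (fst q * vert (snd q))\<bar> * heat_profile ?n h (fst q) (horiz (snd q)))"
          using True v by (simp add: A0_def abs_mult)
        also have "\<dots> \<le> \<bar>f (snd q)\<bar> * (1 * ((1 / h) ^ ?n * exp (- (2 * h) * fst q)))"
          using v by (intro mult_mono) auto
        finally show ?thesis using True h by (simp add: b_def mult_ac abs_mult)
      qed (simp add: A0_def b_def)
    qed
  qed
  have "identity_mass TYPE('n) * W 0 = (LINT q|lborel. A0 q)"
    using LIMSEQ_unique[OF lhs[unfolded rhs] A_lim] .
  also have "\<dots> = (LINT g|lborel. LINT \<omega>|lborel. A0 (\<omega>, g))"
    using integral_swap_lborel(2)[of "\<lambda>\<omega> g. A0 (\<omega>, g)"] A0_int by simp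
  also have "\<dots> = (LINT g|lborel. f g * heat_formula h g)"
    unfolding heat_formula_def integral_mult_right_zero[symmetric]
    by (intro Bochner_Integration.integral_cong) (auto simp: A0_def mult_ac)
  finally show ?thesis .
qed

text \<open>The convolution with \<open>p\<^sub>h\<close> evaluated at the identity is the pairing with \<open>k \<mapsto> p\<^sub>h(-k)\<close>, so
  \<open>heat_semigroup_at_zero\<close> determines the kernel tested against all test functions.\<close>

lemma heat_kernel_eq_formula:
  fixes p :: "real \<Rightarrow> 'n::finite heis \<Rightarrow> real"
  assumes p: "heat_kernel p" and h: "h > 0"
  shows "identity_mass TYPE('n) * p h (- g) = heat_formula h g"
proof -
  obtain T where T: "heat_semigroup T" and conv: "\<And>f. f \<in> test_functions \<Longrightarrow> AE g in lborel. T h f g = heis_convolution f (p h) g"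
    and smooth: "smooth (p h)" using p h unfolding heat_kernel_def by blast
  have pc: "continuous_on UNIV (p h)" using smooth by (rule smooth_continuous)
  let ?D = "\<lambda>g. identity_mass TYPE('n) * p h (- g) - heat_formula h g"
  have "?D g = 0"
  proof (rule continuous_eq_if_integrals_eq[where f="?D"])
    have pm: "continuous_on UNIV (\<lambda>g. p h (- g))"
      by (rule continuous_on_compose2[OF pc]) (auto intro!: continuous_intros)
    then show "continuous_on UNIV ?D" by (intro continuous_intros heat_formula_continuous h)
    fix f :: "'n heis \<Rightarrow> real" assume f: "f \<in> test_functions"
    have f_cont: "continuous_on UNIV f" using smooth_continuous[OF test_functions_D(1)[OF f]] .
    have int: "integrable lborel (\<lambda>g. f g * u g)" if "continuous_on UNIV u" for u
      by (rule compactly_supported_integrable[OF continuous_on_mult[OF f_cont that] test_functions_D(2)[OF f]])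
         (simp add: not_in_support)
    have "identity_mass TYPE('n) * heis_convolution f (p h) 0 = (LINT g|lborel. f g * heat_formula h g)"
      by (rule heat_semigroup_at_zero[OF T f h conv[OF f] heis_convolution_continuous[OF f pc]])
    moreover have "identity_mass TYPE('n) * heis_convolution f (p h) 0 = (LINT g|lborel. f g * (identity_mass TYPE('n) * p h (- g)))"
      unfolding heis_convolution_def integral_mult_right_zero[symmetric]
      by (intro Bochner_Integration.integral_cong) (simp_all add: mult_ac)
    ultimately show "(LINT g|lborel. f g * ?D g) = 0"
      unfolding right_diff_distrib
      by (subst Bochner_Integration.integral_diff) (auto intro!: int continuous_intros pm heat_formula_continuous h)
  qed
  then show ?thesis by simp
qed

lemma heat_formula_uminus: "heat_formula h (- g) = heat_formula h g"
  unfolding heat_formula_def by (cases g) (simp add: horiz_def vert_def)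

section \<open>Derivatives of the heat kernel\<close>

text \<open>The rate \<open>\<omega> coth 4\<omega>h\<close> of the Gaussian in the heat kernel.\<close>

definition heat_kappa :: "real \<Rightarrow> real \<Rightarrow> real" where
  "heat_kappa h \<omega> = \<omega> * cosh (4 * \<omega> * h) / sinh (4 * \<omega> * h)"

lemma heat_profile_kappa: "heat_profile n h \<omega> r = (\<omega> / sinh (4 * \<omega> * h)) ^ n * exp (- heat_kappa h \<omega> * r)"
  by (simp add: heat_profile_def heat_kappa_def)

lemma borel_heat_kappa [measurable (raw)]:
  fixes f k :: "'a \<Rightarrow> real"
  assumes "f \<in> borel_measurable M" "k \<in> borel_measurable M"
  shows "(\<lambda>x. heat_kappa (k x) (f x)) \<in> borel_measurable M"
  unfolding heat_kappa_def using assms by measurable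

lemma sinh_ge_arg: "0 \<le> (x::real) \<Longrightarrow> x \<le> sinh x"
proof (rule DERIV_nonneg_imp_nondecreasing[of 0 x "\<lambda>x. sinh x - x", simplified], goal_cases)
  case (2 y)
  then show ?case by (intro exI[of _ "cosh y - 1"]) (auto intro!: derivative_eq_intros simp: cosh_real_ge_1)
qed simp

text \<open>Both lower bounds matter: \<open>\<kappa> \<ge> \<omega>\<close> gives decay at high frequency and room for complex \<open>t\<close>, while
  \<open>\<kappa> \<ge> 1/4h\<close> gives decay for short times.\<close>

lemma heat_kappa_bounds:
  assumes "\<omega> > 0" "h > 0"
  shows "\<omega> \<le> heat_kappa h \<omega>" "1 / (4 * h) \<le> heat_kappa h \<omega>" "heat_kappa h \<omega> \<le> \<omega> + 1 / (4 * h)"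
proof -
  define x where "x = 4 * \<omega> * h"
  have x: "x > 0" "\<omega> = x / (4 * h)" using assms by (simp_all add: x_def)
  have s: "sinh x > 0" using x by simp
  have k: "heat_kappa h \<omega> = \<omega> * cosh x / sinh x" by (simp add: heat_kappa_def x_def)
  have "\<omega> * sinh x \<le> \<omega> * cosh x" using sinh_less_cosh_real[of x] assms by (intro mult_left_mono) auto
  then show "\<omega> \<le> heat_kappa h \<omega>" unfolding k using s by (simp add: pos_le_divide_eq)
  have "1 / (4 * h) * sinh x \<le> 1 / (4 * h) * (x * cosh x)"
    using sinh_le_mult_cosh[of x] x assms by (intro mult_left_mono) auto
  also have "\<dots> = \<omega> * cosh x" using x by simp
  finally show "1 / (4 * h) \<le> heat_kappa h \<omega>" unfolding k using s by (simp only: pos_le_divide_eq)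
  have "x * (cosh x - sinh x) \<le> x * 1"
    using x by (intro mult_left_mono) (auto simp: cosh_minus_sinh)
  also have "\<dots> \<le> sinh x" using sinh_ge_arg[of x] x by simp
  finally have "1 / (4 * h) * (x * (cosh x - sinh x)) \<le> 1 / (4 * h) * sinh x"
    using assms by (intro mult_left_mono) auto
  then have "\<omega> * cosh x \<le> (\<omega> + 1 / (4 * h)) * sinh x" using x by (simp add: algebra_simps)
  then show "heat_kappa h \<omega> \<le> \<omega> + 1 / (4 * h)" unfolding k using s by (simp only: pos_divide_le_eq)
qed

lemma frequency_derivative_bound:
  assumes "\<omega> > 0" "h > 0" "r \<ge> 0" "n \<ge> 1" "\<bar>c\<bar> \<le> A * (1 + \<omega>)"
  shows "\<bar>c * heat_profile n h \<omega> r\<bar> \<le> A * (1 / h) ^ n * ((1 + \<omega>) * exp (- (2 * h) * \<omega>))"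
proof -
  note p = heat_profile_bound[OF assms(1-4)]
  have "\<bar>c * heat_profile n h \<omega> r\<bar> = \<bar>c\<bar> * heat_profile n h \<omega> r" using p by (simp add: abs_mult)
  also have "\<dots> \<le> A * (1 + \<omega>) * ((1 / h) ^ n * exp (- (2 * h) * \<omega>))" using p assms by (intro mult_mono) auto
  finally show ?thesis by (simp add: mult_ac)
qed

lemma integrable_frequency:
  assumes "h > 0" "r \<ge> 0" "n \<ge> 1" "c \<in> borel_measurable borel" "\<And>\<omega>. \<omega> > 0 \<Longrightarrow> \<bar>c \<omega>\<bar> \<le> A * (1 + \<omega>)"
  shows "integrable lborel (\<lambda>\<omega>. indicator {0<..} \<omega> * (c \<omega> * heat_profile n h \<omega> r))"
proof (rule Bochner_Integration.integrable_bound)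
  show "integrable lborel (\<lambda>\<omega>. A * (1 / h) ^ n * (indicator {0<..} \<omega> * ((1 + \<omega>) * exp (- (2 * h) * \<omega>))))"
    by (intro integrable_mult_right integrable_linear_exp_decay) (use assms in simp)
  show "(\<lambda>\<omega>. indicator {0<..} \<omega> * (c \<omega> * heat_profile n h \<omega> r)) \<in> borel_measurable lborel"
    using assms(4) by measurable
  show "AE \<omega> in lborel. norm (indicator {0<..} \<omega> * (c \<omega> * heat_profile n h \<omega> r))
      \<le> norm (A * (1 / h) ^ n * (indicator {0<..} \<omega> * ((1 + \<omega>) * exp (- (2 * h) * \<omega>))))"
  proof (rule AE_I2)
    fix \<omega> :: real
    show "norm (indicator {0<..} \<omega> * (c \<omega> * heat_profile n h \<omega> r))
      \<le> norm (A * (1 / h) ^ n * (indicator {0<..} \<omega> * ((1 + \<omega>) * exp (- (2 * h) * \<omega>))))"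
    proof (cases "\<omega> > 0")
      case True
      from frequency_derivative_bound[OF True assms(1-3) assms(5)[OF True]] True show ?thesis by simp
    qed simp
  qed
qed

lemma heat_formula_horizontal_derivative:
  assumes h: "h > 0" and n: "n \<ge> 1" and r: "\<And>s. 0 \<le> \<rho> + 2 * s * a + s\<^sup>2"
  shows "((\<lambda>s. LINT \<omega>|lborel. indicator {0<..} \<omega> * (cos (\<omega> * t) * heat_profile n h \<omega> (\<rho> + 2 * s * a + s\<^sup>2)))
    has_real_derivative (LINT \<omega>|lborel. indicator {0<..} \<omega> * ((- 2 * a * heat_kappa h \<omega> * cos (\<omega> * t)) * heat_profile n h \<omega> \<rho>))) (at 0)"
proof -
  let ?r = "\<lambda>s. \<rho> + 2 * s * a + s\<^sup>2"
  let ?f' = "\<lambda>s \<omega>. indicator {0<..} \<omega> * ((cos (\<omega> * t) * (- heat_kappa h \<omega> * (2 * a + 2 * s))) * heat_profile n h \<omega> (?r s))"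
  let ?A = "(2 * \<bar>a\<bar> + 2) * (1 + 1 / (4 * h))"
  have "((\<lambda>s. LINT \<omega>|lborel. indicator {0<..} \<omega> * (cos (\<omega> * t) * heat_profile n h \<omega> (?r s)))
    has_real_derivative (LINT \<omega>|lborel. ?f' 0 \<omega>)) (at 0)"
  proof (rule has_field_derivative_integral[where S="{-1<..<1::real}" and f'="?f'"
        and g="\<lambda>\<omega>. ?A * (1 / h) ^ n * (indicator {0<..} \<omega> * ((1 + \<omega>) * exp (- (2 * h) * \<omega>)))"])
    show "integrable lborel (\<lambda>\<omega>. indicator {0<..} \<omega> * (cos (\<omega> * t) * heat_profile n h \<omega> (?r s)))" for s
    proof (rule integrable_frequency[OF h r n, where A=1])
      show "\<bar>cos (\<omega> * t)\<bar> \<le> 1 * (1 + \<omega>)" if "\<omega> > 0" for \<omega>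
        by (rule order_trans[OF abs_cos_le_one]) (use that in simp)
    qed measurable
    show "integrable lborel (\<lambda>\<omega>. ?A * (1 / h) ^ n * (indicator {0<..} \<omega> * ((1 + \<omega>) * exp (- (2 * h) * \<omega>))))"
      by (intro integrable_mult_right integrable_linear_exp_decay) (use h in simp)
    show "((\<lambda>s. indicator {0<..} \<omega> * (cos (\<omega> * t) * heat_profile n h \<omega> (?r s))) has_real_derivative ?f' s \<omega>) (at s)" for s \<omega>
      unfolding heat_profile_kappa by (auto intro!: derivative_eq_intros simp: algebra_simps)
    show "norm (?f' s \<omega>) \<le> ?A * (1 / h) ^ n * (indicator {0<..} \<omega> * ((1 + \<omega>) * exp (- (2 * h) * \<omega>)))"
      if s: "s \<in> {-1<..<1}" for s \<omega>
    proof (cases "\<omega> > 0")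
      case True
      note k = heat_kappa_bounds[OF True h]
      have k': "0 \<le> heat_kappa h \<omega>" using k(1) True by simp
      have "heat_kappa h \<omega> \<le> (1 + 1 / (4 * h)) * (1 + \<omega>)" using k(3) True h by (simp add: field_simps)
      moreover have "\<bar>2 * a + 2 * s\<bar> \<le> 2 * \<bar>a\<bar> + 2" using s by (auto simp: abs_if)
      ultimately have "\<bar>cos (\<omega> * t)\<bar> * (heat_kappa h \<omega> * \<bar>2 * a + 2 * s\<bar>) \<le> 1 * (((1 + 1 / (4 * h)) * (1 + \<omega>)) * (2 * \<bar>a\<bar> + 2))"
        using k' True h by (intro mult_mono) auto
      then have "\<bar>cos (\<omega> * t) * (- heat_kappa h \<omega> * (2 * a + 2 * s))\<bar> \<le> ?A * (1 + \<omega>)"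
        using k' by (simp only: abs_mult abs_minus abs_of_nonneg mult_ac mult_1_left)
      from frequency_derivative_bound[OF True h r n this] True show ?thesis by simp
    qed simp
  qed (auto, measurable)
  then show ?thesis by (simp add: mult_ac)
qed

lemma heat_formula_vertical_derivative:
  assumes h: "h > 0" and n: "n \<ge> 1" and r: "0 \<le> \<rho>"
  shows "((\<lambda>t. LINT \<omega>|lborel. indicator {0<..} \<omega> * (cos (\<omega> * t) * heat_profile n h \<omega> \<rho>))
    has_real_derivative (LINT \<omega>|lborel. indicator {0<..} \<omega> * ((- \<omega> * sin (\<omega> * t)) * heat_profile n h \<omega> \<rho>))) (at t)"
proof (rule has_field_derivative_integral[where S=UNIV and f'="\<lambda>t \<omega>. indicator {0<..} \<omega> * ((- \<omega> * sin (\<omega> * t)) * heat_profile n h \<omega> \<rho>)"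
        and g="\<lambda>\<omega>. 1 * (1 / h) ^ n * (indicator {0<..} \<omega> * ((1 + \<omega>) * exp (- (2 * h) * \<omega>)))"])
  show "integrable lborel (\<lambda>\<omega>. indicator {0<..} \<omega> * (cos (\<omega> * t) * heat_profile n h \<omega> \<rho>))" for t
  proof (rule integrable_frequency[OF h r n, where A=1])
    show "\<bar>cos (\<omega> * t)\<bar> \<le> 1 * (1 + \<omega>)" if "\<omega> > 0" for \<omega>
        by (rule order_trans[OF abs_cos_le_one]) (use that in simp)
  qed measurable
  show "integrable lborel (\<lambda>\<omega>. 1 * (1 / h) ^ n * (indicator {0<..} \<omega> * ((1 + \<omega>) * exp (- (2 * h) * \<omega>))))"
    by (intro integrable_mult_right integrable_linear_exp_decay) (use h in simp)
  show "((\<lambda>t. indicator {0<..} \<omega> * (cos (\<omega> * t) * heat_profile n h \<omega> \<rho>)) has_real_derivative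
      indicator {0<..} \<omega> * ((- \<omega> * sin (\<omega> * t)) * heat_profile n h \<omega> \<rho>)) (at t)" for t \<omega>
    by (auto intro!: derivative_eq_intros)
  show "norm (indicator {0<..} \<omega> * ((- \<omega> * sin (\<omega> * t)) * heat_profile n h \<omega> \<rho>))
      \<le> 1 * (1 / h) ^ n * (indicator {0<..} \<omega> * ((1 + \<omega>) * exp (- (2 * h) * \<omega>)))" for t \<omega>
  proof (cases "\<omega> > 0")
    case True
    have "\<bar>- \<omega> * sin (\<omega> * t)\<bar> \<le> \<omega> * 1" unfolding abs_mult using True by (intro mult_mono) auto
    then have "\<bar>- \<omega> * sin (\<omega> * t)\<bar> \<le> 1 * (1 + \<omega>)" by simp
    from frequency_derivative_bound[OF True h r n this] True show ?thesis by simp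
  qed simp
qed (auto, measurable)

definition heis_coord :: "'n::finite + 'n \<Rightarrow> 'n heis \<Rightarrow> real" where
  "heis_coord j g = (case j of Inl i \<Rightarrow> fst g $ i | Inr i \<Rightarrow> fst (snd g) $ i)"

lemma heis_field_heat_formula:
  fixes g :: "'n::finite heis"
  assumes h: "h > 0"
  shows "heis_field j (\<lambda>g. c * heat_formula h g) g = c * (LINT \<omega>|lborel. indicator {0<..} \<omega> *
    ((- 2 * heis_coord j g * heat_kappa h \<omega> * cos (\<omega> * vert g) - heis_slope j g * \<omega> * sin (\<omega> * vert g))
      * heat_profile CARD('n) h \<omega> (horiz g)))"
proof (cases g)
  case (fields x y t)
  let ?n = "CARD('n)" and ?\<rho> = "horiz g"
  let ?H = "\<lambda>a. LINT \<omega>|lborel. indicator {0<..} \<omega> * ((- 2 * a * heat_kappa h \<omega> * cos (\<omega> * t)) * heat_profile ?n h \<omega> ?\<rho>)"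
  let ?V = "LINT \<omega>|lborel. indicator {0<..} \<omega> * ((- \<omega> * sin (\<omega> * t)) * heat_profile ?n h \<omega> ?\<rho>)"
  have n: "1 \<le> ?n" by simp
  have ip: "(x + s *\<^sub>R axis i 1) \<bullet> (x + s *\<^sub>R axis i 1) = x \<bullet> x + 2 * s * (x $ i) + s\<^sup>2" for x :: "real^'n" and s i
    by (simp add: inner_add_left inner_add_right inner_axis inner_axis' algebra_simps power2_eq_square)
  have V: "deriv (\<lambda>s. c * heat_formula h (x, y, s)) t = c * ?V"
    using DERIV_imp_deriv[OF DERIV_cmult[OF heat_formula_vertical_derivative[OF h n, of ?\<rho> t], of c]]
    by (simp add: heat_formula_def fields)
  have H1: "deriv (\<lambda>s. c * heat_formula h (x + s *\<^sub>R axis i 1, y, t)) 0 = c * ?H (x $ i)" for i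
  proof -
    have eq: "?\<rho> + 2 * s * (x $ i) + s\<^sup>2 = horiz (x + s *\<^sub>R axis i 1, y, t)" for s
      by (simp add: fields ip)
    have "0 \<le> ?\<rho> + 2 * s * (x $ i) + s\<^sup>2" for s unfolding eq by (rule horiz_nonneg)
    from DERIV_imp_deriv[OF DERIV_cmult[OF heat_formula_horizontal_derivative[OF h n this, of t], of c]]
    show ?thesis unfolding eq by (simp add: heat_formula_def vert_def)
  qed
  have H2: "deriv (\<lambda>s. c * heat_formula h (x, y + s *\<^sub>R axis i 1, t)) 0 = c * ?H (y $ i)" for i
  proof -
    have eq: "?\<rho> + 2 * s * (y $ i) + s\<^sup>2 = horiz (x, y + s *\<^sub>R axis i 1, t)" for s
      by (simp add: fields ip)
    have "0 \<le> ?\<rho> + 2 * s * (y $ i) + s\<^sup>2" for s unfolding eq by (rule horiz_nonneg)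
    from DERIV_imp_deriv[OF DERIV_cmult[OF heat_formula_horizontal_derivative[OF h n this, of t], of c]]
    show ?thesis unfolding eq by (simp add: heat_formula_def vert_def)
  qed
  have sum: "c * ?H a + b * (c * ?V) = c * (LINT \<omega>|lborel. indicator {0<..} \<omega> *
    ((- 2 * a * heat_kappa h \<omega> * cos (\<omega> * t) - b * \<omega> * sin (\<omega> * t)) * heat_profile ?n h \<omega> ?\<rho>))" for a b
  proof -
    have 1: "integrable lborel (\<lambda>\<omega>. indicator {0<..} \<omega> * ((- 2 * a * heat_kappa h \<omega> * cos (\<omega> * t)) * heat_profile ?n h \<omega> ?\<rho>))"
    proof (rule integrable_frequency[OF h horiz_nonneg n, where A="2 * \<bar>a\<bar> * (1 + 1 / (4 * h))"])
      fix \<omega> :: real assume \<omega>: "\<omega> > 0"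
      note k = heat_kappa_bounds[OF \<omega> h]
      have k': "0 \<le> heat_kappa h \<omega>" using k(1) \<omega> by simp
      have "heat_kappa h \<omega> \<le> (1 + 1 / (4 * h)) * (1 + \<omega>)" using k(3) \<omega> h by (simp add: field_simps)
      then have "2 * \<bar>a\<bar> * heat_kappa h \<omega> * \<bar>cos (\<omega> * t)\<bar> \<le> 2 * \<bar>a\<bar> * ((1 + 1 / (4 * h)) * (1 + \<omega>)) * 1"
        using k' \<omega> h by (intro mult_mono) auto
      then show "\<bar>- 2 * a * heat_kappa h \<omega> * cos (\<omega> * t)\<bar> \<le> 2 * \<bar>a\<bar> * (1 + 1 / (4 * h)) * (1 + \<omega>)"
        using k' by (simp add: abs_mult mult_ac)
    qed measurable
    have 2: "integrable lborel (\<lambda>\<omega>. indicator {0<..} \<omega> * ((- \<omega> * sin (\<omega> * t)) * heat_profile ?n h \<omega> ?\<rho>))"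
    proof (rule integrable_frequency[OF h horiz_nonneg n, where A=1])
      fix \<omega> :: real assume \<omega>: "\<omega> > 0"
      have "\<bar>- \<omega> * sin (\<omega> * t)\<bar> \<le> \<omega> * 1" unfolding abs_mult using \<omega> by (intro mult_mono) auto
      then show "\<bar>- \<omega> * sin (\<omega> * t)\<bar> \<le> 1 * (1 + \<omega>)" by simp
    qed measurable
    have "?H a + b * ?V = (LINT \<omega>|lborel. indicator {0<..} \<omega> * ((- 2 * a * heat_kappa h \<omega> * cos (\<omega> * t)) * heat_profile ?n h \<omega> ?\<rho>)
        + b * (indicator {0<..} \<omega> * ((- \<omega> * sin (\<omega> * t)) * heat_profile ?n h \<omega> ?\<rho>)))"
      by (subst Bochner_Integration.integral_add[OF 1 integrable_mult_right[OF 2]]) simp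
    also have "\<dots> = (LINT \<omega>|lborel. indicator {0<..} \<omega> *
        ((- 2 * a * heat_kappa h \<omega> * cos (\<omega> * t) - b * \<omega> * sin (\<omega> * t)) * heat_profile ?n h \<omega> ?\<rho>))"
      by (intro Bochner_Integration.integral_cong) (simp_all add: algebra_simps)
    finally have eq: "?H a + b * ?V = (LINT \<omega>|lborel. indicator {0<..} \<omega> *
        ((- 2 * a * heat_kappa h \<omega> * cos (\<omega> * t) - b * \<omega> * sin (\<omega> * t)) * heat_profile ?n h \<omega> ?\<rho>))" .
    have "c * P + b * (c * Q) = c * (P + b * Q)" for P Q :: real by (simp add: algebra_simps)
    then show ?thesis by (simp only: eq)
  qed
  show ?thesis
  proof (cases j)
    case (Inl i)
    have "heis_field j (\<lambda>g. c * heat_formula h g) g = c * ?H (x $ i) + 2 * (y $ i) * (c * ?V)"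
      unfolding Inl fields heis_field.simps V[unfolded fields] H1[unfolded fields] ..
    then show ?thesis unfolding sum by (simp add: Inl fields heis_coord_def heis_slope_def)
  next
    case (Inr i)
    have "heis_field j (\<lambda>g. c * heat_formula h g) g = c * ?H (y $ i) + (- 2 * (x $ i)) * (c * ?V)"
      unfolding Inr fields heis_field.simps V[unfolded fields] H2[unfolded fields] by simp
    then show ?thesis unfolding sum by (simp add: Inr fields heis_coord_def heis_slope_def)
  qed
qed

section \<open>The Riesz kernel along vertical lines\<close>

definition time_weight :: "nat \<Rightarrow> real \<Rightarrow> real \<Rightarrow> real" where
  "time_weight n c h = h powr (- 1 / 2) * ((1 / h) ^ n * ((1 + 1 / h) * exp (- c / h)))"

lemma integrable_powr_tail: "integrable lborel (\<lambda>h::real. indicator {1<..} h * h powr (- 3 / 2))"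
proof -
  have "set_integrable lborel (einterval (ereal 1) \<infinity>) (\<lambda>h::real. h powr (- 3 / 2))"
  proof (rule interval_integral_FTC_nonneg(1)[where F="\<lambda>h. - 2 * h powr (- 1 / 2)"])
    show "((\<lambda>h. - 2 * h powr (- 1 / 2)) has_real_derivative x powr (- 3 / 2)) (at x)" if "ereal 1 < ereal x" for x
      using that by (auto intro!: derivative_eq_intros)
    show "isCont (\<lambda>h. h powr (- 3 / 2)) x" if "ereal 1 < ereal x" for x
      using that by (intro continuous_intros) auto
    have "((\<lambda>h::real. - 2 * h powr (- 1 / 2)) \<longlongrightarrow> - 2 * 1 powr (- 1 / 2)) (at_right 1)"
      by (intro tendsto_intros) auto
    then show "(((\<lambda>h. - 2 * h powr (- 1 / 2)) \<circ> real_of_ereal) \<longlongrightarrow> - 2) (at_right (ereal 1))"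
      by (simp add: ereal_tendsto_simps)
    have "((\<lambda>h::real. - 2 * h powr (- 1 / 2)) \<longlongrightarrow> 0) at_top" by real_asymp
    then show "(((\<lambda>h. - 2 * h powr (- 1 / 2)) \<circ> real_of_ereal) \<longlongrightarrow> 0) (at_left \<infinity>)"
      by (simp add: ereal_tendsto_simps)
  qed (auto intro!: AE_I2)
  then show ?thesis by (simp add: set_integrable_def)
qed

text \<open>For \<open>h \<le> 1\<close> the exponential absorbs all powers of \<open>1/h\<close>; for \<open>h \<ge> 1\<close> the weight decays like
  \<open>h\<^bsup>-3/2\<^esup>\<close>, because \<open>n \<ge> 1\<close>.\<close>

lemma integrable_time_weight:
  assumes c: "c > 0" and n: "n \<ge> 1"
  shows "integrable lborel (\<lambda>h. indicator {0<..} h * time_weight n c h)"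
proof (rule Bochner_Integration.integrable_bound)
  let ?N = "n + 2"
  let ?M = "2 * (real ?N / c) ^ ?N"
  show "integrable lborel (\<lambda>h::real. ?M * indicator {0<..1} h + 2 * (indicator {1<..} h * h powr (- 3 / 2)))"
    by (intro Bochner_Integration.integrable_add integrable_mult_right integrable_powr_tail integrable_real_indicator) auto
  show "(\<lambda>h. indicator {0<..} h * time_weight n c h) \<in> borel_measurable lborel"
    unfolding time_weight_def by measurable
  show "AE h in lborel. norm (indicator {0<..} h * time_weight n c h)
      \<le> norm (?M * indicator {0<..1} h + 2 * (indicator {1<..} h * h powr (- 3 / 2)))"
  proof (rule AE_I2)
    fix h :: real
    consider "h \<le> 0" | "0 < h" "h \<le> 1" | "1 < h" by linarith
    then show "norm (indicator {0<..} h * time_weight n c h)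
      \<le> norm (?M * indicator {0<..1} h + 2 * (indicator {1<..} h * h powr (- 3 / 2)))"
    proof cases
      case 2
      define u where "u = 1 / h"
      have u: "u \<ge> 1" using 2 by (simp add: u_def)
      have "h powr (- 1 / 2) \<le> h powr (- 1)" using 2 by (intro powr_mono') auto
      also have "\<dots> = u" using 2 by (simp add: u_def powr_minus_divide)
      finally have p: "h powr (- 1 / 2) \<le> u" .
      have "(u * (c / real ?N)) ^ ?N \<le> (1 + c * u / real ?N) ^ ?N"
        using c u by (intro power_mono) (auto simp: mult.commute)
      also have "\<dots> \<le> exp (c * u)"
        using c u by (intro exp_ge_one_plus_x_over_n_power_n) (auto intro: order_trans[of _ 0])
      finally have "(u * (c / real ?N)) ^ ?N * exp (- (c * u)) \<le> exp (c * u) * exp (- (c * u))"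
        by (intro mult_right_mono) auto
      then have "(u * (c / real ?N)) ^ ?N * exp (- (c * u)) \<le> 1" by (simp only: exp_minus_inverse)
      then have "(real ?N / c) ^ ?N * ((u * (c / real ?N)) ^ ?N * exp (- (c * u))) \<le> (real ?N / c) ^ ?N * 1"
        using c by (intro mult_left_mono) auto
      moreover have "(real ?N / c) ^ ?N * (u * (c / real ?N)) ^ ?N = u ^ ?N"
        using c by (subst power_mult_distrib[symmetric]) simp
      ultimately have e: "u ^ ?N * exp (- (c * u)) \<le> (real ?N / c) ^ ?N" by (simp only: mult.assoc[symmetric] mult_1_right)
      have "time_weight n c h = h powr (- 1 / 2) * (u ^ n * ((1 + u) * exp (- (c * u))))"
        by (simp add: time_weight_def u_def)
      also have "\<dots> \<le> u * (u ^ n * ((2 * u) * exp (- (c * u))))"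
        using p u by (intro mult_mono) auto
      also have "\<dots> = 2 * (u ^ ?N * exp (- (c * u)))" by (simp add: power_add power2_eq_square)
      also have "\<dots> \<le> ?M" using e by simp
      finally have "time_weight n c h \<le> ?M" .
      moreover have "0 \<le> time_weight n c h" using 2 by (simp add: time_weight_def)
      ultimately show ?thesis using 2 c by simp
    next
      case 3
      have tail: "h powr (- 1 / 2) * (1 / h) = h powr (- 3 / 2)"
        using 3 powr_add[of h "- 1 / 2" "- 1"] by (simp add: powr_minus_divide)
      have "(1 / h) ^ n \<le> (1 / h) ^ 1" using 3 n by (intro power_decreasing) auto
      then have "(1 / h) ^ n * ((1 + 1 / h) * exp (- c / h)) \<le> (1 / h) ^ 1 * (2 * 1)"
        using 3 c by (intro mult_mono) auto
      then have "time_weight n c h \<le> h powr (- 1 / 2) * ((1 / h) ^ 1 * (2 * 1))"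
        unfolding time_weight_def by (intro mult_left_mono) auto
      also have "\<dots> = 2 * (h powr (- 1 / 2) * (1 / h))" by simp
      also have "\<dots> = 2 * h powr (- 3 / 2)" by (simp only: tail)
      finally have "time_weight n c h \<le> 2 * h powr (- 3 / 2)" .
      moreover have "0 \<le> time_weight n c h" using 3 by (simp add: time_weight_def)
      ultimately show ?thesis using 3 by simp
    qed (simp add: indicator_def)
  qed
qed

lemma integrable_quadratic_exp_decay:
  assumes "c > 0"
  shows "integrable lborel (\<lambda>\<omega>::real. indicator {0<..} \<omega> * ((1 + \<omega>)\<^sup>2 * exp (- c * \<omega>)))"
proof (rule Bochner_Integration.integrable_bound)
  show "integrable lborel (\<lambda>\<omega>::real. (1 + 4 / c)\<^sup>2 * (indicator {0<..} \<omega> * exp (- (c / 2) * \<omega>)))"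
    by (intro integrable_mult_right integrable_exp_decay) (use assms in simp)
  show "AE \<omega> in lborel. norm (indicator {0<..} \<omega> * ((1 + \<omega>)\<^sup>2 * exp (- c * \<omega>)))
      \<le> norm ((1 + 4 / c)\<^sup>2 * (indicator {0<..} \<omega> * exp (- (c / 2) * \<omega>)))"
    using polynomial_times_exp_bound[OF assms] by (auto intro!: AE_I2 simp: indicator_def)
qed simp

definition riesz_density :: "nat \<Rightarrow> real \<Rightarrow> real \<Rightarrow> real \<Rightarrow> real" where
  "riesz_density n \<rho> h \<omega> = indicator {0<..} h * (indicator {0<..} \<omega> * (h powr (- 1 / 2) * heat_profile n h \<omega> \<rho>))"

definition riesz_integrand :: "nat \<Rightarrow> real \<Rightarrow> real \<Rightarrow> real \<Rightarrow> real \<Rightarrow> real \<Rightarrow> real \<Rightarrow> real" where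
  "riesz_integrand n a b \<rho> t h \<omega> = riesz_density n \<rho> h \<omega> * (- 2 * a * heat_kappa h \<omega> * cos (\<omega> * t) - b * \<omega> * sin (\<omega> * t))"

lemma borel_riesz_density [measurable (raw)]:
  fixes f k r :: "'a \<Rightarrow> real"
  assumes "f \<in> borel_measurable M" "k \<in> borel_measurable M" "r \<in> borel_measurable M"
  shows "(\<lambda>x. riesz_density n (r x) (k x) (f x)) \<in> borel_measurable M"
  unfolding riesz_density_def using assms by measurable

lemma borel_complex_trig [measurable (raw)]:
  fixes f :: "'a \<Rightarrow> complex"
  assumes "f \<in> borel_measurable M"
  shows "(\<lambda>x. cos (f x)) \<in> borel_measurable M" "(\<lambda>x. sin (f x)) \<in> borel_measurable M"
  using measurable_compose[OF assms borel_measurable_continuous_onI[of cos]]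
    measurable_compose[OF assms borel_measurable_continuous_onI[of sin]]
  by (simp_all add: continuous_on_cos continuous_on_sin continuous_on_id)

lemma norm_trig_le_exp:
  fixes z :: complex
  assumes "\<bar>Im z\<bar> \<le> m"
  shows "norm (cos z) \<le> exp m" "norm (sin z) \<le> exp m"
proof -
  have e: "norm (exp (\<i> * z)) \<le> exp m" "norm (exp (- (\<i> * z))) \<le> exp m" using assms by simp_all
  have "norm (exp (\<i> * z) + exp (- (\<i> * z))) \<le> exp m + exp m"
    by (rule order_trans[OF norm_triangle_ineq add_mono[OF e]])
  then show "norm (cos z) \<le> exp m" by (simp add: cos_exp_eq norm_divide)
  have "norm (exp (\<i> * z) - exp (- (\<i> * z))) \<le> exp m + exp m"
    by (rule order_trans[OF norm_triangle_ineq4 add_mono[OF e]])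
  then show "norm (sin z) \<le> exp m" by (simp add: sin_exp_eq norm_divide norm_mult)
qed

text \<open>The integrand of the Riesz kernel at the pair \<open>(h, \<omega>)\<close> with the vertical coordinate replaced by a
  complex number, and (primed) its derivative in that number.\<close>

definition riesz_extension :: "nat \<Rightarrow> real \<Rightarrow> real \<Rightarrow> real \<Rightarrow> complex \<Rightarrow> real \<times> real \<Rightarrow> complex" where
  "riesz_extension n a b \<rho> z q = of_real (riesz_density n \<rho> (fst q) (snd q))
     * (of_real (- 2 * a * heat_kappa (fst q) (snd q)) * cos (of_real (snd q) * z) - of_real (b * snd q) * sin (of_real (snd q) * z))"

definition riesz_extension' :: "nat \<Rightarrow> real \<Rightarrow> real \<Rightarrow> real \<Rightarrow> complex \<Rightarrow> real \<times> real \<Rightarrow> complex" where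
  "riesz_extension' n a b \<rho> z q = of_real (riesz_density n \<rho> (fst q) (snd q) * snd q)
     * (of_real (2 * a * heat_kappa (fst q) (snd q)) * sin (of_real (snd q) * z) - of_real (b * snd q) * cos (of_real (snd q) * z))"

definition riesz_dominant :: "nat \<Rightarrow> real \<Rightarrow> real \<Rightarrow> real \<Rightarrow> real \<times> real \<Rightarrow> real" where
  "riesz_dominant n a b \<rho> q = (indicator {0<..} (fst q) * time_weight n (\<rho> / 16) (fst q))
     * ((2 * \<bar>a\<bar> + \<bar>b\<bar>) * (indicator {0<..} (snd q) * ((1 + snd q)\<^sup>2 * exp (- (\<rho> / 4) * snd q))))"

lemma riesz_dominant_integrable:
  assumes "\<rho> > 0" "n \<ge> 1" shows "integrable lborel (riesz_dominant n a b \<rho>)"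
  unfolding riesz_dominant_def[abs_def]
  by (intro integral_lborel_product(1)[of "\<lambda>h. indicator {0<..} h * time_weight n (\<rho> / 16) h"
        "\<lambda>\<omega>. (2 * \<bar>a\<bar> + \<bar>b\<bar>) * (indicator {0<..} \<omega> * ((1 + \<omega>)\<^sup>2 * exp (- (\<rho> / 4) * \<omega>)))"]
      integrable_time_weight integrable_mult_right integrable_quadratic_exp_decay)
     (use assms in auto)

text \<open>The trigonometric functions grow at most like \<open>e\<^bsup>\<omega>\<rho>/2\<^esup>\<close> in the strip, and \<open>\<kappa> \<ge> \<omega>\<close> leaves
  \<open>e\<^bsup>-\<kappa>\<rho>/2\<^esup>\<close> of the Gaussian.  Splitting \<open>\<kappa> \<ge> \<omega>/2 + 1/8h\<close> gives a majorant that is a product of a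
  function of \<open>h\<close> and a function of \<open>\<omega>\<close>.\<close>

lemma riesz_extension_bounds:
  assumes \<rho>: "\<rho> > 0" and n: "n \<ge> 1" and z: "\<bar>Im z\<bar> \<le> \<rho> / 2"
  shows "norm (riesz_extension n a b \<rho> z q) \<le> riesz_dominant n a b \<rho> q"
    and "norm (riesz_extension' n a b \<rho> z q) \<le> riesz_dominant n a b \<rho> q"
proof -
  obtain h \<omega> where q: "q = (h, \<omega>)" by (cases q)
  have "norm (riesz_extension n a b \<rho> z q) \<le> riesz_dominant n a b \<rho> q
      \<and> norm (riesz_extension' n a b \<rho> z q) \<le> riesz_dominant n a b \<rho> q"
  proof (cases "h > 0 \<and> \<omega> > 0")
    case False
    then show ?thesis by (auto simp: q riesz_extension_def riesz_extension'_def riesz_dominant_def riesz_density_def)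
  next
    case True
    then have h: "h > 0" and \<omega>: "\<omega> > 0" by auto
    note k = heat_kappa_bounds[OF \<omega> h]
    let ?k = "heat_kappa h \<omega>"
    have k0: "0 \<le> ?k" using k(1) \<omega> by simp
    have "\<bar>Im (of_real \<omega> * z)\<bar> \<le> \<omega> * (\<rho> / 2)" using mult_left_mono[OF z, of \<omega>] \<omega> by (simp add: abs_mult)
    note trig = norm_trig_le_exp[OF this]
    let ?e = "exp (\<omega> * (\<rho> / 2))"
    have k_le: "?k \<le> (1 + \<omega>) * (1 + 1 / h)" and w_le: "\<omega> \<le> (1 + \<omega>) * (1 + 1 / h)"
    proof -
      have "1 / (4 * h) \<le> 1 / h" using h by (simp add: divide_simps)
      moreover have "0 \<le> \<omega> / h" using h \<omega> by simp
      moreover have "(1 + \<omega>) * (1 + 1 / h) = 1 + \<omega> + 1 / h + \<omega> / h" by (simp add: algebra_simps add_divide_distrib)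
      moreover have "0 \<le> 1 / h" using h by simp
      ultimately show "?k \<le> (1 + \<omega>) * (1 + 1 / h)" "\<omega> \<le> (1 + \<omega>) * (1 + 1 / h)" using k(3) by linarith+
    qed
    let ?B = "(2 * \<bar>a\<bar> + \<bar>b\<bar>) * ((1 + \<omega>) * (1 + 1 / h)) * ?e"
    have B: "2 * \<bar>a\<bar> * ?k * ?e + \<bar>b\<bar> * \<omega> * ?e \<le> ?B"
    proof -
      have "2 * \<bar>a\<bar> * ?k * ?e \<le> 2 * \<bar>a\<bar> * ((1 + \<omega>) * (1 + 1 / h)) * ?e"
        by (intro mult_right_mono mult_left_mono k_le) auto
      moreover have "\<bar>b\<bar> * \<omega> * ?e \<le> \<bar>b\<bar> * ((1 + \<omega>) * (1 + 1 / h)) * ?e"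
        by (intro mult_right_mono mult_left_mono w_le) auto
      moreover have "(2 * A + B) * Z * e = 2 * A * Z * e + B * Z * e" for A B Z e :: real
        by (simp add: algebra_simps)
      ultimately show ?thesis by simp
    qed
    have b1: "norm (of_real (- 2 * a * ?k) * cos (of_real \<omega> * z) - of_real (b * \<omega>) * sin (of_real \<omega> * z)) \<le> ?B"
    proof (rule order_trans[OF norm_triangle_ineq4], rule order_trans[OF _ B], rule add_mono)
      show "norm (of_real (- 2 * a * ?k) * cos (of_real \<omega> * z)) \<le> 2 * \<bar>a\<bar> * ?k * ?e"
        unfolding norm_mult norm_of_real using k0 trig by (intro mult_mono) (auto simp: abs_mult)
      show "norm (of_real (b * \<omega>) * sin (of_real \<omega> * z)) \<le> \<bar>b\<bar> * \<omega> * ?e"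
        unfolding norm_mult norm_of_real using \<omega> trig by (intro mult_mono) (auto simp: abs_mult)
    qed
    have b2: "norm (of_real (2 * a * ?k) * sin (of_real \<omega> * z) - of_real (b * \<omega>) * cos (of_real \<omega> * z)) \<le> ?B"
    proof (rule order_trans[OF norm_triangle_ineq4], rule order_trans[OF _ B], rule add_mono)
      show "norm (of_real (2 * a * ?k) * sin (of_real \<omega> * z)) \<le> 2 * \<bar>a\<bar> * ?k * ?e"
        unfolding norm_mult norm_of_real using k0 trig by (intro mult_mono) (auto simp: abs_mult)
      show "norm (of_real (b * \<omega>) * cos (of_real \<omega> * z)) \<le> \<bar>b\<bar> * \<omega> * ?e"
        unfolding norm_mult norm_of_real using \<omega> trig by (intro mult_mono) (auto simp: abs_mult)
    qed
    define E where "E = exp (- (\<rho> / 16) / h) * exp (- (\<rho> / 4) * \<omega>)"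
    have expo: "exp (- ?k * \<rho>) * ?e \<le> E"
    proof -
      have "\<omega> * \<rho> \<le> ?k * \<rho>" using k(1) \<rho> by (intro mult_right_mono) auto
      moreover have "1 / (4 * h) * \<rho> \<le> ?k * \<rho>" using k(2) \<rho> by (intro mult_right_mono) auto
      moreover have "1 / (4 * h) * \<rho> = 4 * (\<rho> / 16 / h)" by simp
      ultimately have "- ?k * \<rho> + \<omega> * (\<rho> / 2) \<le> - (\<rho> / 16) / h + - (\<rho> / 4) * \<omega>" by (simp add: algebra_simps)
      then show ?thesis by (simp add: E_def exp_add[symmetric])
    qed
    have factor: "(\<omega> / sinh (4 * \<omega> * h)) ^ n \<le> (1 / h) ^ n" "0 \<le> (\<omega> / sinh (4 * \<omega> * h)) ^ n"
    proof -
      note f = frequency_factor_bound[OF \<omega> h n]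
      show "0 \<le> (\<omega> / sinh (4 * \<omega> * h)) ^ n" using f(1) by simp
      have "(1 / h) ^ n * exp (- (2 * h) * \<omega>) \<le> (1 / h) ^ n * 1" using h \<omega> by (intro mult_left_mono) auto
      with f(2) show "(\<omega> / sinh (4 * \<omega> * h)) ^ n \<le> (1 / h) ^ n" by simp
    qed
    define P where "P = h powr (- 1 / 2)"
    have P: "0 \<le> P" by (simp add: P_def)
    have dens: "riesz_density n \<rho> h \<omega> = P * ((\<omega> / sinh (4 * \<omega> * h)) ^ n * exp (- ?k * \<rho>))"
      using h \<omega> by (simp add: riesz_density_def heat_profile_kappa P_def)
    have dens0: "0 \<le> riesz_density n \<rho> h \<omega>" unfolding dens using P factor(2) by simp
    have main: "riesz_density n \<rho> h \<omega> * ?B * (1 + \<omega>) \<le> riesz_dominant n a b \<rho> q"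
    proof -
      have "(\<omega> / sinh (4 * \<omega> * h)) ^ n * (exp (- ?k * \<rho>) * ?e) \<le> (1 / h) ^ n * E"
        using expo factor h by (intro mult_mono) auto
      then have l1: "P * ((2 * \<bar>a\<bar> + \<bar>b\<bar>) * ((1 + \<omega>)\<^sup>2 * (1 + 1 / h))) * ((\<omega> / sinh (4 * \<omega> * h)) ^ n * (exp (- ?k * \<rho>) * ?e))
          \<le> P * ((2 * \<bar>a\<bar> + \<bar>b\<bar>) * ((1 + \<omega>)\<^sup>2 * (1 + 1 / h))) * ((1 / h) ^ n * E)"
        using P h by (intro mult_left_mono) auto
      have l2: "riesz_density n \<rho> h \<omega> * ?B * (1 + \<omega>) = P * ((2 * \<bar>a\<bar> + \<bar>b\<bar>) * ((1 + \<omega>)\<^sup>2 * (1 + 1 / h)))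
          * ((\<omega> / sinh (4 * \<omega> * h)) ^ n * (exp (- ?k * \<rho>) * ?e))"
        unfolding dens power2_eq_square by (simp only: mult_ac)
      have l3: "riesz_dominant n a b \<rho> q = P * ((2 * \<bar>a\<bar> + \<bar>b\<bar>) * ((1 + \<omega>)\<^sup>2 * (1 + 1 / h))) * ((1 / h) ^ n * E)"
        using h \<omega> by (simp add: riesz_dominant_def q time_weight_def P_def E_def)
      show ?thesis unfolding l2 l3 by (rule l1)
    qed
    have B0: "0 \<le> ?B" using h \<omega> by simp
    have "norm (riesz_extension n a b \<rho> z q) \<le> riesz_density n \<rho> h \<omega> * ?B"
      unfolding riesz_extension_def q fst_conv snd_conv norm_mult[of "of_real (riesz_density n \<rho> h \<omega>)"] norm_of_real
      using dens0 b1 by (simp only: abs_of_nonneg) (rule mult_left_mono)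
    also have "\<dots> \<le> riesz_density n \<rho> h \<omega> * ?B * (1 + \<omega>)"
      using mult_left_mono[of 1 "1 + \<omega>" "riesz_density n \<rho> h \<omega> * ?B"] mult_nonneg_nonneg[OF dens0 B0] \<omega> by simp
    finally have r1: "norm (riesz_extension n a b \<rho> z q) \<le> riesz_dominant n a b \<rho> q" using main by linarith
    have "norm (riesz_extension' n a b \<rho> z q) \<le> riesz_density n \<rho> h \<omega> * \<omega> * ?B"
      unfolding riesz_extension'_def q fst_conv snd_conv norm_mult[of "of_real (riesz_density n \<rho> h \<omega> * \<omega>)"] norm_of_real
      using mult_nonneg_nonneg[OF dens0 less_imp_le[OF \<omega>]] b2 by (simp only: abs_of_nonneg less_imp_le) (rule mult_left_mono)
    also have "\<dots> = riesz_density n \<rho> h \<omega> * ?B * \<omega>" by (simp only: mult_ac)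
    also have "\<dots> \<le> riesz_density n \<rho> h \<omega> * ?B * (1 + \<omega>)"
      using mult_nonneg_nonneg[OF dens0 B0] by (intro mult_left_mono) auto
    finally have r2: "norm (riesz_extension' n a b \<rho> z q) \<le> riesz_dominant n a b \<rho> q" using main by linarith
    show ?thesis using r1 r2 by blast
  qed
  then show "norm (riesz_extension n a b \<rho> z q) \<le> riesz_dominant n a b \<rho> q"
    "norm (riesz_extension' n a b \<rho> z q) \<le> riesz_dominant n a b \<rho> q" by auto
qed

lemma riesz_extension_measurable:
  "riesz_extension n a b \<rho> z \<in> borel_measurable lborel" "riesz_extension' n a b \<rho> z \<in> borel_measurable lborel"
  unfolding riesz_extension_def[abs_def] riesz_extension'_def[abs_def] by measurable

lemma riesz_extension_integrable:
  assumes "\<rho> > 0" "n \<ge> 1" "\<bar>Im z\<bar> \<le> \<rho> / 2"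
  shows "integrable lborel (riesz_extension n a b \<rho> z)"
  by (rule Bochner_Integration.integrable_bound[OF riesz_dominant_integrable[OF assms(1,2), of a b] riesz_extension_measurable(1)])
     (use riesz_extension_bounds(1)[OF assms, of a b] in \<open>auto intro!: AE_I2 intro: order_trans[OF _ abs_ge_self]\<close>)

lemma riesz_extension_real: "riesz_extension n a b \<rho> (of_real t) q = of_real (riesz_integrand n a b \<rho> t (fst q) (snd q))"
proof -
  have "cos (of_real (snd q) * of_real t) = complex_of_real (cos (snd q * t))"
    "sin (of_real (snd q) * of_real t) = complex_of_real (sin (snd q * t))"
    by (simp_all add: cos_of_real sin_of_real flip: of_real_mult)
  then show ?thesis by (simp add: riesz_extension_def riesz_integrand_def)
qed

lemma riesz_integrand_integrable:
  assumes "\<rho> > 0" "n \<ge> 1"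
  shows "integrable lborel (\<lambda>q. riesz_integrand n a b \<rho> t (fst q) (snd q))"
  using riesz_extension_integrable[OF assms, of "of_real t" a b] assms
  by (simp add: riesz_extension_real[abs_def] complex_of_real_integrable_eq)

lemma open_convex_strip: "open {z. \<bar>Im z\<bar> < r}" "convex {z. \<bar>Im z\<bar> < r}"
proof -
  have S: "{z. \<bar>Im z\<bar> < r} = {z. Im z < r} \<inter> {z. Im z > - r}" by (auto simp: abs_less_iff)
  show "open {z. \<bar>Im z\<bar> < r}" "convex {z. \<bar>Im z\<bar> < r}"
    unfolding S by (intro open_Int open_halfspace_Im_lt open_halfspace_Im_gt convex_Int
        convex_halfspace_Im_lt convex_halfspace_Im_gt)+
qed

lemma riesz_integral_holomorphic:
  assumes "\<rho> > 0" "n \<ge> 1"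
  shows "(\<lambda>z. LINT q|lborel. riesz_extension n a b \<rho> z q) holomorphic_on {z. \<bar>Im z\<bar> < \<rho> / 2}"
proof -
  let ?S = "{z. \<bar>Im z\<bar> < \<rho> / 2}"
  note op = open_convex_strip(1)[of "\<rho> / 2"] and cv = open_convex_strip(2)[of "\<rho> / 2"]
  have "((\<lambda>z. LINT q|lborel. riesz_extension n a b \<rho> z q) has_field_derivative (LINT q|lborel. riesz_extension' n a b \<rho> z q)) (at z)"
    if "z \<in> ?S" for z
  proof (rule has_field_derivative_integral[OF op cv that, where f'="riesz_extension' n a b \<rho>"])
    show "integrable lborel (riesz_extension n a b \<rho> z)" if "z \<in> ?S" for z
      using that by (intro riesz_extension_integrable assms) auto
    show "riesz_extension' n a b \<rho> z \<in> borel_measurable lborel" by (rule riesz_extension_measurable)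
    show "((\<lambda>z. riesz_extension n a b \<rho> z q) has_field_derivative riesz_extension' n a b \<rho> z q) (at z)" for z q
      unfolding riesz_extension_def riesz_extension'_def
      by (auto intro!: derivative_eq_intros simp: algebra_simps)
    show "norm (riesz_extension' n a b \<rho> z q) \<le> riesz_dominant n a b \<rho> q" if "z \<in> ?S" for z q
      using that by (intro riesz_extension_bounds assms) auto
    show "integrable lborel (riesz_dominant n a b \<rho>)" by (rule riesz_dominant_integrable[OF assms])
  qed
  then show ?thesis by (subst holomorphic_on_open[OF op]) blast
qed

text \<open>At \<open>t = 0\<close> the sine vanishes and the integrand is \<open>-2a\<close> times a function that is positive for
  \<open>h, \<omega> > 0\<close>.\<close>

lemma riesz_integral_at_zero:
  assumes "\<rho> > 0" "n \<ge> 1" "a \<noteq> 0"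
  shows "(LINT q|lborel. riesz_integrand n a b \<rho> 0 (fst q) (snd q)) \<noteq> 0"
proof
  assume zero: "(LINT q|lborel. riesz_integrand n a b \<rho> 0 (fst q) (snd q)) = 0"
  let ?u = "\<lambda>q :: real \<times> real. riesz_density n \<rho> (fst q) (snd q) * heat_kappa (fst q) (snd q)"
  have eq: "riesz_integrand n a b \<rho> 0 (fst q) (snd q) = (- 2 * a) * ?u q" for q by (simp add: riesz_integrand_def)
  have pos: "?u q > 0" if "fst q > 0" "snd q > 0" for q
    using heat_profile_bound(1)[OF that(2,1), of \<rho> n] heat_kappa_bounds(1)[OF that(2,1)] assms that
    by (simp add: riesz_density_def)
  have nonneg: "?u q \<ge> 0" for q
    using pos[of q] by (cases "fst q > 0 \<and> snd q > 0") (auto simp: riesz_density_def intro: less_imp_le)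
  have "integrable lborel (\<lambda>q. (- 1 / (2 * a)) * riesz_integrand n a b \<rho> 0 (fst q) (snd q))"
    by (intro integrable_mult_right riesz_integrand_integrable assms)
  then have int: "integrable lborel ?u" unfolding eq using assms by simp
  have "(- 2 * a) * (LINT q|lborel. ?u q) = 0" using zero unfolding eq integral_mult_right_zero .
  then have "(LINT q|lborel. ?u q) = 0" using assms by simp
  then have "AE q in lborel. ?u q = 0" using integral_nonneg_eq_0_iff_AE[OF int] nonneg by simp
  then have ae: "AE q in lborel. q \<notin> ({0<..} \<times> {0<..} :: (real \<times> real) set)"
    by (rule eventually_mono) (use pos in force)
  have op: "open ({0<..} \<times> {0<..} :: (real \<times> real) set)" by (intro open_Times) auto
  then have "({0<..} \<times> {0<..} :: (real \<times> real) set) \<in> null_sets lborel"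
    using ae by (subst AE_iff_null_sets) (auto intro: borel_open)
  then have "negligible ({0<..} \<times> {0<..} :: (real \<times> real) set)" by (metis negligible_iff_null_sets null_sets_completionI)
  with op have "({0<..} \<times> {0<..} :: (real \<times> real) set) = {}" using open_not_negligible by blast
  moreover have "(1, 1) \<in> ({0<..} \<times> {0<..} :: (real \<times> real) set)" by simp
  ultimately show False by blast
qed

text \<open>A holomorphic function that does not vanish at the origin has countably many zeros in the strip,
  and in particular on the real line.\<close>

lemma riesz_integral_nonzero_AE:
  assumes "\<rho> > 0" "n \<ge> 1" "a \<noteq> 0"
  shows "AE t in lborel. (LINT h|lborel. LINT \<omega>|lborel. riesz_integrand n a b \<rho> t h \<omega>) \<noteq> 0"
proof -
  let ?S = "{z. \<bar>Im z\<bar> < \<rho> / 2}" and ?F = "\<lambda>z. LINT q|lborel. riesz_extension n a b \<rho> z q"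
  note op = open_convex_strip(1)[of "\<rho> / 2"] and cv = open_convex_strip(2)[of "\<rho> / 2"]
  have real: "?F (of_real t) = of_real (LINT h|lborel. LINT \<omega>|lborel. riesz_integrand n a b \<rho> t h \<omega>)" for t
    unfolding riesz_extension_real integral_complex_of_real
    using integral_swap_lborel(1)[OF riesz_integrand_integrable[OF assms(1,2), of a b t]] by simp
  have F0: "?F 0 \<noteq> 0"
    using riesz_integral_at_zero[OF assms, of b] riesz_extension_real[of n a b \<rho> 0]
    by (simp add: riesz_extension_real[of n a b \<rho> 0, simplified])
  have "countable {z \<in> ?S. ?F z = 0}"
  proof (cases "?F constant_on ?S")
    case True
    then obtain c where c: "\<And>z. z \<in> ?S \<Longrightarrow> ?F z = c" by (auto simp: constant_on_def)
    have "c \<noteq> 0" using c[of 0] F0 assms by simp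
    then have "{z \<in> ?S. ?F z = 0} = {}" using c by auto
    then show ?thesis by (simp only: countable_empty)
  next
    case False
    obtain C :: "nat \<Rightarrow> complex set" where "\<And>i. compact (C i)" "\<Union> (range C) = ?S"
      using open_Union_compact_subsets[OF op] by metis
    then have "fsigma ?S" unfolding fsigma_Union_compact by (intro exI[of _ C]) auto
    then show ?thesis
      by (rule holomorphic_countable_zeros[OF riesz_integral_holomorphic[OF assms(1,2)] op convex_connected[OF cv] _ False])
  qed
  then have "countable {t. ?F (of_real t) = 0}"
  proof (rule countable_subset[OF _ countable_image[of _ Re], rotated])
    show "{t. ?F (of_real t) = 0} \<subseteq> Re ` {z \<in> ?S. ?F z = 0}"
    proof
      fix t assume "t \<in> {t. ?F (of_real t) = 0}"
      then have "of_real t \<in> {z \<in> ?S. ?F z = 0}" using assms(1) by simp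
      then have "Re (of_real t) \<in> Re ` {z \<in> ?S. ?F z = 0}" by (rule imageI)
      then show "t \<in> Re ` {z \<in> ?S. ?F z = 0}" by simp
    qed
  qed
  then have "AE t in lborel. t \<notin> {t. ?F (of_real t) = 0}" by (intro AE_not_in countable_imp_null_set_lborel)
  then show ?thesis unfolding real by simp
qed

lemma riesz_kernel_eq_integral:
  fixes p :: "real \<Rightarrow> 'n::finite heis \<Rightarrow> real"
  assumes p: "heat_kernel p"
  shows "riesz_kernel p j g = 1 / (sqrt pi * identity_mass TYPE('n)) * (LINT h|lborel. LINT \<omega>|lborel.
    riesz_integrand CARD('n) (heis_coord j g) (heis_slope j g) (horiz g) (vert g) h \<omega>)"
proof -
  let ?C = "identity_mass TYPE('n)"
  have C: "?C > 0" by (rule identity_mass_pos)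
  have field: "heis_field j (p h) g = 1 / ?C * (LINT \<omega>|lborel. indicator {0<..} \<omega> *
    ((- 2 * heis_coord j g * heat_kappa h \<omega> * cos (\<omega> * vert g) - heis_slope j g * \<omega> * sin (\<omega> * vert g))
      * heat_profile CARD('n) h \<omega> (horiz g)))" if h: "h > 0" for h
  proof -
    have "p h = (\<lambda>g. 1 / ?C * heat_formula h g)"
    proof
      fix g
      have "?C * p h g = heat_formula h g"
        using heat_kernel_eq_formula[OF p h, of "- g"] by (simp add: heat_formula_uminus)
      then show "p h g = 1 / ?C * heat_formula h g" using C by (simp add: field_simps)
    qed
    then show ?thesis by (simp only: heis_field_heat_formula[OF h])
  qed
  have "indicator {0<..} h *\<^sub>R (h powr (- 1 / 2) * heis_field j (p h) g) = 1 / ?C * (LINT \<omega>|lborel.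
    riesz_integrand CARD('n) (heis_coord j g) (heis_slope j g) (horiz g) (vert g) h \<omega>)" for h :: real
  proof (cases "h > 0")
    case True
    have "(LINT \<omega>|lborel. riesz_integrand CARD('n) (heis_coord j g) (heis_slope j g) (horiz g) (vert g) h \<omega>)
      = (LINT \<omega>|lborel. h powr (- 1 / 2) * (indicator {0<..} \<omega> *
    ((- 2 * heis_coord j g * heat_kappa h \<omega> * cos (\<omega> * vert g) - heis_slope j g * \<omega> * sin (\<omega> * vert g))
      * heat_profile CARD('n) h \<omega> (horiz g))))"
      using True by (intro Bochner_Integration.integral_cong) (simp_all add: riesz_integrand_def riesz_density_def mult_ac)
    then show ?thesis unfolding integral_mult_right_zero field[OF True] using True by simp
  qed (simp add: riesz_integrand_def riesz_density_def)
  then show ?thesis unfolding riesz_kernel_def set_lebesgue_integral_def by simp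
qed

lemma heis_AE_I:
  fixes P :: "'n::finite heis \<Rightarrow> bool"
  assumes P: "{g. P g} \<in> sets borel" and ae: "AE x in lborel. AE y in lborel. AE t in lborel. P (x, y, t)"
  shows "AE g in lborel. P g"
proof -
  have "AE g in lborel \<Otimes>\<^sub>M lborel. P g"
  proof (rule lborel_pair.AE_pair_measure)
    show "{g \<in> space (lborel \<Otimes>\<^sub>M lborel). P g} \<in> sets (lborel \<Otimes>\<^sub>M lborel)" using P unfolding lborel_prod by simp
    show "AE x in lborel. AE q in lborel. P (x, q)"
      using ae
    proof eventually_elim
      case (elim x)
      have "AE q in lborel \<Otimes>\<^sub>M lborel. P (x, q)"
      proof (rule lborel_pair.AE_pair_measure)
        have "(\<lambda>q. (x, q)) \<in> borel \<rightarrow>\<^sub>M borel"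
          by (intro borel_measurable_continuous_onI continuous_intros)
        from measurable_sets[OF this P] show "{q \<in> space (lborel \<Otimes>\<^sub>M lborel). P (x, q)} \<in> sets (lborel \<Otimes>\<^sub>M lborel)"
          unfolding lborel_prod by (simp add: vimage_def)
        show "AE y in lborel. AE t in lborel. P (x, (y, t))" using elim .
      qed
      then show ?case unfolding lborel_prod .
    qed
  qed
  then show ?thesis unfolding lborel_prod .
qed

lemma AE_component_nonzero: "AE x in lborel. (x :: real^'n::finite) $ i \<noteq> 0"
proof -
  have "AE x in lborel. (x :: real^'n) \<bullet> axis i 1 \<noteq> 0"
    by (rule AE_lborel_inner_neq) (simp add: axis_in_Basis_iff)
  then show ?thesis by (simp add: inner_axis)
qed

lemma borel_heis_coord [measurable]: "heis_coord j \<in> borel_measurable borel"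
  and borel_heis_slope [measurable]: "heis_slope j \<in> borel_measurable borel"
proof -
  have "continuous_on UNIV (heis_coord j)"
    by (cases j) (auto simp: heis_coord_def[abs_def] intro!: continuous_intros)
  then show "heis_coord j \<in> borel_measurable borel" by (rule borel_measurable_continuous_onI)
  show "heis_slope j \<in> borel_measurable borel"
    by (intro borel_measurable_continuous_onI linear_continuous_on bounded_linear_heis_slope)
qed

theorem theorem1p5:
  fixes p :: "real \<Rightarrow> 'n::finite heis \<Rightarrow> real"
    and j :: "'n + 'n"
  assumes "heat_kernel p"
  shows "AE g in lborel. riesz_kernel p j g \<noteq> 0"
proof -
  define R where "R g = (LINT h|lborel. LINT \<omega>|lborel.
    riesz_integrand CARD('n) (heis_coord j g) (heis_slope j g) (horiz g) (vert g) h \<omega>)" for g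
  have [measurable]: "R \<in> borel_measurable borel"
    unfolding R_def[abs_def] riesz_integrand_def by measurable
  have line: "AE t in lborel. R (x, y, t) \<noteq> 0" if "heis_coord j (x, y, 0) \<noteq> 0" for x y
  proof -
    have "x \<noteq> 0 \<or> y \<noteq> 0" using that by (cases j) (auto simp: heis_coord_def)
    then have "x \<bullet> x > 0 \<or> y \<bullet> y > 0" by simp
    then have "x \<bullet> x + y \<bullet> y > 0" by (auto intro: add_pos_nonneg add_nonneg_pos)
    from riesz_integral_nonzero_AE[OF this _ that, of "CARD('n)" "heis_slope j (x, y, 0)"]
    have "AE t in lborel. (LINT h|lborel. LINT \<omega>|lborel. riesz_integrand CARD('n) (heis_coord j (x, y, 0))
        (heis_slope j (x, y, 0)) (x \<bullet> x + y \<bullet> y) t h \<omega>) \<noteq> 0" by simp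
    moreover have "R (x, y, t) = (LINT h|lborel. LINT \<omega>|lborel. riesz_integrand CARD('n) (heis_coord j (x, y, 0))
        (heis_slope j (x, y, 0)) (x \<bullet> x + y \<bullet> y) t h \<omega>)" for t
      by (cases j) (simp_all add: R_def heis_coord_def heis_slope_def)
    ultimately show ?thesis by (simp only:)
  qed
  have "AE g in lborel. R g \<noteq> 0"
  proof (rule heis_AE_I)
    show "{g. R g \<noteq> 0} \<in> sets borel" by measurable
    show "AE x in lborel. AE y in lborel. AE t in lborel. R (x, y, t) \<noteq> 0"
    proof (cases j)
      case (Inl i)
      show ?thesis using AE_component_nonzero[of i]
        by eventually_elim (auto intro!: AE_I2 line simp: heis_coord_def Inl)
    next
      case (Inr i)
      have "AE y in lborel. AE t in lborel. R (x, y, t) \<noteq> 0" for x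
        using AE_component_nonzero[of i] by eventually_elim (auto intro!: line simp: heis_coord_def Inr)
      then show ?thesis by (rule AE_I2)
    qed
  qed
  then show ?thesis
  proof eventually_elim
    case (elim g)
    then show ?case
      using identity_mass_pos[where 'n='n] unfolding riesz_kernel_eq_integral[OF assms] R_def by simp
  qed
qed

end
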